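(* Let $n\ge 2$, let $q$ be a power of a prime $p>n$, and let $\mathcal{S}\subset\mathbb{P}^n$ be an absolutely irreducible hypersurface defined over $\mathbb{F}_q$ by a homogeneous polynomial $F$, such that $p\nmid\deg(\mathcal{S})$ and $\sum_{i=0}^n \frac{\partial F}{\partial X_i}X_i^q$ is a nonzero polynomial. Assume that $\dim(\mathcal{S}_{\Phi_q})>0$. Then every curve $\mathcal{X}\subset\mathcal{S}_{\Phi_q}$ defined over $\mathbb{F}_q$ such that the restriction to $\mathcal{X}$ of the Gauss map of $\mathcal{S}$ is inseparable is $\mathbb{F}_q$-Frobenius nonclassical.
   Context: Varieties are projective and geometrically irreducible. A curve in $\mathbb{P}^n$ is such a variety of dimension $1$ which is nondegenerate, i.e. not contained in any hyperplane. $\mathbb{F}_q$-Frobenius nonclassical curves: let $\mathcal{X}\subset\mathbb{P}^n$ be a curve over $\mathbb{F}_q$ with coordinate functions $y_0,\dots,y_n\in\mathbb{F}_q(\mathcal{X})$ (residues of the $X_i/X_j$ for a fixed $X_j$ not vanishing identically on $\mathcal{X}$), $\zeta$ a separating element, $D_\zeta^{(k)}$ the $k$-th Hasse derivative with respect to $\zeta$. The $\mathbb{F}_q$-Frobenius order sequence of $\mathcal{X}$ is the lexicographically minimal sequence $0\le\nu_0<\dots<\nu_{n-1}$ such that the determinant of the $(n+1)\times(n+1)$ matrix with rows $(y_0^q,\dots,y_n^q)$ and $(D_\zeta^{(\nu_i)}y_0,\dots,D_\zeta^{(\nu_i)}y_n)$, $i=0,\dots,n-1$, is nonzero. $\mathcal{X}$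 is $\mathbb{F}_q$-Frobenius classical if $(\nu_0,\dots,\nu_{n-1})=(0,1,\dots,n-1)$ and $\mathbb{F}_q$-Frobenius nonclassical otherwise. $\Phi_q$ is the $\mathbb{F}_q$-Frobenius map (raising coordinates to the $q$-th power). $\mathcal{S}_{\operatorname{reg}}$ is the nonsingular locus of $\mathcal{S}$, $T_P(\mathcal{S})$ the tangent hyperplane at $P\in\mathcal{S}_{\operatorname{reg}}$, and $\mathcal{S}_{\Phi_q}=\{P\in\mathcal{S}_{\operatorname{reg}} : \Phi_q(P)\in T_P(\mathcal{S})\}$ is the $\mathbb{F}_q$-Frobenius nonclassical locus. The Gauss map of $\mathcal{S}$ is the rational map from $\mathcal{S}$ to the dual projective space $(\mathbb{P}^n)'$ sending $P\in\mathcal{S}_{\operatorname{reg}}$ to the dual of $T_P(\mathcal{S})$, i.e. the map given by the partial derivatives $\partial F/\partial X_i$. A rational map is inseparable if the extension of function fields of the source over that of the closure of the image is not separable. *)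

theory Defs
  imports
    "HOL-Library.Poly_Mapping"
    "HOL-Library.Extended_Nat"
    "HOL-Library.Cardinality"
    "HOL-Combinatorics.Permutations"
    "HOL-Algebra.Generated_Fields"
    "HOL-Algebra.Finite_Extensions"
    "HOL-Algebra.Polynomial_Divisibility"
    "HOL-Algebra.Algebraic_Closure_Type"
    "HOL-Analysis.Abstract_Topology"
begin

text \<open>The indeterminates are indexed by all natural numbers; a polynomial in \<open>X\<^sub>0, \<dots>, X\<^sub>n\<close> is one all of
  whose monomials have support in \<open>{..n}\<close>.\<close>

type_synonym 'a mpoly = "(nat \<Rightarrow>\<^sub>0 nat) \<Rightarrow>\<^sub>0 'a"

definition X_var :: "nat \<Rightarrow> 'a::comm_ring_1 mpoly" where
  "X_var i = Poly_Mapping.single (Poly_Mapping.single i 1) 1"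

definition mconst :: "'a::comm_ring_1 \<Rightarrow> 'a mpoly" where
  "mconst c = Poly_Mapping.single 0 c"

definition eval_mpoly :: "(nat \<Rightarrow> 'a) \<Rightarrow> 'a::comm_ring_1 mpoly \<Rightarrow> 'a" where
  "eval_mpoly x F =
     (\<Sum>m\<in>Poly_Mapping.keys F. Poly_Mapping.lookup F m *
        (\<Prod>i\<in>Poly_Mapping.keys m. x i ^ Poly_Mapping.lookup m i))"

definition partial :: "nat \<Rightarrow> 'a::comm_ring_1 mpoly \<Rightarrow> 'a mpoly" where
  "partial i F =
     (\<Sum>m\<in>Poly_Mapping.keys F.
        Poly_Mapping.single (m - Poly_Mapping.single i 1)
          (of_nat (Poly_Mapping.lookup m i) * Poly_Mapping.lookup F m))"

text \<open>The zero polynomial is homogeneous of every degree.\<close>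

definition homogeneous :: "nat \<Rightarrow> nat \<Rightarrow> 'a::comm_ring_1 mpoly \<Rightarrow> bool" where
  "homogeneous n d F \<longleftrightarrow>
     (\<forall>m\<in>Poly_Mapping.keys F.
        Poly_Mapping.keys m \<subseteq> {..n} \<and> (\<Sum>i\<le>n. Poly_Mapping.lookup m i) = d)"

definition base_change :: "'k::field mpoly \<Rightarrow> 'k alg_closure mpoly" where
  "base_change F = Poly_Mapping.map to_ac F"

definition proj_point :: "(nat \<Rightarrow> 'a) \<Rightarrow> (nat \<Rightarrow> 'a::field) set" where
  "proj_point v = {\<lambda>i. c * v i |c. c \<noteq> 0}"

definition proj_space :: "nat \<Rightarrow> (nat \<Rightarrow> 'a::field) set set" where
  "proj_space n = {proj_point v |v. (\<forall>i>n. v i = 0) \<and> (\<exists>i\<le>n. v i \<noteq> 0)}"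

definition zero_locus :: "nat \<Rightarrow> 'a::field mpoly set \<Rightarrow> (nat \<Rightarrow> 'a) set set" where
  "zero_locus n T = {P \<in> proj_space n. \<forall>G\<in>T. \<forall>v\<in>P. eval_mpoly v G = 0}"

definition zariski :: "nat \<Rightarrow> (nat \<Rightarrow> 'a::field) set topology" where
  "zariski n =
     topology_generated_by {proj_space n - zero_locus n {G} |G. \<exists>d. homogeneous n d G}"

definition irreducible_space :: "'a topology \<Rightarrow> bool" where
  "irreducible_space T \<longleftrightarrow> topspace T \<noteq> {} \<and>
     (\<forall>A B. closedin T A \<and> closedin T B \<and> topspace T = A \<union> B \<longrightarrow>
        A = topspace T \<or> B = topspace T)"

text \<open>Krull dimension: supremum of the lengths of strict chains of irreducible closed subsets.
  With values in \<^typ>\<open>enat\<close>, the empty space gets dimension 0.\<close>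

definition krull_dim :: "'a topology \<Rightarrow> enat" where
  "krull_dim T = Sup {enat r |r. \<exists>Z.
     (\<forall>i\<le>r. closedin T (Z i) \<and> irreducible_space (subtopology T (Z i))) \<and>
     (\<forall>i<r. Z i \<subset> Z (Suc i))}"

definition hyperplane :: "nat \<Rightarrow> (nat \<Rightarrow> 'a) \<Rightarrow> (nat \<Rightarrow> 'a::field) set set" where
  "hyperplane n a = {P \<in> proj_space n. \<forall>v\<in>P. (\<Sum>i\<le>n. a i * v i) = 0}"

text \<open>A curve defined over the (finite, hence perfect) field \<open>'k\<close>: the zero locus of homogeneous
  polynomials over \<open>'k\<close> in the projective space over the algebraic closure. Irreducibility refers to
  the Zariski topology over the algebraic closure, so it is geometric irreducibility.\<close>

definition projective_curve :: "nat \<Rightarrow> (nat \<Rightarrow> 'k::{field,finite} alg_closure) set set \<Rightarrow> bool" where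
  "projective_curve n V \<longleftrightarrow>
     (\<exists>T :: 'k mpoly set. (\<forall>G\<in>T. \<exists>d. homogeneous n d G) \<and> V = zero_locus n (base_change ` T)) \<and>
     irreducible_space (subtopology (zariski n) V) \<and>
     krull_dim (subtopology (zariski n) V) = 1 \<and>
     (\<forall>a. (\<exists>i\<le>n. a i \<noteq> 0) \<longrightarrow> \<not> V \<subseteq> hyperplane n a)"

text \<open>The hypersurface is the zero locus of an irreducible \<open>F\<close>, so nonsingularity is the Jacobian
  criterion for \<open>F\<close>.\<close>

definition hypersurface :: "nat \<Rightarrow> 'k::field mpoly \<Rightarrow> (nat \<Rightarrow> 'k alg_closure) set set" where
  "hypersurface n F = zero_locus n {base_change F}"

definition regular_locus :: "nat \<Rightarrow> 'k::field mpoly \<Rightarrow> (nat \<Rightarrow> 'k alg_closure) set set" where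
  "regular_locus n F =
     {P \<in> hypersurface n F. \<forall>v\<in>P. \<exists>i\<le>n. eval_mpoly v (base_change (partial i F)) \<noteq> 0}"

definition tangent_hyperplane ::
    "nat \<Rightarrow> 'k::field mpoly \<Rightarrow> (nat \<Rightarrow> 'k alg_closure) set \<Rightarrow> (nat \<Rightarrow> 'k alg_closure) set set" where
  "tangent_hyperplane n F P =
     (\<Inter>v\<in>P. hyperplane n (\<lambda>i. eval_mpoly v (base_change (partial i F))))"

definition frobenius_map :: "nat \<Rightarrow> (nat \<Rightarrow> 'a::field) set \<Rightarrow> (nat \<Rightarrow> 'a) set" where
  "frobenius_map q P = (\<Union>v\<in>P. proj_point (\<lambda>i. v i ^ q))"

definition frobenius_nonclassical_locus ::
    "nat \<Rightarrow> nat \<Rightarrow> 'k::field mpoly \<Rightarrow> (nat \<Rightarrow> 'k alg_closure) set set" where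
  "frobenius_nonclassical_locus n q F =
     {P \<in> regular_locus n F. frobenius_map q P \<in> tangent_hyperplane n F P}"

text \<open>The function field over \<open>'k\<close> consists of the quotients \<open>G/H\<close> of homogeneous polynomials over
  \<open>'k\<close> of equal degree with \<open>H\<close> not vanishing identically on \<open>V\<close>, where \<open>G/H\<close> and \<open>G'/H'\<close> are
  identified if \<open>G H' - G' H\<close> vanishes on \<open>V\<close>. An element is such an equivalence class of pairs.\<close>

definition vanishes_on :: "'k::field mpoly \<Rightarrow> (nat \<Rightarrow> 'k alg_closure) set set \<Rightarrow> bool" where
  "vanishes_on G V \<longleftrightarrow> (\<forall>P\<in>V. \<forall>v\<in>P. eval_mpoly v (base_change G) = 0)"

definition fractions ::
    "nat \<Rightarrow> (nat \<Rightarrow> 'k::field alg_closure) set set \<Rightarrow> ('k mpoly \<times> 'k mpoly) set" where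
  "fractions n V =
     {(G, H). (\<exists>d. homogeneous n d G \<and> homogeneous n d H) \<and> \<not> vanishes_on H V}"

definition ratio ::
    "nat \<Rightarrow> (nat \<Rightarrow> 'k::field alg_closure) set set \<Rightarrow> 'k mpoly \<Rightarrow> 'k mpoly
      \<Rightarrow> ('k mpoly \<times> 'k mpoly) set" where
  "ratio n V G H = {(G', H') \<in> fractions n V. vanishes_on (G * H' - G' * H) V}"

definition function_field ::
    "nat \<Rightarrow> (nat \<Rightarrow> 'k::field alg_closure) set set \<Rightarrow> ('k mpoly \<times> 'k mpoly) set ring" where
  "function_field n V =
     \<lparr>carrier = {ratio n V G H |G H. (G, H) \<in> fractions n V},
      monoid.mult = (\<lambda>a b. \<Union>(G, H)\<in>a. \<Union>(G', H')\<in>b. ratio n V (G * G') (H * H')),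
      one = ratio n V 1 1,
      zero = ratio n V 0 1,
      add = (\<lambda>a b. \<Union>(G, H)\<in>a. \<Union>(G', H')\<in>b. ratio n V (G * H' + G' * H) (H * H'))\<rparr>"

definition constants ::
    "nat \<Rightarrow> (nat \<Rightarrow> 'k::field alg_closure) set set \<Rightarrow> ('k mpoly \<times> 'k mpoly) set set" where
  "constants n V = {ratio n V (mconst c) 1 |c. True}"

text \<open>For an algebraic element, separability over \<open>L\<close> means being a simple root of its minimal
  polynomial \<^const>\<open>ring.Irr\<close>. A (not necessarily algebraic) extension is called separable if it is
  separable algebraic over a purely transcendental subextension; for the finitely generated
  extensions occurring here this is the usual notion.\<close>

definition separable_element :: "('a, 'b) ring_scheme \<Rightarrow> 'a set \<Rightarrow> 'a \<Rightarrow> bool" where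
  "separable_element K L a \<longleftrightarrow>
     ring.algebraic K L a \<and> ring.alg_mult K (ring.Irr K L a) a = 1"

definition separable_extension :: "('a, 'b) ring_scheme \<Rightarrow> 'a set \<Rightarrow> bool" where
  "separable_extension K L \<longleftrightarrow>
     (\<exists>B\<subseteq>carrier K.
        (\<forall>b\<in>B. ring.transcendental K (generate_field K (L \<union> (B - {b}))) b) \<and>
        (\<forall>a\<in>carrier K. separable_element K (generate_field K (L \<union> B)) a))"

text \<open>Meant for the function field \<open>K\<close> of a curve over \<open>C\<close>, so that a single transcendental element suffices.\<close>

definition separating_element :: "('a, 'b) ring_scheme \<Rightarrow> 'a set \<Rightarrow> 'a \<Rightarrow> bool" where
  "separating_element K C z \<longleftrightarrow> z \<in> carrier K \<and> ring.transcendental K C z \<and>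
     (\<forall>a\<in>carrier K. separable_element K (generate_field K (insert z C)) a)"

text \<open>The function field over \<open>'k\<close> of the closure of the image of \<open>V\<close> under the Gauss map
  \<open>(\<partial>F/\<partial>X\<^sub>0 : \<dots> : \<partial>F/\<partial>X\<^sub>n)\<close>, embedded by pullback in the function field of \<open>V\<close>. The function field
  of the closure is generated over the constants by the ratios of its homogeneous coordinates, and
  these pull back to the ratios of the partial derivatives.\<close>

definition gauss_image_field ::
    "nat \<Rightarrow> 'k::field mpoly \<Rightarrow> (nat \<Rightarrow> 'k alg_closure) set set
      \<Rightarrow> ('k mpoly \<times> 'k mpoly) set set" where
  "gauss_image_field n F V =
     generate_field (function_field n V)
       (constants n V \<union>
        {ratio n V (partial i F) (partial j F) |i j.
           i \<le> n \<and> j \<le> n \<and> \<not> vanishes_on (partial j F) V})"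

definition gauss_map_inseparable ::
    "nat \<Rightarrow> 'k::field mpoly \<Rightarrow> (nat \<Rightarrow> 'k alg_closure) set set \<Rightarrow> bool" where
  "gauss_map_inseparable n F V \<longleftrightarrow>
     \<not> separable_extension (function_field n V) (gauss_image_field n F V)"

text \<open>The Hasse derivatives of \<open>K\<close> with respect to a separating element \<open>z\<close>: the (unique) extension
  of \<open>D\<^sup>(\<^sup>k\<^sup>) z\<^sup>m = (m choose k) z\<^sup>m\<^sup>-\<^sup>k\<close> to a family of maps, linear over the constants \<open>C\<close>, with
  \<open>D\<^sup>(\<^sup>0\<^sup>) = id\<close> and the product rule.\<close>

definition hasse_derivatives ::
    "('a, 'b) ring_scheme \<Rightarrow> 'a set \<Rightarrow> 'a \<Rightarrow> (nat \<Rightarrow> 'a \<Rightarrow> 'a) \<Rightarrow> bool" where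
  "hasse_derivatives K C z D \<longleftrightarrow>
     (\<forall>k. \<forall>f\<in>carrier K. D k f \<in> carrier K) \<and>
     (\<forall>f\<in>carrier K. D 0 f = f) \<and>
     (\<forall>k. \<forall>f\<in>carrier K. \<forall>g\<in>carrier K. D k (f \<oplus>\<^bsub>K\<^esub> g) = D k f \<oplus>\<^bsub>K\<^esub> D k g) \<and>
     (\<forall>k. \<forall>c\<in>C. \<forall>f\<in>carrier K. D k (c \<otimes>\<^bsub>K\<^esub> f) = c \<otimes>\<^bsub>K\<^esub> D k f) \<and>
     (\<forall>k. \<forall>f\<in>carrier K. \<forall>g\<in>carrier K.
        D k (f \<otimes>\<^bsub>K\<^esub> g) = (\<Oplus>\<^bsub>K\<^esub>i\<in>{..k}. D i f \<otimes>\<^bsub>K\<^esub> D (k - i) g)) \<and>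
     (\<forall>k m::nat. D k (z [^]\<^bsub>K\<^esub> m) = [(m choose k)] \<cdot>\<^bsub>K\<^esub> (z [^]\<^bsub>K\<^esub> (m - k)))"

definition ring_det :: "('a, 'b) ring_scheme \<Rightarrow> nat \<Rightarrow> (nat \<Rightarrow> nat \<Rightarrow> 'a) \<Rightarrow> 'a" where
  "ring_det K N A =
     (\<Oplus>\<^bsub>K\<^esub>\<sigma>\<in>{\<sigma>. \<sigma> permutes {..<N}}.
        (if evenperm \<sigma> then \<one>\<^bsub>K\<^esub> else \<ominus>\<^bsub>K\<^esub> \<one>\<^bsub>K\<^esub>) \<otimes>\<^bsub>K\<^esub> (\<Otimes>\<^bsub>K\<^esub>i\<in>{..<N}. A i (\<sigma> i)))"

text \<open>Row \<open>0\<close> is \<open>(y\<^sub>0\<^sup>q, \<dots>, y\<^sub>n\<^sup>q)\<close>; row \<open>i + 1\<close> consists of the derivatives of order \<open>\<nu>\<^sub>i\<close>.\<close>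

definition frobenius_matrix ::
    "('a, 'b) ring_scheme \<Rightarrow> nat \<Rightarrow> (nat \<Rightarrow> 'a) \<Rightarrow> (nat \<Rightarrow> 'a \<Rightarrow> 'a) \<Rightarrow> nat list \<Rightarrow> nat \<Rightarrow> nat \<Rightarrow> 'a" where
  "frobenius_matrix K q y D \<nu> i j =
     (case i of 0 \<Rightarrow> y j [^]\<^bsub>K\<^esub> q | Suc i' \<Rightarrow> D (\<nu> ! i') (y j))"

definition frobenius_admissible ::
    "('a, 'b) ring_scheme \<Rightarrow> nat \<Rightarrow> nat \<Rightarrow> (nat \<Rightarrow> 'a) \<Rightarrow> (nat \<Rightarrow> 'a \<Rightarrow> 'a) \<Rightarrow> nat list \<Rightarrow> bool" where
  "frobenius_admissible K n q y D \<nu> \<longleftrightarrow> length \<nu> = n \<and> sorted_wrt (<) \<nu> \<and>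
     ring_det K (Suc n) (frobenius_matrix K q y D \<nu>) \<noteq> \<zero>\<^bsub>K\<^esub>"

definition coord_fun ::
    "nat \<Rightarrow> (nat \<Rightarrow> 'k::field alg_closure) set set \<Rightarrow> nat \<Rightarrow> nat \<Rightarrow> ('k mpoly \<times> 'k mpoly) set" where
  "coord_fun n V j i = ratio n V (X_var i) (X_var j)"

text \<open>\<open>\<nu>\<close> is the Frobenius order sequence of the curve \<open>V\<close> over \<open>'k\<close>, the field with \<open>q = CARD('k)\<close>
  elements. It does not depend on the choice of \<open>j\<close> and of the
  separating element \<open>z\<close>, and \<open>D\<close> is determined by \<open>z\<close>.\<close>

definition frobenius_order_sequence ::
    "nat \<Rightarrow> (nat \<Rightarrow> 'k::{field,finite} alg_closure) set set \<Rightarrow> nat list \<Rightarrow> bool" where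
  "frobenius_order_sequence n V \<nu> \<longleftrightarrow>
     (\<exists>j z D. j \<le> n \<and> \<not> vanishes_on (X_var j :: 'k mpoly) V \<and>
        separating_element (function_field n V) (constants n V) z \<and>
        hasse_derivatives (function_field n V) (constants n V) z D \<and>
        frobenius_admissible (function_field n V) n CARD('k) (coord_fun n V j) D \<nu> \<and>
        (\<forall>\<mu>. frobenius_admissible (function_field n V) n CARD('k) (coord_fun n V j) D \<mu>
              \<longrightarrow> \<mu> = \<nu> \<or> (\<nu>, \<mu>) \<in> lex less_than))"

definition frobenius_classical ::
    "nat \<Rightarrow> (nat \<Rightarrow> 'k::{field,finite} alg_closure) set set \<Rightarrow> bool" where
  "frobenius_classical n V \<longleftrightarrow> frobenius_order_sequence n V [0..<n]"

abbreviation frobenius_nonclassical ::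
    "nat \<Rightarrow> (nat \<Rightarrow> 'k::{field,finite} alg_closure) set set \<Rightarrow> bool" where
  "frobenius_nonclassical n V \<equiv> \<not> frobenius_classical n V"

end

theory Submission
  imports Defs "HOL-Number_Theory.Residues"
begin

text \<open>
  Let \<open>K\<close> be the function field of the curve \<open>V\<close>, let \<open>y\<^sub>0, \<dots>, y\<^sub>n\<close> be its coordinate functions, and let
  \<open>w\<^sub>i\<close> be the restriction to \<open>V\<close> of \<open>\<partial>F/\<partial>X\<^sub>i\<close> divided by one partial derivative that does not vanish on \<open>V\<close>.
  The \<open>w\<^sub>i\<close> lie in the function field \<open>L\<close> of the image of the Gauss map. Euler's identity gives
  \<open>\<Sum> w\<^sub>i y\<^sub>i = 0\<close>, and \<open>V\<close> being in the Frobenius nonclassical locus gives \<open>\<Sum> w\<^sub>i y\<^sub>i\<^sup>q = 0\<close>.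

  If every Hasse derivative \<open>D\<^sup>(\<^sup>k\<^sup>)\<close> with \<open>0 < k < n\<close> kills every \<open>w\<^sub>i\<close>, then applying \<open>D\<^sup>(\<^sup>k\<^sup>)\<close> to the first
  relation gives \<open>\<Sum> w\<^sub>i D\<^sup>(\<^sup>k\<^sup>) y\<^sub>i = 0\<close> for \<open>k < n\<close>. So the columns of the Frobenius matrix for the orders
  \<open>0, \<dots>, n - 1\<close> satisfy a nontrivial linear relation and its determinant is zero
  (\<open>frobenius_det_zero_if_inseparable\<close>), which means that \<open>V\<close> is not Frobenius classical.

  That the Hasse derivatives of the \<open>w\<^sub>i\<close> vanish rests on two facts.

  \<^item> If some \<open>w \<in> L\<close> has \<open>D\<^sup>(\<^sup>1\<^sup>) w \<noteq> 0\<close>, then \<open>K\<close> is separable over \<open>L\<close> (\<open>separable_over_nonconstant\<close>).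
    Any \<open>a \<in> K\<close> satisfies a polynomial relation \<open>P(a, w) = 0\<close> over the constants. In a smallest such
    relation the partial derivatives of \<open>P\<close> cannot both vanish at \<open>(a, w)\<close>: they are smaller relations, so
    both would be the zero polynomial, and \<open>P\<close> would be a \<open>p\<close>-th power because the constants are perfect
    (\<open>separable_relation\<close>). Differentiating \<open>P(a, w) = 0\<close> and using \<open>D\<^sup>(\<^sup>1\<^sup>) w \<noteq> 0\<close> shows that \<open>a\<close> is a
    simple root of \<open>P(X, w)\<close>. Hence an inseparable Gauss map forces \<open>D\<^sup>(\<^sup>1\<^sup>) w\<^sub>i = 0\<close>.

  \<^item> The composition rule \<open>(k + 1) D\<^sup>(\<^sup>k\<^sup>+\<^sup>1\<^sup>) = D\<^sup>(\<^sup>k\<^sup>) D\<^sup>(\<^sup>1\<^sup>)\<close> (\<open>hasse_compose\<close>) propagates the vanishing to all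
    orders below \<open>p\<close>, where \<open>k + 1\<close> is invertible; \<open>p > n\<close> makes this enough.
\<close>

section \<open>Polynomial values from coefficient functions\<close>

context cring begin

lemma finsum_lessThan_Suc:
  fixes n :: nat
  assumes "f \<in> {..<Suc n} \<rightarrow> carrier R"
  shows "(\<Oplus>i\<in>{..<Suc n}. f i) = (\<Oplus>i\<in>{..<n}. f i) \<oplus> f n"
proof -
  have "{..<Suc n} = insert n {..<n}" by auto
  thus ?thesis using assms by (simp add: finsum_insert Pi_def a_comm finsum_closed)
qed

text \<open>A polynomial is given by a coefficient function and a bound on its support; \<open>psum\<close> and \<open>dpsum\<close>
  are the values of the polynomial and of its formal derivative. Relations in two variables are obtained
  by nesting, which coefficient lists do not support well.\<close>

definition psum :: "nat \<Rightarrow> (nat \<Rightarrow> 'a) \<Rightarrow> 'a \<Rightarrow> 'a" where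
  "psum N u x = (\<Oplus>i\<in>{..<N}. u i \<otimes> x [^] i)"

definition dpsum :: "nat \<Rightarrow> (nat \<Rightarrow> 'a) \<Rightarrow> 'a \<Rightarrow> 'a" where
  "dpsum N u x = (\<Oplus>i\<in>{..<N}. [i] \<cdot> (u i \<otimes> x [^] (i - 1)))"

lemma psum_0 [simp]: "psum 0 u x = \<zero>"
  by (simp add: psum_def finsum_empty)

lemma dpsum_0 [simp]: "dpsum 0 u x = \<zero>"
  by (simp add: dpsum_def finsum_empty)

lemma psum_Suc:
  assumes "\<And>i. u i \<in> carrier R" "x \<in> carrier R"
  shows "psum (Suc N) u x = psum N u x \<oplus> u N \<otimes> x [^] N"
  using assms unfolding psum_def by (subst finsum_lessThan_Suc) auto

lemma dpsum_Suc:
  assumes "\<And>i. u i \<in> carrier R" "x \<in> carrier R"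
  shows "dpsum (Suc N) u x = dpsum N u x \<oplus> [N] \<cdot> (u N \<otimes> x [^] (N - 1))"
  using assms unfolding dpsum_def by (subst finsum_lessThan_Suc) auto

lemma psum_closed [simp, intro]:
  assumes "\<And>i. u i \<in> carrier R" "x \<in> carrier R"
  shows "psum N u x \<in> carrier R"
  using assms by (induction N) (auto simp: psum_Suc)

lemma dpsum_closed [simp, intro]:
  assumes "\<And>i. u i \<in> carrier R" "x \<in> carrier R"
  shows "dpsum N u x \<in> carrier R"
  using assms by (induction N) (auto simp: dpsum_Suc)

lemma psum_cong:
  assumes "\<And>i. i < N \<Longrightarrow> u i = v i" "\<And>i. v i \<in> carrier R" "x \<in> carrier R"
  shows "psum N u x = psum N v x"
  unfolding psum_def using assms by (intro finsum_cong') auto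

lemma psum_zero:
  assumes "\<And>i. i < N \<Longrightarrow> u i = \<zero>" "x \<in> carrier R"
  shows "psum N u x = \<zero>"
proof -
  have "psum N u x = psum N (\<lambda>_. \<zero>) x" by (rule psum_cong) (use assms in auto)
  also have "\<dots> = \<zero>" using assms(2) by (induction N) (auto simp: psum_Suc)
  finally show ?thesis .
qed

lemma psum_add:
  assumes "\<And>i. u i \<in> carrier R" "\<And>i. v i \<in> carrier R" "x \<in> carrier R"
  shows "psum N (\<lambda>i. u i \<oplus> v i) x = psum N u x \<oplus> psum N v x"
proof (induction N)
  case (Suc N)
  have c: "psum N u x \<in> carrier R" "psum N v x \<in> carrier R" "u N \<in> carrier R" "v N \<in> carrier R"
    "x [^] N \<in> carrier R" using assms by auto
  from c have "(psum N u x \<oplus> psum N v x) \<oplus> (u N \<oplus> v N) \<otimes> x [^] N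
    = (psum N u x \<oplus> u N \<otimes> x [^] N) \<oplus> (psum N v x \<oplus> v N \<otimes> x [^] N)" by algebra
  thus ?case using assms Suc by (simp add: psum_Suc)
qed simp

lemma psum_mult_left:
  assumes "\<And>i. u i \<in> carrier R" "a \<in> carrier R" "x \<in> carrier R"
  shows "psum N (\<lambda>i. a \<otimes> u i) x = a \<otimes> psum N u x"
proof (induction N)
  case (Suc N)
  have c: "psum N u x \<in> carrier R" "u N \<in> carrier R" "x [^] N \<in> carrier R" using assms by auto
  with assms(2) have "a \<otimes> psum N u x \<oplus> (a \<otimes> u N) \<otimes> x [^] N
    = a \<otimes> (psum N u x \<oplus> u N \<otimes> x [^] N)" by algebra
  thus ?case using assms Suc by (simp add: psum_Suc)
qed (use assms in simp)

lemma psum_mult_right: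
  assumes "\<And>i. u i \<in> carrier R" "a \<in> carrier R" "x \<in> carrier R"
  shows "psum N (\<lambda>i. u i \<otimes> a) x = psum N u x \<otimes> a"
proof -
  have "(\<lambda>i. u i \<otimes> a) = (\<lambda>i. a \<otimes> u i)" using assms m_comm by auto
  moreover have "a \<otimes> psum N u x = psum N u x \<otimes> a" using assms m_comm psum_closed by auto
  ultimately show ?thesis using psum_mult_left[OF assms] by simp
qed

lemma psum_add_pow:
  assumes "\<And>i. u i \<in> carrier R" "x \<in> carrier R"
  shows "psum N (\<lambda>i. [(k::nat)] \<cdot> u i) x = [k] \<cdot> psum N u x"
proof (induction N)
  case (Suc N)
  have "([k] \<cdot> u N) \<otimes> x [^] N = [k] \<cdot> (u N \<otimes> x [^] N)"
    using assms by (intro add_pow_ldistr) auto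
  thus ?case using assms Suc by (simp add: psum_Suc add.nat_pow_distrib)
qed (simp add: add.nat_pow_one)

lemma psum_swap:
  assumes "\<And>i j. c i j \<in> carrier R" "x \<in> carrier R" "y \<in> carrier R"
  shows "psum N (\<lambda>i. psum M (c i) y) x = psum M (\<lambda>j. psum N (\<lambda>i. c i j) x) y"
proof (induction N)
  case 0
  show ?case using assms by (simp add: psum_zero)
next
  case (Suc N)
  have "psum M (\<lambda>j. psum (Suc N) (\<lambda>i. c i j) x) y
      = psum M (\<lambda>j. psum N (\<lambda>i. c i j) x \<oplus> c N j \<otimes> x [^] N) y"
    using assms by (intro psum_cong) (auto simp: psum_Suc)
  also have "\<dots> = psum M (\<lambda>j. psum N (\<lambda>i. c i j) x) y \<oplus> psum M (c N) y \<otimes> x [^] N"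
    using assms by (subst psum_add) (auto simp: psum_mult_right)
  finally show ?case using assms Suc by (simp add: psum_Suc)
qed

lemma psum_extend:
  assumes "\<And>i. u i \<in> carrier R" "x \<in> carrier R" "\<And>i. i \<ge> N \<Longrightarrow> u i = \<zero>"
  shows "psum (N + k) u x = psum N u x"
  using assms by (induction k) (auto simp: psum_Suc)

lemma psum_extend_le:
  assumes "\<And>i. u i \<in> carrier R" "x \<in> carrier R" "\<And>i. i \<ge> N \<Longrightarrow> u i = \<zero>" "N \<le> M"
  shows "psum M u x = psum N u x"
  using psum_extend[of u x N "M - N"] assms by simp

lemma dpsum_extend:
  assumes "\<And>i. u i \<in> carrier R" "x \<in> carrier R" "\<And>i. i \<ge> N \<Longrightarrow> u i = \<zero>" "N \<le> M"
  shows "dpsum M u x = dpsum N u x"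
proof -
  have "dpsum (N + k) u x = dpsum N u x" for k
    using assms(1-3) by (induction k) (auto simp: dpsum_Suc)
  from this[of "M - N"] assms(4) show ?thesis by simp
qed

lemma dpsum_shift:
  assumes "\<And>i. u i \<in> carrier R" "x \<in> carrier R"
  shows "dpsum (Suc N) u x = psum N (\<lambda>i. [Suc i] \<cdot> u (Suc i)) x"
proof (induction N)
  case 0
  show ?case using assms by (simp add: dpsum_Suc)
next
  case (Suc N)
  have "dpsum (Suc (Suc N)) u x = dpsum (Suc N) u x \<oplus> [Suc N] \<cdot> (u (Suc N) \<otimes> x [^] N)"
    using assms by (subst dpsum_Suc) auto
  also have "\<dots> = psum (Suc N) (\<lambda>i. [Suc i] \<cdot> u (Suc i)) x"
    unfolding Suc using assms by (simp add: psum_Suc add_pow_ldistr del: add.nat_pow_Suc)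
  finally show ?case .
qed

text \<open>The coefficients of \<open>(X - a) h\<close> are \<open>h\<^sub>i\<^sub>-\<^sub>1 - a h\<^sub>i\<close>, so the left-hand side is the derivative of
  \<open>(X - a) h\<close> at \<open>a\<close>. For \<open>N\<close> beyond the degree of \<open>h\<close> the correction term disappears and what is left is
  the product rule: that derivative is \<open>h(a)\<close>.\<close>

lemma psum_telescope:
  assumes "\<And>i. h i \<in> carrier R" "a \<in> carrier R"
  shows "psum N (\<lambda>i. [Suc i] \<cdot> (h i \<ominus> a \<otimes> h (Suc i))) a
       = psum N h a \<ominus> [N] \<cdot> (h N \<otimes> a [^] N)"
proof (induction N)
  case 0
  show ?case using assms by (simp add: minus_eq)
next
  case (Suc N)
  define H where "H = psum N h a"
  define b where "b = [N] \<cdot> (h N \<otimes> a [^] N)"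
  define c where "c = [N] \<cdot> (h (Suc N) \<otimes> a [^] Suc N)"
  have cl: "H \<in> carrier R" "b \<in> carrier R" "c \<in> carrier R" "h N \<in> carrier R" "h (Suc N) \<in> carrier R"
    "a [^] N \<in> carrier R" using assms by (auto simp: H_def b_def c_def)
  have e1: "([N] \<cdot> (h N \<ominus> a \<otimes> h (Suc N))) \<otimes> a [^] N = b \<ominus> c"
  proof -
    have "([N] \<cdot> (h N \<ominus> a \<otimes> h (Suc N))) \<otimes> a [^] N = [N] \<cdot> ((h N \<ominus> a \<otimes> h (Suc N)) \<otimes> a [^] N)"
      using assms cl by (intro add_pow_ldistr) auto
    also have "(h N \<ominus> a \<otimes> h (Suc N)) \<otimes> a [^] N = h N \<otimes> a [^] N \<oplus> \<ominus> (h (Suc N) \<otimes> (a [^] N \<otimes> a))"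
      using assms(2) cl by algebra
    also have "[N] \<cdot> (h N \<otimes> a [^] N \<oplus> \<ominus> (h (Suc N) \<otimes> (a [^] N \<otimes> a))) = b \<ominus> c"
      using assms cl by (simp add: b_def c_def add.nat_pow_distrib minus_eq add.nat_pow_inv)
    finally show ?thesis .
  qed
  have "psum (Suc N) (\<lambda>i. [Suc i] \<cdot> (h i \<ominus> a \<otimes> h (Suc i))) a
      = (H \<ominus> b) \<oplus> ([Suc N] \<cdot> (h N \<ominus> a \<otimes> h (Suc N))) \<otimes> a [^] N"
    using assms Suc by (simp add: psum_Suc H_def b_def)
  also have "([Suc N] \<cdot> (h N \<ominus> a \<otimes> h (Suc N))) \<otimes> a [^] N
     = (b \<ominus> c) \<oplus> (h N \<ominus> a \<otimes> h (Suc N)) \<otimes> a [^] N"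
    unfolding e1[symmetric] using assms cl by (simp add: l_distr)
  also have "(H \<ominus> b) \<oplus> ((b \<ominus> c) \<oplus> (h N \<ominus> a \<otimes> h (Suc N)) \<otimes> a [^] N)
     = (H \<oplus> h N \<otimes> a [^] N) \<ominus> (c \<oplus> h (Suc N) \<otimes> (a [^] N \<otimes> a))"
    using assms(2) cl by algebra
  finally show ?case using assms by (simp add: psum_Suc H_def c_def)
qed

end

section \<open>Derivations of a field\<close>

definition (in ring) derivation :: "('a \<Rightarrow> 'a) \<Rightarrow> bool" where
  "derivation \<delta> \<longleftrightarrow> (\<forall>x\<in>carrier R. \<delta> x \<in> carrier R) \<and>
     (\<forall>x\<in>carrier R. \<forall>y\<in>carrier R. \<delta> (x \<oplus> y) = \<delta> x \<oplus> \<delta> y) \<and>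
     (\<forall>x\<in>carrier R. \<forall>y\<in>carrier R. \<delta> (x \<otimes> y) = \<delta> x \<otimes> y \<oplus> x \<otimes> \<delta> y)"

context field begin

context
  fixes \<delta> assumes der: "derivation \<delta>"
begin

lemma der_closed [simp]: "x \<in> carrier R \<Longrightarrow> \<delta> x \<in> carrier R"
  and der_add: "x \<in> carrier R \<Longrightarrow> y \<in> carrier R \<Longrightarrow> \<delta> (x \<oplus> y) = \<delta> x \<oplus> \<delta> y"
  and der_mult: "x \<in> carrier R \<Longrightarrow> y \<in> carrier R \<Longrightarrow> \<delta> (x \<otimes> y) = \<delta> x \<otimes> y \<oplus> x \<otimes> \<delta> y"
  using der by (auto simp: derivation_def)

lemma der_zero [simp]: "\<delta> \<zero> = \<zero>"
  using der_add[of \<zero> \<zero>] der_closed[of \<zero>] by (metis add.r_cancel_one' r_zero zero_closed)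

lemma der_one [simp]: "\<delta> \<one> = \<zero>"
  using der_mult[of \<one> \<one>] der_closed[of \<one>] 
  by (metis add.r_cancel_one' l_one one_closed r_one)

lemma der_minus: "x \<in> carrier R \<Longrightarrow> \<delta> (\<ominus> x) = \<ominus> \<delta> x"
  using der_add[of x "\<ominus> x"] der_closed der_zero
  by (metis a_inv_closed minus_equality add.inv_equality r_neg add.m_comm)

lemma der_pow:
  assumes "x \<in> carrier R"
  shows "\<delta> (x [^] (n::nat)) = ([n] \<cdot> (x [^] (n - 1))) \<otimes> \<delta> x"
proof (induction n)
  case (Suc n)
  have d: "\<delta> x \<in> carrier R" "x [^] n \<in> carrier R" using assms by auto
  have "([n] \<cdot> (x [^] (n - 1))) \<otimes> \<delta> x \<otimes> x = ([n] \<cdot> (x [^] n)) \<otimes> \<delta> x"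
  proof (cases n)
    case (Suc m)
    define q where "q = [n] \<cdot> (x [^] m)"
    have "q \<in> carrier R" using assms by (simp add: q_def)
    hence "q \<otimes> \<delta> x \<otimes> x = q \<otimes> x \<otimes> \<delta> x" using assms d(1) by algebra
    also have "q \<otimes> x = [n] \<cdot> (x [^] m \<otimes> x)" unfolding q_def using assms by (intro add_pow_ldistr) auto
    finally show ?thesis using Suc by (simp add: q_def)
  qed (use assms d in simp)
  thus ?case using assms Suc d by (simp add: der_mult l_distr)
qed (use assms in simp)

lemma der_psum:
  assumes "\<And>i. u i \<in> carrier R" "x \<in> carrier R"
  shows "\<delta> (psum N u x) = psum N (\<lambda>i. \<delta> (u i)) x \<oplus> dpsum N u x \<otimes> \<delta> x"
proof (induction N)
  case 0
  show ?case using assms by simp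
next
  case (Suc N)
  define P where "P = psum N (\<lambda>i. \<delta> (u i)) x"
  define Q where "Q = dpsum N u x"
  define S where "S = [N] \<cdot> (u N \<otimes> x [^] (N - 1))"
  have cl: "P \<in> carrier R" "Q \<in> carrier R" "\<delta> x \<in> carrier R" "u N \<in> carrier R" "\<delta> (u N) \<in> carrier R"
    "x [^] N \<in> carrier R" "S \<in> carrier R" using assms by (auto simp: P_def Q_def S_def)
  have "\<delta> (u N \<otimes> x [^] N) = \<delta> (u N) \<otimes> x [^] N \<oplus> u N \<otimes> (([N] \<cdot> (x [^] (N - 1))) \<otimes> \<delta> x)"
    using assms by (simp add: der_mult der_pow)
  also have "u N \<otimes> (([N] \<cdot> (x [^] (N - 1))) \<otimes> \<delta> x) = S \<otimes> \<delta> x"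
  proof -
    have "u N \<otimes> (([N] \<cdot> (x [^] (N - 1))) \<otimes> \<delta> x) = (u N \<otimes> ([N] \<cdot> (x [^] (N - 1)))) \<otimes> \<delta> x"
      using assms by (simp add: m_assoc)
    also have "u N \<otimes> ([N] \<cdot> (x [^] (N - 1))) = S" unfolding S_def
      using assms by (intro add_pow_rdistr) auto
    finally show ?thesis .
  qed
  finally have "\<delta> (psum (Suc N) u x) = (P \<oplus> Q \<otimes> \<delta> x) \<oplus> (\<delta> (u N) \<otimes> x [^] N \<oplus> S \<otimes> \<delta> x)"
    using assms Suc by (simp add: psum_Suc der_add P_def Q_def)
  also have "\<dots> = (P \<oplus> \<delta> (u N) \<otimes> x [^] N) \<oplus> (Q \<oplus> S) \<otimes> \<delta> x" using cl by algebra
  finally show ?case using assms by (simp add: psum_Suc dpsum_Suc P_def Q_def S_def)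
qed

lemma der_psum_const:
  assumes "\<And>i. u i \<in> carrier R" "\<And>i. \<delta> (u i) = \<zero>" "x \<in> carrier R"
  shows "\<delta> (psum N u x) = dpsum N u x \<otimes> \<delta> x"
  using assms by (simp add: der_psum psum_zero)

lemma der_inv:
  assumes "x \<in> carrier R" "x \<noteq> \<zero>" "\<delta> x = \<zero>"
  shows "\<delta> (inv x) = \<zero>"
proof -
  have u: "x \<in> Units R" using assms field_Units by auto
  have i: "inv x \<in> carrier R" using u by auto
  have "\<zero> = \<delta> (x \<otimes> inv x)" using u by simp
  also have "\<dots> = x \<otimes> \<delta> (inv x)" unfolding der_mult[OF assms(1) i] using assms i by simp
  finally show ?thesis using integral[of x "\<delta> (inv x)"] assms i by auto
qed

lemma der_kernel_subfield: "subfield {x \<in> carrier R. \<delta> x = \<zero>} R"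
proof (rule subfieldI'[OF subringI])
  fix k assume "k \<in> {x \<in> carrier R. \<delta> x = \<zero>} - {\<zero>}"
  thus "inv k \<in> {x \<in> carrier R. \<delta> x = \<zero>}" using der_inv field_Units by auto
qed (auto simp: der_minus der_add der_mult)

end

section \<open>Simple roots and separable elements\<close>

lemma eval_eq_psum:
  assumes "set p \<subseteq> carrier R" "x \<in> carrier R"
  shows "eval p x = psum (length p) (coeff p) x"
  using assms(1)
proof (induction p)
  case (Cons c p)
  have "psum (length p) (coeff p) x = psum (length p) (coeff (c # p)) x"
    using Cons assms by (intro psum_cong) auto
  thus ?case using Cons assms by (auto simp: psum_Suc a_comm)
qed simp

definition deval :: "'a list \<Rightarrow> 'a \<Rightarrow> 'a" where
  "deval p x = dpsum (length p) (coeff p) x"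

lemma deval_root_factor:
  assumes h: "set h \<subseteq> carrier R" and a: "a \<in> carrier R"
    and p: "p = poly_mult [\<one>, \<ominus> a] h" 
  shows "deval p a = eval h a"
proof -
  have cl: "coeff h i \<in> carrier R" for i using h by simp
  have cp: "coeff p (Suc i) = coeff h i \<ominus> a \<otimes> coeff h (Suc i)" for i
  proof -
    define f where "f = (\<lambda>k. coeff [\<one>, \<ominus> a] k \<otimes> coeff h (Suc i - k))"
    have c1: "coeff [\<one>, \<ominus> a] k \<in> carrier R" for k using a by simp
    have f: "f k \<in> carrier R" for k unfolding f_def using c1 cl by blast
    have "coeff p (Suc i) = (\<Oplus>k\<in>{..Suc i}. f k)"
      unfolding p f_def using h a by (subst poly_mult_coeff) auto
    also have "\<dots> = (\<Oplus>k\<in>{..i}. f (Suc k)) \<oplus> f 0" by (rule finsum_Suc2) (use f in auto)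
    also have "(\<Oplus>k\<in>{..i}. f (Suc k)) = f 1"
    proof (cases i)
      case 0
      thus ?thesis using f by (simp add: finsum_0)
    next
      case (Suc m)
      have "(\<Oplus>k\<in>{..Suc m}. f (Suc k)) = (\<Oplus>k\<in>{..m}. f (Suc (Suc k))) \<oplus> f (Suc 0)"
        by (rule finsum_Suc2) (use f in auto)
      also have "(\<Oplus>k\<in>{..m}. f (Suc (Suc k))) = (\<Oplus>k\<in>{..m}. \<zero>)"
        by (rule finsum_cong') (use cl in \<open>auto simp: f_def\<close>)
      finally show ?thesis using Suc f by (simp add: finsum_zero)
    qed
    finally show ?thesis using cl a by (simp add: f_def minus_eq l_minus)
  qed
  have "set p \<subseteq> carrier R" unfolding p using h a by (intro poly_mult_in_carrier) auto
  hence pc: "coeff p i \<in> carrier R" for i by simp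
  define M where "M = length p + length h"
  have hM: "coeff h i = \<zero>" if "i \<ge> M" for i using that by (simp add: M_def coeff_length)
  have "deval p a = dpsum (Suc M) (coeff p) a"
    unfolding deval_def using pc a by (intro dpsum_extend[symmetric]) (auto simp: coeff_length M_def)
  also have "\<dots> = psum M (\<lambda>i. [Suc i] \<cdot> coeff p (Suc i)) a"
    using pc a by (rule dpsum_shift)
  also have "\<dots> = psum M (\<lambda>i. [Suc i] \<cdot> (coeff h i \<ominus> a \<otimes> coeff h (Suc i))) a"
    unfolding cp ..
  also have "\<dots> = psum M (coeff h) a \<ominus> [M] \<cdot> (coeff h M \<otimes> a [^] M)"
    using cl a by (rule psum_telescope)
  also have "\<dots> = psum M (coeff h) a"
    using a cl hM by (simp add: minus_eq)
  also have "\<dots> = eval h a"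
    using h a cl by (subst eval_eq_psum) (auto intro!: psum_extend_le simp: M_def coeff_length)
  finally show ?thesis .
qed


lemma root_factor:
  assumes "p \<in> carrier (poly_ring R)" "a \<in> carrier R" "eval p a = \<zero>"
  obtains h where "h \<in> carrier (poly_ring R)" "p = poly_mult [\<one>, \<ominus> a] h"
proof -
  have "[\<one>, \<ominus> a] pdivides p"
  proof (cases "p = []")
    case True
    have "[\<one>, \<ominus> a] \<in> carrier (poly_ring R)"
      using assms(2) unfolding univ_poly_carrier[symmetric] polynomial_def by auto
    thus ?thesis using True pdivides_zero[OF carrier_is_subring] by auto
  next
    case False
    thus ?thesis using assms is_root_imp_pdivides[of p a] by (auto simp: is_root_def)
  qed
  thus ?thesis using that unfolding pdivides_def factor_def univ_poly_mult by auto
qed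

lemma poly_ring_carrier_set: "p \<in> carrier (poly_ring R) \<Longrightarrow> set p \<subseteq> carrier R"
  unfolding univ_poly_carrier[symmetric] by (rule polynomial_incl)

lemma linear_in_poly_ring: "a \<in> carrier R \<Longrightarrow> [\<one>, \<ominus> a] \<in> carrier (poly_ring R)"
  unfolding univ_poly_carrier[symmetric] polynomial_def by auto

text \<open>Write \<open>p = (X - a) h\<close>. Then \<open>p'(a) = h(a)\<close>, and \<open>h(a) = 0\<close> means that \<open>X - a\<close> divides \<open>h\<close>,
  that is, that \<open>(X - a)\<^sup>2\<close> divides \<open>p\<close>.\<close>

lemma simple_root_iff_deval_nonzero:
  assumes p: "p \<in> carrier (poly_ring R)" "p \<noteq> []" and a: "a \<in> carrier R" and root: "eval p a = \<zero>"
  shows "alg_mult p a = 1 \<longleftrightarrow> deval p a \<noteq> \<zero>"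
proof -
  interpret UP: domain "poly_ring R" using univ_poly_is_domain[OF carrier_is_subring] .
  let ?l = "[\<one>, \<ominus> a]"
  have l: "?l \<in> carrier (poly_ring R)" by (rule linear_in_poly_ring[OF a])
  have ge: "alg_mult p a \<ge> 1"
    using alg_mult_gt_zero_iff_is_root[OF p(1), of a] p a root by (auto simp: is_root_def Suc_le_eq)
  have l2: "?l [^]\<^bsub>poly_ring R\<^esub> (2::nat) = poly_mult ?l ?l"
  proof -
    have "?l [^]\<^bsub>poly_ring R\<^esub> (2::nat) = ?l \<otimes>\<^bsub>poly_ring R\<^esub> ?l"
      using l by (simp only: numeral_2_eq_2 UP.nat_pow_Suc UP.nat_pow_0 UP.l_one)
    thus ?thesis by (simp only: univ_poly_mult)
  qed
  have "alg_mult p a \<ge> 2 \<longleftrightarrow> deval p a = \<zero>"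
  proof
    assume "alg_mult p a \<ge> 2"
    hence "(?l [^]\<^bsub>poly_ring R\<^esub> (2::nat)) pdivides p"
      using le_alg_mult_imp_pdivides[OF a p(1)] by blast
    then obtain g where g: "g \<in> carrier (poly_ring R)" "p = poly_mult (poly_mult ?l ?l) g"
      unfolding pdivides_def factor_def l2 univ_poly_mult by auto
    have g2: "p = poly_mult ?l (poly_mult ?l g)"
      using UP.m_assoc[OF l l g(1)] unfolding univ_poly_mult g(2)[symmetric] .
    have gs: "set g \<subseteq> carrier R" "set ?l \<subseteq> carrier R"
      using g l poly_ring_carrier_set by blast+
    have "deval p a = eval (poly_mult ?l g) a"
      using deval_root_factor[OF poly_mult_in_carrier[OF gs(2,1)] a g2] .
    also have "\<dots> = eval ?l a \<otimes> eval g a" using gs a by (intro eval_poly_mult) auto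
    also have "eval ?l a = \<zero>" using a by (simp add: r_neg)
    also have "\<zero> \<otimes> eval g a = \<zero>" using gs a eval_in_carrier by simp
    finally show "deval p a = \<zero>" .
  next
    assume d: "deval p a = \<zero>"
    obtain h where h: "h \<in> carrier (poly_ring R)" "p = poly_mult ?l h"
      using root_factor[OF p(1) a root] .
    have "eval h a = \<zero>" using deval_root_factor[OF poly_ring_carrier_set[OF h(1)] a h(2)] d by simp
    then obtain g where g: "g \<in> carrier (poly_ring R)" "h = poly_mult ?l g"
      using root_factor[OF h(1) a] by blast
    have "p = poly_mult (poly_mult ?l ?l) g"
      using UP.m_assoc[OF l l g(1)] unfolding univ_poly_mult h(2)[unfolded g(2)] by (rule sym)
    hence "p = (?l [^]\<^bsub>poly_ring R\<^esub> (2::nat)) \<otimes>\<^bsub>poly_ring R\<^esub> g" 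
      by (simp only: l2 univ_poly_mult)
    hence "(?l [^]\<^bsub>poly_ring R\<^esub> (2::nat)) pdivides p"
      unfolding pdivides_def by (intro dividesI[OF g(1)])
    thus "alg_mult p a \<ge> 2" using alg_multE(2)[OF a p] by blast
  qed
  with ge show ?thesis by auto
qed

lemma subfield_poly_carrier:
  assumes "subfield L R" "p \<in> carrier (L[X])"
  shows "p \<in> carrier (poly_ring R)" "set p \<subseteq> L"
proof -
  show "set p \<subseteq> L" using assms(2) unfolding univ_poly_carrier[symmetric] by (rule polynomial_incl)
  thus "p \<in> carrier (poly_ring R)" 
    using assms(2) subfieldE(3)[OF assms(1)] unfolding univ_poly_carrier[symmetric] polynomial_def by blast
qed

text \<open>The minimal polynomial divides \<open>p\<close>, so its multiplicity at \<open>a\<close> is at most that of \<open>p\<close>. This makes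
  separability checkable on any annihilating polynomial.\<close>

lemma separable_elementI:
  assumes L: "subfield L R" and p: "p \<in> carrier (L[X])" and a: "a \<in> carrier R"
    and root: "eval p a = \<zero>" and d: "deval p a \<noteq> \<zero>"
  shows "separable_element R L a"
proof -
  interpret UP: domain "poly_ring R" using univ_poly_is_domain[OF carrier_is_subring] .
  have pn: "p \<noteq> []" using d by (auto simp: deval_def)
  have alg: "(algebraic over L) a" using algebraicI[OF p pn root] .
  define f where "f = Irr L a"
  have f: "f \<in> carrier (L[X])" "eval f a = \<zero>" "f pdivides p"
    using IrrE[OF L a alg] Irr_minimal[OF L a alg p root] by (auto simp: f_def)
  have fR: "f \<in> carrier (poly_ring R)" and pR: "p \<in> carrier (poly_ring R)"
    using subfield_poly_carrier[OF L] f p by auto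
  have fn: "f \<noteq> []" using f(3) pn zero_pdivides by auto
  let ?l = "[\<one>, \<ominus> a]"
  have l: "?l \<in> carrier (poly_ring R)" by (rule linear_in_poly_ring[OF a])
  have "(?l [^]\<^bsub>poly_ring R\<^esub> (alg_mult f a)) pdivides p"
    using alg_multE(1)[OF a fR fn] f(3) l unfolding pdivides_def
    by (meson UP.divides_trans UP.nat_pow_closed)
  hence "alg_mult f a \<le> alg_mult p a" using alg_multE(2)[OF a pR pn] by blast
  also have "\<dots> = 1" using simple_root_iff_deval_nonzero[OF pR pn a root] d by simp
  finally have "alg_mult f a = 1"
    using alg_mult_gt_zero_iff_is_root[OF fR, of a] fn f(2) a by (auto simp: is_root_def)
  thus ?thesis using alg by (auto simp: separable_element_def f_def over_def)
qed

lemma separable_elementE: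
  assumes L: "subfield L R" and a: "a \<in> carrier R" and sep: "separable_element R L a"
  obtains f where "f \<in> carrier (L[X])" "eval f a = \<zero>" "deval f a \<noteq> \<zero>"
proof -
  have alg: "(algebraic over L) a" using sep by (auto simp: separable_element_def over_def)
  have f: "Irr L a \<in> carrier (L[X])" "eval (Irr L a) a = \<zero>" "pirreducible L (Irr L a)"
    using IrrE[OF L a alg] by auto
  have "Irr L a \<noteq> []" using pirreducibleE(1)[OF subfieldE(1)[OF L] f(1,3)] .
  thus ?thesis using that[OF f(1,2)] simple_root_iff_deval_nonzero[OF subfield_poly_carrier(1)[OF L f(1)] _ a f(2)] sep
    by (auto simp: separable_element_def)
qed

text \<open>Applying \<open>\<delta>\<close> to \<open>f(a) = 0\<close>, where \<open>f\<close> is the minimal polynomial, gives \<open>f'(a) \<delta>(a) = 0\<close> because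
  \<open>\<delta>\<close> kills the coefficients, and \<open>f'(a) \<noteq> 0\<close>.\<close>

lemma derivation_zero_if_separable:
  assumes der: "derivation \<delta>" and S: "S \<subseteq> carrier R" "\<And>s. s \<in> S \<Longrightarrow> \<delta> s = \<zero>"
    and a: "a \<in> carrier R" and sep: "separable_element R (generate_field R S) a"
  shows "\<delta> a = \<zero>"
proof -
  let ?L = "generate_field R S"
  have L: "subfield ?L R" using generate_field_is_subfield[OF S(1)] .
  have z: "\<delta> x = \<zero>" if "x \<in> ?L" for x
    using generate_field_min_subfield1[OF S(1) der_kernel_subfield[OF der]] S that by auto
  obtain f where f: "f \<in> carrier (?L[X])" "eval f a = \<zero>" "deval f a \<noteq> \<zero>"
    using separable_elementE[OF L a sep] .
  have fs: "set f \<subseteq> ?L" "set f \<subseteq> carrier R"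
    using subfield_poly_carrier(2)[OF L f(1)] subfieldE(3)[OF L] by auto
  have fc: "coeff f i \<in> ?L" for i
    using coeff_in_carrier[of f i] fs subringE(2)[OF subfieldE(1)[OF L]]
    by (cases "i < length f") (auto simp: coeff_nth coeff_length)
  have "\<zero> = \<delta> (psum (length f) (coeff f) a)"
    using f(2) fs a der by (simp add: eval_eq_psum[symmetric] der_zero)
  also have "\<dots> = deval f a \<otimes> \<delta> a"
    unfolding deval_def using der fs a z[OF fc] by (intro der_psum_const) auto
  finally show ?thesis using f(3) integral[of "deval f a" "\<delta> a"] fs a der_closed[OF der a]
    unfolding deval_def by (metis coeff_in_carrier dpsum_closed)
qed

end

section \<open>Prime characteristic\<close>

context cring begin

lemma binomial_ring:
  assumes "a \<in> carrier R" "b \<in> carrier R"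
  shows "(a \<oplus> b) [^] (n::nat) = (\<Oplus>k\<in>{..n}. [(n choose k)] \<cdot> (a [^] k \<otimes> b [^] (n - k)))"
proof (induction n)
  case 0
  show ?case using assms by (simp add: finsum_0)
next
  case (Suc n)
  define f where "f = (\<lambda>k. [(n choose k)] \<cdot> (a [^] k \<otimes> b [^] (Suc n - k)))"
  define g where "g = (\<lambda>k. if k = 0 then \<zero> else [(n choose (k - 1))] \<cdot> (a [^] k \<otimes> b [^] (Suc n - k)))"
  have cl: "f k \<in> carrier R" "g k \<in> carrier R" for k using assms by (auto simp: f_def g_def)
  have "(a \<oplus> b) [^] Suc n = (\<Oplus>k\<in>{..n}. [(n choose k)] \<cdot> (a [^] k \<otimes> b [^] (n - k))) \<otimes> (a \<oplus> b)"
    using Suc by simp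
  also have "\<dots> = (\<Oplus>k\<in>{..n}. [(n choose k)] \<cdot> (a [^] k \<otimes> b [^] (n - k))) \<otimes> a \<oplus>
      (\<Oplus>k\<in>{..n}. [(n choose k)] \<cdot> (a [^] k \<otimes> b [^] (n - k))) \<otimes> b"
    using assms by (intro r_distr finsum_closed) auto
  also have "(\<Oplus>k\<in>{..n}. [(n choose k)] \<cdot> (a [^] k \<otimes> b [^] (n - k))) \<otimes> b = (\<Oplus>k\<in>{..n}. f k)"
  proof -
    have "([(n choose k)] \<cdot> (a [^] k \<otimes> b [^] (n - k))) \<otimes> b = f k" if "k \<le> n" for k
    proof -
      have "([(n choose k)] \<cdot> (a [^] k \<otimes> b [^] (n - k))) \<otimes> b = [(n choose k)] \<cdot> (a [^] k \<otimes> b [^] (n - k) \<otimes> b)"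
        using assms by (intro add_pow_ldistr) auto
      also have "a [^] k \<otimes> b [^] (n - k) \<otimes> b = a [^] k \<otimes> b [^] (Suc n - k)"
        using assms that by (simp add: m_assoc Suc_diff_le)
      finally show ?thesis by (simp add: f_def)
    qed
    thus ?thesis using assms cl by (subst finsum_ldistr) (auto intro!: finsum_cong')
  qed
  also have "(\<Oplus>k\<in>{..n}. [(n choose k)] \<cdot> (a [^] k \<otimes> b [^] (n - k))) \<otimes> a = (\<Oplus>k\<in>{..n}. g (Suc k))"
  proof -
    have "([(n choose k)] \<cdot> (a [^] k \<otimes> b [^] (n - k))) \<otimes> a = g (Suc k)" if "k \<le> n" for k
    proof -
      have "([(n choose k)] \<cdot> (a [^] k \<otimes> b [^] (n - k))) \<otimes> a = [(n choose k)] \<cdot> (a [^] k \<otimes> b [^] (n - k) \<otimes> a)"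
        using assms by (intro add_pow_ldistr) auto
      also have "a [^] k \<otimes> b [^] (n - k) \<otimes> a = a [^] Suc k \<otimes> b [^] (n - k)"
      proof -
        have "a [^] k \<in> carrier R" "b [^] (n - k) \<in> carrier R" using assms by auto
        thus ?thesis using assms(1) by (simp add: m_ac)
      qed
      finally show ?thesis by (simp add: g_def)
    qed
    thus ?thesis using assms cl by (subst finsum_ldistr) (auto intro!: finsum_cong')
  qed
  also have "(\<Oplus>k\<in>{..n}. g (Suc k)) = (\<Oplus>k\<in>{..Suc n}. g k)"
  proof -
    have "(\<Oplus>k\<in>{..Suc n}. g k) = (\<Oplus>k\<in>{..n}. g (Suc k)) \<oplus> g 0"
      using cl by (intro finsum_Suc2) auto
    moreover have "g 0 = \<zero>" by (simp add: g_def)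
    moreover have "(\<Oplus>k\<in>{..n}. g (Suc k)) \<in> carrier R" using cl by (intro finsum_closed) auto
    ultimately show ?thesis by simp
  qed
  also have "(\<Oplus>k\<in>{..n}. f k) = (\<Oplus>k\<in>{..Suc n}. f k)"
    using cl assms by (subst finsum_Suc) (auto simp: f_def binomial_eq_0)
  also have "(\<Oplus>k\<in>{..Suc n}. g k) \<oplus> (\<Oplus>k\<in>{..Suc n}. f k) = (\<Oplus>k\<in>{..Suc n}. g k \<oplus> f k)"
    using cl by (subst finsum_addf) auto
  also have "\<dots> = (\<Oplus>k\<in>{..Suc n}. [(Suc n choose k)] \<cdot> (a [^] k \<otimes> b [^] (Suc n - k)))"
  proof (rule finsum_cong')
    fix k assume "k \<in> {..Suc n}"
    show "g k \<oplus> f k = [(Suc n choose k)] \<cdot> (a [^] k \<otimes> b [^] (Suc n - k))"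
      using assms by (cases k) (auto simp: f_def g_def add.nat_pow_mult)
  qed (use assms in auto)
  finally show ?case .
qed

end

locale prime_char_field = field +
  fixes p :: nat
  assumes p_prime: "Factorial_Ring.prime p"
    and p_zero: "[p] \<cdot> \<one> = \<zero>"
begin

lemma char_mult_zero:
  assumes "a \<in> carrier R" "p dvd k"
  shows "[k] \<cdot> a = \<zero>"
proof -
  obtain m where k: "k = p * m" using assms(2) by auto
  have "[p] \<cdot> a = ([p] \<cdot> \<one>) \<otimes> a" using assms(1) by (simp add: add_pow_ldistr)
  hence "[p] \<cdot> a = \<zero>" using p_zero assms by simp
  thus ?thesis using assms(1) unfolding k by (metis add.nat_pow_one add.nat_pow_pow)
qed

lemma char_mult_eq_zero:
  assumes "a \<in> carrier R" "[k] \<cdot> a = \<zero>" "\<not> p dvd k"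
  shows "a = \<zero>"
proof -
  have "coprime k p" using p_prime assms(3) using prime_imp_coprime[of p k] by (simp add: coprime_commute)
  moreover have "p \<noteq> 1" "p \<noteq> 0" "k \<noteq> 0" using p_prime assms(3) by (auto intro: ccontr)
  ultimately obtain x y where xy: "k * x = p * y + 1"
    using bezout_nat[of k p] by (auto simp: coprime_iff_gcd_eq_1)
  have "[(k * x)] \<cdot> a = \<zero>" using assms by (metis add.nat_pow_one add.nat_pow_pow)
  moreover have "[(k * x)] \<cdot> a = [(p * y)] \<cdot> a \<oplus> a" unfolding xy using assms(1) by (simp add: add.nat_pow_mult[symmetric])
  ultimately show ?thesis using char_mult_zero[of a "p * y"] assms(1) by simp
qed

lemma freshman:
  assumes "a \<in> carrier R" "b \<in> carrier R"
  shows "(a \<oplus> b) [^] p = a [^] p \<oplus> b [^] p"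
proof -
  obtain m where m: "p = Suc (Suc m)" using p_prime 
    by (metis not0_implies_Suc not_prime_0 not_prime_1 One_nat_def)
  define f where "f = (\<lambda>k. [(p choose k)] \<cdot> (a [^] k \<otimes> b [^] (p - k)))"
  have cl: "f k \<in> carrier R" for k using assms by (auto simp: f_def)
  have "(a \<oplus> b) [^] p = (\<Oplus>k\<in>{..p}. f k)" unfolding f_def by (rule binomial_ring[OF assms])
  also have "\<dots> = f p \<oplus> ((\<Oplus>k\<in>{..m}. f (Suc k)) \<oplus> f 0)"
    unfolding m using cl by (subst finsum_Suc, force, subst finsum_Suc2) auto
  also have "(\<Oplus>k\<in>{..m}. f (Suc k)) = (\<Oplus>k\<in>{..m}. \<zero>)"
  proof (rule finsum_cong')
    fix k assume k: "k \<in> {..m}"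
    have "p dvd p choose Suc k" using p_prime k m by (intro dvd_choose_prime) auto
    thus "f (Suc k) = \<zero>" unfolding f_def using assms by (intro char_mult_zero) auto
  qed auto
  finally show ?thesis using assms by (simp add: f_def finsum_zero)
qed

lemma psum_frobenius:
  assumes "\<And>i. u i \<in> carrier R" "x \<in> carrier R"
  shows "psum N u x [^] p = psum N (\<lambda>i. u i [^] p) (x [^] p)"
proof (induction N)
  case 0
  have "p \<noteq> 0" using p_prime by auto
  thus ?case by (simp add: nat_pow_zero)
next
  case (Suc N)
  have "(x [^] N) [^] p = (x [^] p) [^] N" using assms by (simp add: nat_pow_pow mult.commute)
  thus ?case using assms Suc by (simp add: psum_Suc freshman nat_pow_distrib)
qed

text \<open>A polynomial in \<open>X\<^sup>p\<close>, evaluated at \<open>x\<close>, is a polynomial of smaller degree evaluated at \<open>x\<^sup>p\<close>.\<close>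

lemma psum_multiples:
  assumes "\<And>i. u i \<in> carrier R" "x \<in> carrier R" "\<And>i. \<not> p dvd i \<Longrightarrow> u i = \<zero>"
  shows "psum (p * N) u x = psum N (\<lambda>i. u (p * i)) (x [^] p)"
proof (induction N)
  case (Suc N)
  have p0: "p > 0" using p_prime prime_gt_0_nat by auto
  have "psum (Suc (p * N + k)) u x = psum (p * N) u x \<oplus> u (p * N) \<otimes> x [^] (p * N)" if "k < p" for k
    using that
  proof (induction k)
    case (Suc k)
    have "\<not> p dvd (p * N + Suc k)" using Suc.prems by (metis dvd_add_right_iff dvd_triv_left nat_dvd_not_less zero_less_Suc)
    hence "u (Suc (p * N + k)) = \<zero>" using assms(3) by simp
    thus ?case using Suc assms by (simp add: psum_Suc)
  qed (use assms in \<open>simp add: psum_Suc\<close>)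
  from this[of "p - 1"] p0 have "psum (p * Suc N) u x = psum (p * N) u x \<oplus> u (p * N) \<otimes> x [^] (p * N)"
    by (simp add: algebra_simps)
  thus ?case using Suc assms by (simp add: psum_Suc nat_pow_pow)
qed simp

lemma pow_eq_zero_iff: 
  assumes "a \<in> carrier R"
  shows "a [^] p = \<zero> \<longleftrightarrow> a = \<zero>"
proof
  have "a = \<zero>" if "a [^] k = \<zero>" for k :: nat
    using that assms by (induction k) (auto dest: integral)
  thus "a [^] p = \<zero> \<Longrightarrow> a = \<zero>" .
  assume "a = \<zero>"
  thus "a [^] p = \<zero>" using p_prime by (simp add: nat_pow_zero prime_gt_0_nat)
qed

section \<open>Algebraic relations between two elements\<close>

definition bisum :: "nat \<Rightarrow> nat \<Rightarrow> (nat \<Rightarrow> nat \<Rightarrow> 'a) \<Rightarrow> 'a \<Rightarrow> 'a \<Rightarrow> 'a" where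
  "bisum N M c x y = psum N (\<lambda>i. psum M (c i) y) x"

text \<open>The coefficients of a nonzero polynomial over \<open>C\<close> in two variables whose degrees are less than
  \<open>N\<close> and \<open>M\<close>. The size \<open>N + M\<close> of this box is what descends in the search for a separable relation.\<close>

definition bounded_coeffs :: "'a set \<Rightarrow> nat \<Rightarrow> nat \<Rightarrow> (nat \<Rightarrow> nat \<Rightarrow> 'a) \<Rightarrow> bool" where
  "bounded_coeffs C N M c \<longleftrightarrow> (\<forall>i j. c i j \<in> C) \<and> (\<forall>i j. c i j \<noteq> \<zero> \<longrightarrow> i < N \<and> j < M) \<and> (\<exists>i j. c i j \<noteq> \<zero>)"

text \<open>The derivative with respect to the first variable. The one with respect to the second variable is
  \<open>dx_bisum\<close> of the transposed coefficients with the arguments exchanged.\<close>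

definition dx_bisum :: "nat \<Rightarrow> nat \<Rightarrow> (nat \<Rightarrow> nat \<Rightarrow> 'a) \<Rightarrow> 'a \<Rightarrow> 'a \<Rightarrow> 'a" where
  "dx_bisum N M c x y = dpsum N (\<lambda>i. psum M (c i) y) x"

lemma bisum_swap:
  assumes "\<And>i j. c i j \<in> carrier R" "x \<in> carrier R" "y \<in> carrier R"
  shows "bisum N M c x y = bisum M N (\<lambda>j i. c i j) y x"
  unfolding bisum_def using psum_swap[OF assms] .

lemma bounded_coeffs_swap: "bounded_coeffs C N M c \<Longrightarrow> bounded_coeffs C M N (\<lambda>j i. c i j)"
  unfolding bounded_coeffs_def by blast

text \<open>If some exponent of \<open>x\<close> is prime to \<open>p\<close>, the derivative is a nonzero polynomial in a smaller box.\<close>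

lemma dx_bisum_relation:
  assumes c: "bounded_coeffs C (Suc N) M c" and C: "subfield C R"
    and x: "x \<in> carrier R" "y \<in> carrier R" and nz: "c i j \<noteq> \<zero>" "\<not> p dvd i"
  defines "c' \<equiv> \<lambda>i j. [Suc i] \<cdot> c (Suc i) j"
  shows "bounded_coeffs C N M c'" "bisum N M c' x y = dx_bisum (Suc N) M c x y"
proof -
  have cc: "c i j \<in> C" for i j using c by (auto simp: bounded_coeffs_def)
  have CR: "C \<subseteq> carrier R" using subfieldE(3)[OF C] .
  have cR: "c i j \<in> carrier R" for i j using cc CR by auto
  have pow: "[k] \<cdot> z \<in> C" if "z \<in> C" for k :: nat and z
    using that subringE(2,7)[OF subfieldE(1)[OF C]] by (induction k) auto
  obtain i' where i': "i = Suc i'" using nz(2) by (cases i) auto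
  have "c' i' j \<noteq> \<zero>" using char_mult_eq_zero[OF cR, of i] nz unfolding c'_def i' by blast
  moreover have "c' a b \<noteq> \<zero> \<Longrightarrow> a < N \<and> b < M" for a b
    using c unfolding bounded_coeffs_def c'_def by (metis Suc_less_eq add.nat_pow_one)
  ultimately show "bounded_coeffs C N M c'" using pow cc unfolding bounded_coeffs_def c'_def by blast
  show "bisum N M c' x y = dx_bisum (Suc N) M c x y"
    unfolding bisum_def dx_bisum_def using x cR by (subst dpsum_shift) (auto simp: c'_def psum_add_pow simp del: add.nat_pow_Suc)
qed

text \<open>Descent on the size of the box. Suppose that both partial derivatives vanish at \<open>(x, y)\<close>. If one of
  them is a nonzero polynomial, it is a relation in a smaller box. Otherwise all exponents are multiples of
  \<open>p\<close>, and taking \<open>p\<close>-th roots of the coefficients exhibits the polynomial as a \<open>p\<close>-th power \<open>Q\<^sup>p\<close>; then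
  \<open>Q(x, y) = 0\<close> is a relation in a smaller box. The descent stops, because a nonzero constant is not
  a relation. The bounds on \<open>N'\<close> and \<open>M'\<close> record that a variable that is absent stays absent.\<close>

lemma separable_relation:
  assumes C: "subfield C R" and perfect: "\<And>a. a \<in> C \<Longrightarrow> \<exists>b\<in>C. b [^] p = a"
    and x: "x \<in> carrier R" and y: "y \<in> carrier R"
    and c: "bounded_coeffs C N M c" "bisum N M c x y = \<zero>"
  shows "\<exists>N'\<le>N. \<exists>M'\<le>M. \<exists>c'. bounded_coeffs C N' M' c' \<and> bisum N' M' c' x y = \<zero> \<and>
    (dx_bisum N' M' c' x y \<noteq> \<zero> \<or> dx_bisum M' N' (\<lambda>j i. c' i j) y x \<noteq> \<zero>)"
  using c
proof (induction "N + M" arbitrary: N M c rule: less_induct)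
  case less
  note c = less.prems
  have CR: "C \<subseteq> carrier R" using subfieldE(3)[OF C] .
  have cc: "c i j \<in> C" and cb: "c i j \<noteq> \<zero> \<Longrightarrow> i < N \<and> j < M" for i j
    using c by (auto simp: bounded_coeffs_def)
  have cR: "c i j \<in> carrier R" for i j using cc CR by auto
  let ?T = "\<lambda>j i. c i j"
  show ?case
  proof (cases "dx_bisum N M c x y \<noteq> \<zero> \<or> dx_bisum M N ?T y x \<noteq> \<zero>")
    case True
    thus ?thesis using c by blast
  next
    case False
    hence d: "dx_bisum N M c x y = \<zero>" "dx_bisum M N ?T y x = \<zero>" by auto
    obtain i0 j0 where ij0: "c i0 j0 \<noteq> \<zero>" using c by (auto simp: bounded_coeffs_def)
    obtain N' M' where N': "N = Suc N'" and M': "M = Suc M'"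
      using cb[OF ij0] by (metis less_imp_Suc_add)
    show ?thesis
    proof (cases "\<exists>i j. c i j \<noteq> \<zero> \<and> \<not> p dvd i")
      case True
      then obtain i j where ij: "c i j \<noteq> \<zero>" "\<not> p dvd i" by blast
      note r = dx_bisum_relation[OF c(1)[unfolded N'] C x y ij]
      from less.hyps[OF _ r(1)] r(2) d(1) N' obtain A B c' where "A \<le> N'" "B \<le> M" 
        "bounded_coeffs C A B c' \<and> bisum A B c' x y = \<zero> \<and>
         (dx_bisum A B c' x y \<noteq> \<zero> \<or> dx_bisum B A (\<lambda>j i. c' i j) y x \<noteq> \<zero>)" by auto
      thus ?thesis using N' by (intro exI[of _ A] conjI exI[of _ B] exI[of _ c']) auto
    next
      case pi: False
      show ?thesis
      proof (cases "\<exists>i j. c i j \<noteq> \<zero> \<and> \<not> p dvd j")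
        case True
        then obtain i j where ij: "?T j i \<noteq> \<zero>" "\<not> p dvd j" by blast
        note r = dx_bisum_relation[OF bounded_coeffs_swap[OF c(1)[unfolded M']] C y x ij]
        define c1 where "c1 = (\<lambda>i j. [Suc j] \<cdot> c i (Suc j))"
        have c1: "bounded_coeffs C N M' c1" using bounded_coeffs_swap[OF r(1)] by (simp add: c1_def)
        have "c1 i j \<in> carrier R" for i j using cR by (simp add: c1_def)
        hence "bisum N M' c1 x y = \<zero>" using bisum_swap[of c1 x y N M'] x y r(2) d(2) M'
          by (simp add: c1_def)
        from less.hyps[OF _ c1 this] M' obtain A B c' where "A \<le> N" "B \<le> M'" 
          "bounded_coeffs C A B c' \<and> bisum A B c' x y = \<zero> \<and>
           (dx_bisum A B c' x y \<noteq> \<zero> \<or> dx_bisum B A (\<lambda>j i. c' i j) y x \<noteq> \<zero>)" by auto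
        thus ?thesis using M' by (intro exI[of _ A] conjI exI[of _ B] exI[of _ c']) auto
      next
        case pj: False
        have ppos: "p \<ge> 2" using p_prime prime_ge_2_nat by auto
        obtain rt where rt: "\<And>a. a \<in> C \<Longrightarrow> rt a \<in> C \<and> rt a [^] p = a" using perfect by metis
        \<comment> \<open>An index \<open>p * i < Suc N'\<close> has \<open>i \<le> N' div p\<close>, so this is the bound for the \<open>p\<close>-th root.\<close>
        define N1 where "N1 = Suc (N' div p)"
        define M1 where "M1 = Suc (M' div p)"
        define c1 where "c1 = (\<lambda>i j. rt (c (p * i) (p * j)))"
        have c1C: "c1 i j \<in> C" for i j using rt cc by (simp add: c1_def)
        have c1R: "c1 i j \<in> carrier R" for i j using c1C CR by auto
        have c1p: "c1 i j [^] p = c (p * i) (p * j)" for i j using rt cc by (simp add: c1_def)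
        have c1z: "c1 i j = \<zero> \<longleftrightarrow> c (p * i) (p * j) = \<zero>" for i j
          using pow_eq_zero_iff[OF c1R[of i j]] c1p[of i j] by simp
        have b1: "bounded_coeffs C N1 M1 c1" 
        proof -
          have "i < N1 \<and> j < M1" if "c1 i j \<noteq> \<zero>" for i j
          proof -
            have "p * i \<le> N'" "p * j \<le> M'" using cb[of "p * i" "p * j"] that c1z N' M' by auto
            hence "p * i div p \<le> N' div p" "p * j div p \<le> M' div p" using div_le_mono by blast+
            thus ?thesis using ppos by (simp add: N1_def M1_def)
          qed
          moreover have "\<exists>i j. c1 i j \<noteq> \<zero>"
          proof -
            have "p dvd i0" "p dvd j0" using pi pj ij0 by auto
            then obtain i j where "i0 = p * i" "j0 = p * j" unfolding dvd_def by blast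
            thus ?thesis using ij0 c1z by auto
          qed
          ultimately show ?thesis using c1C by (auto simp: bounded_coeffs_def)
        qed
        have le: "N \<le> p * N1" "M \<le> p * M1"
          using ppos unfolding N1_def M1_def N' M' 
          by (metis Suc_leI dividend_less_times_div mult_Suc_right not_numeral_le_zero le_zero_eq
              gr0I add.commute)+
        have inner: "psum M1 (c1 i) y [^] p = psum M (c (p * i)) y" for i
        proof -
          have "psum M (c (p * i)) y = psum (p * M1) (c (p * i)) y"
            using cR y cb le by (intro psum_extend_le[symmetric]) (auto simp: not_le[symmetric])
          also have "\<dots> = psum M1 (\<lambda>j. c (p * i) (p * j)) (y [^] p)"
            using cR y pj by (intro psum_multiples) auto
          also have "\<dots> = psum M1 (c1 i) y [^] p" using c1R y by (simp add: psum_frobenius c1p)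
          finally show ?thesis ..
        qed
        have "bisum N1 M1 c1 x y [^] p = psum N1 (\<lambda>i. psum M (c (p * i)) y) (x [^] p)"
          unfolding bisum_def using c1R x y by (simp add: psum_frobenius inner)
        also have "\<dots> = psum (p * N1) (\<lambda>i. psum M (c i) y) x"
          using cR x y pi by (intro psum_multiples[symmetric]) (auto intro!: psum_zero)
        also have "\<dots> = bisum N M c x y" unfolding bisum_def
          using cR x y cb le by (intro psum_extend_le) (auto simp: not_le[symmetric] intro!: psum_zero)
        finally have "bisum N1 M1 c1 x y [^] p = \<zero>" using c by simp
        moreover have "bisum N1 M1 c1 x y \<in> carrier R" using c1R x y by (simp add: bisum_def)
        ultimately have z: "bisum N1 M1 c1 x y = \<zero>" using pow_eq_zero_iff by simp
        have div: "k div p < k" if "k > 0" for k using that ppos by simp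
        show ?thesis
        proof (cases "N' = 0 \<and> M' = 0")
          case True
          hence "i0 = 0" "j0 = 0" using cb[OF ij0] N' M' by auto
          moreover have "bisum N M c x y = c 0 0"
            using True N' M' cR x y by (simp add: bisum_def psum_Suc)
          ultimately show ?thesis using ij0 c by simp
        next
          case False
          have le': "N1 \<le> N" "M1 \<le> M" unfolding N1_def M1_def N' M' by auto
          have lt: "N1 + M1 < N + M"
            using False div[of N'] div[of M'] div_le_dividend[of N' p] div_le_dividend[of M' p]
            unfolding N1_def M1_def N' M' by linarith
          from less.hyps[OF lt b1 z] obtain A B c' where "A \<le> N1" "B \<le> M1" 
            "bounded_coeffs C A B c' \<and> bisum A B c' x y = \<zero> \<and>
             (dx_bisum A B c' x y \<noteq> \<zero> \<or> dx_bisum B A (\<lambda>j i. c' i j) y x \<noteq> \<zero>)" by auto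
          thus ?thesis using le' by (intro exI[of _ A] conjI exI[of _ B] exI[of _ c']) auto
        qed
      qed
    qed
  qed
qed

end

section \<open>Separability over a nonconstant element\<close>

context field begin

text \<open>The passage from coefficient functions to the coefficient lists that algebraicity and minimal
  polynomials refer to.\<close>

lemma poly_of_psum:
  assumes L: "subfield L R" and u: "\<And>i. u i \<in> L" "\<And>i. i \<ge> N \<Longrightarrow> u i = \<zero>" and x: "x \<in> carrier R"
  obtains p where "p \<in> carrier (L[X])" "eval p x = psum N u x" "deval p x = dpsum N u x" "coeff p = u"
proof -
  define l where "l = rev (map u [0..<N])"
  have l: "set l \<subseteq> L" using u by (auto simp: l_def)
  define p where "p = normalize l"
  have LR: "L \<subseteq> carrier R" using subfieldE(3)[OF L] .
  have cl: "coeff l = u"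
  proof
    fix i show "coeff l i = u i"
      using u by (cases "i < N") (auto simp: l_def coeff_nth coeff_length rev_nth)
  qed
  hence cp: "coeff p = u" using normalize_coeff[of l] by (simp add: p_def)
  have uR: "u i \<in> carrier R" for i using u LR by auto
  have len: "length p \<le> N" using normalize_length_le[of l] by (simp add: p_def l_def)
  have ps: "set p \<subseteq> L" using normalize_gives_polynomial[OF l] unfolding p_def by (rule polynomial_incl)
  have "p \<in> carrier (L[X])" unfolding univ_poly_carrier[symmetric] p_def
    using normalize_gives_polynomial[OF l] .
  moreover have "eval p x = psum N u x"
    using ps LR x cp uR len coeff_length[of p] by (subst eval_eq_psum) (auto intro!: psum_extend_le[symmetric])
  moreover have "deval p x = dpsum N u x"
    unfolding deval_def cp using uR x len cp coeff_length[of p] by (intro dpsum_extend[symmetric]) auto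
  ultimately show ?thesis using that cp by blast
qed

lemma psum_in_subring:
  assumes L: "subring L R" and u: "\<And>i. u i \<in> L" and x: "x \<in> L"
  shows "psum N u x \<in> L"
proof -
  have R: "u i \<in> carrier R" "x \<in> carrier R" for i using subringE(1)[OF L] u x by auto
  have "x [^] k \<in> L" for k :: nat using subringE(3,6)[OF L] x by (induction k) auto
  thus ?thesis using R u subringE(2,6,7)[OF L] by (induction N) (auto simp: psum_Suc)
qed

lemma fraction_subfield:
  assumes A: "subring A R"
  shows "subfield {u \<in> carrier R. \<exists>b\<in>A. b \<noteq> \<zero> \<and> u \<otimes> b \<in> A} R" (is "subfield ?F R")
proof -
  have AR: "A \<subseteq> carrier R" using subringE(1)[OF A] .
  note cl = subringE(2,3,5,6,7)[OF A]
  show ?thesis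
  proof (rule subfieldI'[OF subringI])
    show "\<one> \<in> ?F" using cl by (auto intro!: bexI[of _ \<one>])
  next
    fix u assume "u \<in> ?F"
    then obtain b where b: "u \<in> carrier R" "b \<in> A" "b \<noteq> \<zero>" "u \<otimes> b \<in> A" by auto
    have "\<ominus> u \<otimes> b = \<ominus> (u \<otimes> b)" using b AR l_minus by blast
    thus "\<ominus> u \<in> ?F" using b cl by auto
  next
    fix u v assume "u \<in> ?F" "v \<in> ?F"
    then obtain b c where b: "u \<in> carrier R" "b \<in> A" "b \<noteq> \<zero>" "u \<otimes> b \<in> A"
      and c: "v \<in> carrier R" "c \<in> A" "c \<noteq> \<zero>" "v \<otimes> c \<in> A" by auto
    have bc: "b \<in> carrier R" "c \<in> carrier R" using b c AR by auto
    have "(u \<oplus> v) \<otimes> (b \<otimes> c) = (u \<otimes> b) \<otimes> c \<oplus> (v \<otimes> c) \<otimes> b" using b(1) c(1) bc by algebra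
    moreover have "b \<otimes> c \<noteq> \<zero>" using integral[of b c] bc b c by blast
    ultimately show "u \<oplus> v \<in> ?F" using b c cl by (auto intro!: bexI[of _ "b \<otimes> c"])
    have "(u \<otimes> v) \<otimes> (b \<otimes> c) = (u \<otimes> b) \<otimes> (v \<otimes> c)" using b(1) c(1) bc by algebra
    thus "u \<otimes> v \<in> ?F" using b c cl \<open>b \<otimes> c \<noteq> \<zero>\<close> by (auto intro!: bexI[of _ "b \<otimes> c"])
  next
    fix u assume "u \<in> ?F - {\<zero>}"
    then obtain b where b: "u \<in> carrier R" "b \<in> A" "b \<noteq> \<zero>" "u \<otimes> b \<in> A" "u \<noteq> \<zero>" by auto
    have u: "u \<in> Units R" using b field_Units by auto
    have bR: "b \<in> carrier R" using b AR by auto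
    have "inv u \<otimes> (u \<otimes> b) = b" using u b(1) bR by (simp add: m_assoc[symmetric])
    moreover have "u \<otimes> b \<noteq> \<zero>" using integral[of u b] b bR by blast
    ultimately show "inv u \<in> ?F" using b u by (auto intro!: bexI[of _ "u \<otimes> b"])
  qed auto
qed

lemma common_denominator:
  assumes A: "subring A R" and u: "\<And>i::nat. u i \<in> carrier R" 
    and d: "\<And>i. \<exists>b\<in>A. b \<noteq> \<zero> \<and> u i \<otimes> b \<in> A"
  shows "\<exists>b\<in>A. b \<noteq> \<zero> \<and> (\<forall>i<N. u i \<otimes> b \<in> A)"
proof (induction N)
  case 0
  show ?case using subringE(3)[OF A] by (intro bexI[of _ \<one>]) auto
next
  case (Suc N)
  have AR: "A \<subseteq> carrier R" using subringE(1)[OF A] .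
  obtain b where b: "b \<in> A" "b \<noteq> \<zero>" "\<And>i. i < N \<Longrightarrow> u i \<otimes> b \<in> A" using Suc by blast
  obtain c where c: "c \<in> A" "c \<noteq> \<zero>" "u N \<otimes> c \<in> A" using d by blast
  have bc: "b \<in> carrier R" "c \<in> carrier R" using b c AR by auto
  have "u i \<otimes> (b \<otimes> c) \<in> A" if "i < Suc N" for i
  proof (cases "i = N")
    case True
    have "u i \<otimes> (b \<otimes> c) = (u i \<otimes> c) \<otimes> b" using u[of i] bc by algebra
    thus ?thesis using True c b subringE(6)[OF A] by simp
  next
    case False
    have "u i \<otimes> (b \<otimes> c) = (u i \<otimes> b) \<otimes> c" using u[of i] bc by algebra
    thus ?thesis using False that c b subringE(6)[OF A] by simp
  qed
  moreover have "b \<otimes> c \<noteq> \<zero>" using integral[of b c] bc b c by blast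
  ultimately show ?case using b c subringE(6)[OF A] by blast
qed

end

context prime_char_field begin

text \<open>The coefficients of an annihilating polynomial of \<open>x\<close> over \<open>C(y)\<close> are quotients of elements of \<open>C[y]\<close>.
  Multiplying by a common denominator turns it into a polynomial relation between \<open>x\<close> and \<open>y\<close>. Unlike the
  algebraicity of \<open>x\<close> over \<open>C(y)\<close>, such a relation is symmetric in the two elements.\<close>

lemma algebraic_imp_relation:
  assumes C: "subfield C R" and x: "x \<in> carrier R" and y: "y \<in> carrier R"
    and alg: "algebraic (generate_field R (insert y C)) x"
  shows "\<exists>N M c. bounded_coeffs C N M c \<and> bisum N M c x y = \<zero>"
proof -
  have CR: "C \<subseteq> carrier R" using subfieldE(3)[OF C] .
  let ?S = "insert y C"
  have S: "?S \<subseteq> carrier R" using CR y by auto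
  define L where "L = generate_field R ?S"
  have L: "subfield L R" using generate_field_is_subfield[OF S] by (simp add: L_def)
  define A where "A = simple_extension C y"
  have A: "subring A R" unfolding A_def by (rule simple_extension_is_subring[OF subfieldE(1)[OF C] y])
  have AR: "A \<subseteq> carrier R" using subringE(1)[OF A] .
  have SA: "?S \<subseteq> A" unfolding A_def
    using simple_extension_incl[OF CR y] simple_extension_mem[OF subfieldE(1)[OF C] y] by auto
  have "L \<subseteq> {u \<in> carrier R. \<exists>b\<in>A. b \<noteq> \<zero> \<and> u \<otimes> b \<in> A}"
    unfolding L_def
  proof (rule generate_field_min_subfield1[OF S fraction_subfield[OF A]], safe)
    fix a assume "a \<in> C" thus "\<exists>b\<in>A. b \<noteq> \<zero> \<and> a \<otimes> b \<in> A"
      using SA CR subringE(3)[OF A] by (intro bexI[of _ \<one>]) (auto simp: subset_iff)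
  next
    show "\<exists>b\<in>A. b \<noteq> \<zero> \<and> y \<otimes> b \<in> A"
      using SA y subringE(3)[OF A] by (intro bexI[of _ \<one>]) auto
  qed (use S in auto)
  hence LA: "\<exists>b\<in>A. b \<noteq> \<zero> \<and> a \<otimes> b \<in> A" if "a \<in> L" for a using that by blast
  have "(algebraic over L) x" using alg by (simp add: L_def over_def)
  then obtain f where f: "f \<in> carrier (L[X])" "f \<noteq> []" "eval f x = \<zero>"
    using algebraicE[OF subfieldE(1)[OF L] x] by blast
  have fs: "set f \<subseteq> L" "set f \<subseteq> carrier R"
    using subfield_poly_carrier(2)[OF L f(1)] subfieldE(3)[OF L] by auto
  have fL: "coeff f i \<in> L" for i
    using fs subringE(2)[OF subfieldE(1)[OF L]]
    by (cases "i < length f") (auto simp: coeff_nth coeff_length)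
  have fR: "coeff f i \<in> carrier R" for i using fs by simp
  define N where "N = length f"
  obtain b where b: "b \<in> A" "b \<noteq> \<zero>" "\<And>i. i < N \<Longrightarrow> coeff f i \<otimes> b \<in> A"
    using common_denominator[where u = "coeff f" and N = N, OF A fR LA[OF fL]] by auto
  have bR: "b \<in> carrier R" using b AR by auto
  have "\<exists>q. q \<in> carrier (C[X]) \<and> eval q y = coeff f i \<otimes> b" if "i < N" for i
    using b(3)[OF that] unfolding A_def simple_extension_as_eval_img[OF CR y] by force
  then obtain q where q: "\<And>i. i < N \<Longrightarrow> q i \<in> carrier (C[X])" "\<And>i. i < N \<Longrightarrow> eval (q i) y = coeff f i \<otimes> b"
    by metis
  define M where "M = (\<Sum>i<N. length (q i))"
  have lM: "length (q i) \<le> M" if "i < N" for i unfolding M_def using that by (intro member_le_sum) auto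
  define c where "c = (\<lambda>i j. if i < N then coeff (q i) j else \<zero>)"
  have z: "\<zero> \<in> C" using subringE(2)[OF subfieldE(1)[OF C]] .
  have qs: "set (q i) \<subseteq> C" if "i < N" for i
    using subfield_poly_carrier(2)[OF C q(1)[OF that]] .
  have cC: "c i j \<in> C" for i j
    using qs[of i] z by (cases "j < length (q i)") (auto simp: c_def coeff_nth coeff_length subset_iff)
  have cR: "c i j \<in> carrier R" for i j using cC CR by auto
  have cM: "i < N \<and> j < M" if "c i j \<noteq> \<zero>" for i j
    using that lM[of i] coeff_length[of "q i" j]
    by (cases "i < N"; cases "j < length (q i)") (auto simp: c_def)
  have ev: "psum M (c i) y = coeff f i \<otimes> b" if "i < N" for i
  proof -
    have ci: "c i = coeff (q i)" using that by (auto simp: c_def)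
    have qR: "coeff (q i) j \<in> carrier R" for j using cR[of i j] by (simp add: ci)
    have "psum M (c i) y = psum (length (q i)) (coeff (q i)) y" unfolding ci
      using qR y lM[OF that] coeff_length[of "q i"] by (intro psum_extend_le) auto
    also have "psum (length (q i)) (coeff (q i)) y = eval (q i) y"
      using qs[OF that] CR y by (intro eval_eq_psum[symmetric]) auto
    finally show ?thesis using q(2)[OF that] by simp
  qed
  have "bisum N M c x y = psum N (\<lambda>i. coeff f i \<otimes> b) x"
    unfolding bisum_def using ev fR bR x by (intro psum_cong) auto
  also have "\<dots> = eval f x \<otimes> b" using fs fR bR x by (simp add: psum_mult_right eval_eq_psum N_def)
  finally have "bisum N M c x y = \<zero>" using f(3) bR by simp
  moreover have "\<exists>i j. c i j \<noteq> \<zero>"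
  proof -
    have N0: "N - 1 < N" using f(2) by (simp add: N_def)
    have "coeff f (N - 1) \<noteq> \<zero>"
      using f(1,2) lead_coeff_simp[OF f(2)] unfolding univ_poly_carrier[symmetric] polynomial_def N_def by auto
    hence "psum M (c (N - 1)) y \<noteq> \<zero>" unfolding ev[OF N0] using integral[of "coeff f (N - 1)" b] fR bR b by blast
    thus ?thesis using psum_zero[of M "c (N - 1)" y] y by blast
  qed
  ultimately show ?thesis using cC cM unfolding bounded_coeffs_def by blast
qed

context
  fixes C \<delta>
  assumes C: "subfield C R" and perfect: "\<And>a. a \<in> C \<Longrightarrow> \<exists>b\<in>C. b [^] p = a"
    and der: "derivation \<delta>" and der_C: "\<And>a. a \<in> C \<Longrightarrow> \<delta> a = \<zero>"
begin

lemma der_bisum: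
  assumes c: "bounded_coeffs C N M c" and x: "x \<in> carrier R" and y: "y \<in> carrier R"
  shows "\<delta> (bisum N M c x y) = 
    dx_bisum N M c x y \<otimes> \<delta> x \<oplus> dx_bisum M N (\<lambda>j i. c i j) y x \<otimes> \<delta> y"
proof -
  have cC: "c i j \<in> C" for i j using c by (auto simp: bounded_coeffs_def)
  have cR: "c i j \<in> carrier R" for i j using cC subfieldE(3)[OF C] by auto
  have "dpsum M (\<lambda>j. psum N (\<lambda>i. c i j) x) y = psum N (\<lambda>i. dpsum M (c i) y) x"
  proof (cases M)
    case (Suc M')
    have "dpsum M (\<lambda>j. psum N (\<lambda>i. c i j) x) y = psum M' (\<lambda>j. psum N (\<lambda>i. [Suc j] \<cdot> c i (Suc j)) x) y"
      unfolding Suc using cR x y by (simp add: dpsum_shift psum_add_pow del: add.nat_pow_Suc)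
    also have "\<dots> = psum N (\<lambda>i. psum M' (\<lambda>j. [Suc j] \<cdot> c i (Suc j)) y) x"
      using cR x y by (intro psum_swap[symmetric]) auto
    also have "\<dots> = psum N (\<lambda>i. dpsum M (c i) y) x"
      unfolding Suc using cR x y by (simp add: dpsum_shift del: add.nat_pow_Suc)
    finally show ?thesis .
  qed (use x y in \<open>simp add: psum_zero\<close>)
  moreover have "\<delta> (bisum N M c x y) = psum N (\<lambda>i. dpsum M (c i) y \<otimes> \<delta> y) x \<oplus> dx_bisum N M c x y \<otimes> \<delta> x"
    unfolding bisum_def dx_bisum_def using cR x y der_C cC
    by (simp add: der_psum[OF der] der_psum_const[OF der] psum_zero der_closed[OF der])
  ultimately show ?thesis unfolding dx_bisum_def
    using cR x y der_closed[OF der] by (simp add: psum_mult_right a_comm)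
qed

text \<open>An element with nonzero derivative is transcendental over \<open>C\<close>: a relation for \<open>y\<close> alone is a relation
  in a box of width one, and a separable relation of width one involves only \<open>y\<close>. Differentiating it
  would give \<open>\<delta> y = 0\<close>.\<close>

lemma no_univariate_relation:
  assumes y: "y \<in> carrier R" "\<delta> y \<noteq> \<zero>" and u: "\<And>j. u j \<in> C" "\<And>j. u j \<noteq> \<zero> \<Longrightarrow> j < M"
    and z: "psum M u y = \<zero>"
  shows "u j = \<zero>"
proof (rule ccontr)
  assume nz: "u j \<noteq> \<zero>"
  have C0: "\<zero> \<in> C" using subringE(2)[OF subfieldE(1)[OF C]] .
  have uR: "u j \<in> carrier R" for j using u subfieldE(3)[OF C] by auto
  define c where "c = (\<lambda>i j. if i = (0::nat) then u j else \<zero>)"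
  have c: "bounded_coeffs C 1 M c" 
    unfolding bounded_coeffs_def c_def using u C0 nz by auto
  \<comment> \<open>The first element is arbitrary, as it occurs only with exponent \<open>0\<close>.\<close>
  have "bisum 1 M c \<one> y = \<zero>" using uR y z by (simp add: bisum_def psum_Suc c_def)
  then obtain N' M' c' where N': "N' \<le> 1" and c': "bounded_coeffs C N' M' c'" "bisum N' M' c' \<one> y = \<zero>"
    "dx_bisum N' M' c' \<one> y \<noteq> \<zero> \<or> dx_bisum M' N' (\<lambda>j i. c' i j) y \<one> \<noteq> \<zero>"
    using separable_relation[OF C perfect one_closed y(1) c] by blast
  have cR: "c' i j \<in> carrier R" for i j using c'(1) subfieldE(3)[OF C] by (auto simp: bounded_coeffs_def)
  have "dx_bisum N' M' c' \<one> y = \<zero>"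
    using N' cR y by (cases N') (auto simp: dx_bisum_def dpsum_Suc)
  hence "dx_bisum M' N' (\<lambda>j i. c' i j) y \<one> \<noteq> \<zero>" using c' by simp
  moreover have "dx_bisum M' N' (\<lambda>j i. c' i j) y \<one> \<in> carrier R"
    using cR y by (auto simp: dx_bisum_def)
  moreover have "dx_bisum M' N' (\<lambda>j i. c' i j) y \<one> \<otimes> \<delta> y = \<zero>"
    using der_bisum[OF c'(1) one_closed y(1)] c'(2) calculation(2) y der_closed[OF der]
    by (simp add: \<open>dx_bisum N' M' c' \<one> y = \<zero>\<close> der_zero[OF der] der_one[OF der])
  ultimately show False using integral y der_closed[OF der] by blast
qed

lemma relation_imp_algebraic:
  assumes c: "bounded_coeffs C N M c" "bisum N M c x y = \<zero>" and x: "x \<in> carrier R"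
    and y: "y \<in> carrier R" "\<delta> y \<noteq> \<zero>" 
    and L: "subfield L R" "C \<subseteq> L" "y \<in> L"
  shows "algebraic L x"
proof -
  have cC: "c i j \<in> C" and cb: "c i j \<noteq> \<zero> \<Longrightarrow> i < N \<and> j < M" for i j 
    using c by (auto simp: bounded_coeffs_def)
  have cR: "c i j \<in> carrier R" for i j using cC subfieldE(3)[OF C] by auto
  define u where "u = (\<lambda>i. psum M (c i) y)"
  have uL: "u i \<in> L" for i
    unfolding u_def using cC L by (intro psum_in_subring subfieldE(1)) auto
  have uN: "u i = \<zero>" if "i \<ge> N" for i
    unfolding u_def using that cb y by (intro psum_zero) (auto simp: not_le[symmetric])
  obtain q where q: "q \<in> carrier (L[X])" "eval q x = psum N u x" "coeff q = u"
    using poly_of_psum[where u = u, OF L(1) uL uN x] by blast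
  obtain i j where ij: "c i j \<noteq> \<zero>" using c by (auto simp: bounded_coeffs_def)
  have "u i \<noteq> \<zero>" unfolding u_def
    using no_univariate_relation[OF y, of "c i" M j] cC cb ij by blast
  hence "q \<noteq> []" using q(3) by auto
  moreover have "eval q x = \<zero>" using q(2) c(2) by (simp add: bisum_def u_def)
  ultimately have "(algebraic over L) x" using algebraicI[OF q(1)] by blast
  thus ?thesis by (simp add: over_def)
qed

text \<open>Exchange shows that \<open>z\<close> is algebraic over \<open>C(w)\<close>: \<open>w\<close> is algebraic over \<open>C(z)\<close> but not over \<open>C\<close>. By
  transitivity \<open>a\<close> is algebraic over \<open>C(w)\<close>. In a separable relation \<open>P(a, w) = 0\<close> the identity
  \<open>P\<^sub>x(a, w) \<delta> a + P\<^sub>y(a, w) \<delta> w = 0\<close> with \<open>\<delta> w \<noteq> 0\<close> rules out \<open>P\<^sub>x(a, w) = 0\<close>, so \<open>a\<close> is a simple root of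
  \<open>P(X, w)\<close>, which has coefficients in \<open>L\<close>.\<close>

lemma separable_over_nonconstant:
  assumes L: "subfield L R" "C \<subseteq> L" and w: "w \<in> L" "\<delta> w \<noteq> \<zero>" and z: "z \<in> carrier R"
    and alg: "\<And>a. a \<in> carrier R \<Longrightarrow> algebraic (generate_field R (insert z C)) a"
    and a: "a \<in> carrier R"
  shows "separable_element R L a"
proof -
  have CR: "C \<subseteq> carrier R" using subfieldE(3)[OF C] .
  have wR: "w \<in> carrier R" using w subfieldE(3)[OF L(1)] by auto
  define M where "M = generate_field R (insert w C)"
  have M: "subfield M R" unfolding M_def using CR wR by (intro generate_field_is_subfield) auto
  have CM: "C \<subseteq> M" "w \<in> M" unfolding M_def by (auto intro: generate_field.incl)
  have algz: "algebraic M z"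
  proof -
    obtain N1 N2 c where c: "bounded_coeffs C N1 N2 c" "bisum N1 N2 c w z = \<zero>"
      using algebraic_imp_relation[OF C wR z alg[OF wR]] by blast
    have cR: "c i j \<in> carrier R" for i j using c(1) CR by (auto simp: bounded_coeffs_def)
    have "bisum N2 N1 (\<lambda>j i. c i j) z w = \<zero>" using bisum_swap[OF cR wR z] c(2) by simp
    thus ?thesis by (intro relation_imp_algebraic[OF bounded_coeffs_swap[OF c(1)] _ z wR w(2) M CM])
  qed
  define E where "E = simple_extension M z"
  have E: "subfield E R" unfolding E_def
    using simple_extension_is_subfield[OF M z] algz by (simp add: over_def)
  have ME: "M \<subseteq> E" "z \<in> E" unfolding E_def
    using simple_extension_incl[OF subfieldE(3)[OF M] z] simple_extension_mem[OF subfieldE(1)[OF M] z] by auto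
  have "generate_field R (insert z C) \<subseteq> E"
    using CR z ME CM by (intro generate_field_min_subfield1[OF _ E]) auto
  hence algE: "(algebraic over E) a" 
    using algebraic_mono[of "generate_field R (insert z C)" E a] alg[OF a] by (simp add: over_def)
  define G where "G = simple_extension E a"
  have G: "subfield G R" unfolding G_def using simple_extension_is_subfield[OF E a] algE by simp
  have "finite_dimension M E" unfolding E_def
    using finite_dimension_simple_extension[OF M z] algz by (simp add: over_def)
  moreover have "finite_dimension E G" unfolding G_def
    using finite_dimension_simple_extension[OF E a] algE by simp
  ultimately have "finite_dimension M G" using telescopic_base_dim(1)[OF M E] by blast
  moreover have "a \<in> G" unfolding G_def using simple_extension_mem[OF subfieldE(1)[OF E] a] .
  ultimately have "(algebraic over M) a"
    using finite_dimension_imp_algebraic[OF M subfieldE(1)[OF G]] by blast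
  hence "algebraic (generate_field R (insert w C)) a" by (simp add: over_def M_def)
  then obtain N1 N2 c where c: "bounded_coeffs C N1 N2 c" "bisum N1 N2 c a w = \<zero>"
    using algebraic_imp_relation[OF C a wR] by blast
  obtain A B c' where c': "bounded_coeffs C A B c'" "bisum A B c' a w = \<zero>"
    "dx_bisum A B c' a w \<noteq> \<zero> \<or> dx_bisum B A (\<lambda>j i. c' i j) w a \<noteq> \<zero>"
    using separable_relation[OF C perfect a wR c] by blast
  have cC: "c' i j \<in> C" and cb: "c' i j \<noteq> \<zero> \<Longrightarrow> i < A \<and> j < B" for i j 
    using c' by (auto simp: bounded_coeffs_def)
  have cR: "c' i j \<in> carrier R" for i j using cC CR by auto
  have nz: "dx_bisum A B c' a w \<noteq> \<zero>"
  proof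
    assume z: "dx_bisum A B c' a w = \<zero>"
    define t where "t = dx_bisum B A (\<lambda>j i. c' i j) w a"
    have t: "t \<in> carrier R" "t \<noteq> \<zero>" using c'(3) z cR wR a by (auto simp: t_def dx_bisum_def)
    have dw: "\<delta> w \<in> carrier R" "\<delta> a \<in> carrier R" using der_closed[OF der] wR a by auto
    have "\<zero> = \<zero> \<otimes> \<delta> a \<oplus> t \<otimes> \<delta> w"
      using der_bisum[OF c'(1) a wR] c'(2) z der_zero[OF der] by (simp add: t_def)
    hence "t \<otimes> \<delta> w = \<zero>" using t dw by simp
    thus False using integral[of t "\<delta> w"] t dw w by blast
  qed
  define u where "u = (\<lambda>i. psum B (c' i) w)"
  have uL: "u i \<in> L" for i
    unfolding u_def using cC L w by (intro psum_in_subring subfieldE(1)) auto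
  have uN: "u i = \<zero>" if "i \<ge> A" for i
    unfolding u_def using that cb wR by (intro psum_zero) (auto simp: not_le[symmetric])
  obtain q where q: "q \<in> carrier (L[X])" "eval q a = psum A u a" "deval q a = dpsum A u a"
    using poly_of_psum[where u = u, OF L(1) uL uN a] by blast
  show ?thesis
    using c'(2) nz by (intro separable_elementI[OF L(1) q(1) a]) (auto simp: q bisum_def dx_bisum_def u_def)
qed

end
end

section \<open>Determinants with dependent columns\<close>

context cring begin

lemma finsum_swap_lessThan:
  fixes N :: nat
  assumes "finite A" "\<And>a j. a \<in> A \<Longrightarrow> f a j \<in> carrier R"
  shows "(\<Oplus>j\<in>{..<N}. \<Oplus>a\<in>A. f a j) = (\<Oplus>a\<in>A. \<Oplus>j\<in>{..<N}. f a j)"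
proof (induction N)
  case 0
  show ?case by (simp add: finsum_empty finsum_zero)
next
  case (Suc N)
  have "(\<Oplus>j\<in>{..<Suc N}. \<Oplus>a\<in>A. f a j) = (\<Oplus>j\<in>{..<N}. \<Oplus>a\<in>A. f a j) \<oplus> (\<Oplus>a\<in>A. f a N)"
    using assms by (intro finsum_lessThan_Suc) (auto intro!: finsum_closed)
  also have "\<dots> = (\<Oplus>a\<in>A. (\<Oplus>j\<in>{..<N}. f a j) \<oplus> f a N)"
    unfolding Suc using assms by (intro finsum_addf[symmetric]) (auto intro!: finsum_closed)
  also have "\<dots> = (\<Oplus>a\<in>A. \<Oplus>j\<in>{..<Suc N}. f a j)"
    using assms by (intro finsum_cong') (auto simp: finsum_lessThan_Suc intro!: finsum_closed)
  finally show ?case .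
qed

end

context field begin

lemma ring_det_cong:
  assumes "\<And>i j. i < N \<Longrightarrow> j < N \<Longrightarrow> A i j = B i j" "\<And>i j. B i j \<in> carrier R"
  shows "ring_det R N A = ring_det R N B"
  unfolding ring_det_def
proof (rule finsum_cong')
  fix \<sigma> assume s: "\<sigma> \<in> {\<sigma>. \<sigma> permutes {..<N}}"
  have "(\<Otimes>i\<in>{..<N}. A i (\<sigma> i)) = (\<Otimes>i\<in>{..<N}. B i (\<sigma> i))"
  proof (rule finprod_cong')
    fix i assume i: "i \<in> {..<N}"
    hence "\<sigma> i < N" using permutes_in_image[of \<sigma> "{..<N}" i] s by auto
    thus "A i (\<sigma> i) = B i (\<sigma> i)" using assms(1) i by simp
  qed (use assms in auto)
  thus "(if evenperm \<sigma> then \<one> else \<ominus> \<one>) \<otimes> (\<Otimes>i\<in>{..<N}. A i (\<sigma> i)) =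
        (if evenperm \<sigma> then \<one> else \<ominus> \<one>) \<otimes> (\<Otimes>i\<in>{..<N}. B i (\<sigma> i))" by simp
qed (use assms in \<open>auto intro!: finprod_closed\<close>)

text \<open>Cramer's argument. Let \<open>T j\<close> be the determinant with column \<open>j\<^sub>0\<close> replaced by column \<open>j\<close>. For
  \<open>j \<noteq> j\<^sub>0\<close> two columns agree, so \<open>T j = 0\<close>. By linearity in column \<open>j\<^sub>0\<close> and the relation between the columns,
  \<open>\<Sum> w\<^sub>j T j = 0\<close>. Hence \<open>w\<^sub>j\<^sub>0 T j\<^sub>0 = 0\<close>, and \<open>T j\<^sub>0\<close> is the original determinant. Away from
  characteristic \<open>2\<close>, \<open>T j = 0\<close> for two equal columns follows from \<open>T j = - T j\<close>.\<close>

lemma ring_det_eq_zero: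
  assumes two: "\<one> \<oplus> \<one> \<noteq> \<zero>"
    and A: "\<And>i j. A i j \<in> carrier R" and w: "\<And>j. w j \<in> carrier R"
    and j0: "j0 < N" "w j0 \<noteq> \<zero>"
    and rel: "\<And>i. i < N \<Longrightarrow> (\<Oplus>j\<in>{..<N}. w j \<otimes> A i j) = \<zero>"
  shows "ring_det R N A = \<zero>"
proof -
  let ?P = "{\<sigma>. \<sigma> permutes {..<N}}"
  define sg where "sg = (\<lambda>\<sigma>::nat\<Rightarrow>nat. if evenperm \<sigma> then \<one> else \<ominus> \<one>)"
  define f where "f = (\<lambda>j k. if k = j0 then j else (k::nat))"
  define m where "m = (\<lambda>j \<sigma>. finprod R (\<lambda>i. A i (f j (\<sigma> i))) {..<N})"
  define T where "T = (\<lambda>j. \<Oplus>\<sigma>\<in>?P. sg \<sigma> \<otimes> m j \<sigma>)"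
  have fin: "finite ?P" by (rule finite_permutations) simp
  have sg: "sg \<sigma> \<in> carrier R" for \<sigma> by (simp add: sg_def)
  have m: "m j \<sigma> \<in> carrier R" for j \<sigma> unfolding m_def using A by (intro finprod_closed) auto
  have T: "T j \<in> carrier R" for j unfolding T_def using sg m by (intro finsum_closed) auto
  have T_zero: "T j = \<zero>" if "j \<noteq> j0" "j < N" for j
  proof -
    let ?\<tau> = "Transposition.transpose j j0"
    have tau: "?\<tau> permutes {..<N}" using that j0 by (intro permutes_swap_id) auto
    have inj: "inj_on (\<lambda>\<sigma>. ?\<tau> \<circ> \<sigma>) ?P"
      by (intro inj_onI) (metis comp_assoc transpose_comp_involutory id_comp)
    have img: "(\<lambda>\<sigma>. ?\<tau> \<circ> \<sigma>) ` ?P = ?P"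
    proof
      show "(\<lambda>\<sigma>. ?\<tau> \<circ> \<sigma>) ` ?P \<subseteq> ?P" using tau permutes_compose by auto
      show "?P \<subseteq> (\<lambda>\<sigma>. ?\<tau> \<circ> \<sigma>) ` ?P"
      proof
        fix \<sigma> assume "\<sigma> \<in> ?P"
        hence "?\<tau> \<circ> \<sigma> \<in> ?P" using tau permutes_compose by auto
        moreover have "\<sigma> = ?\<tau> \<circ> (?\<tau> \<circ> \<sigma>)" by (metis comp_assoc transpose_comp_involutory id_comp)
        ultimately show "\<sigma> \<in> (\<lambda>\<sigma>. ?\<tau> \<circ> \<sigma>) ` ?P" by blast
      qed
    qed
    have ft: "f j (?\<tau> k) = f j k" for k by (auto simp: f_def Transposition.transpose_def)
    have "T j = (\<Oplus>\<sigma>\<in>(\<lambda>\<sigma>. ?\<tau> \<circ> \<sigma>) ` ?P. sg \<sigma> \<otimes> m j \<sigma>)" unfolding T_def img ..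
    also have "\<dots> = (\<Oplus>\<sigma>\<in>?P. sg (?\<tau> \<circ> \<sigma>) \<otimes> m j (?\<tau> \<circ> \<sigma>))"
      using sg m inj by (intro finsum_reindex) auto
    also have "\<dots> = (\<Oplus>\<sigma>\<in>?P. (\<ominus> \<one>) \<otimes> (sg \<sigma> \<otimes> m j \<sigma>))"
    proof (rule finsum_cong')
      fix \<sigma> assume s: "\<sigma> \<in> ?P"
      have "permutation \<sigma>" "permutation ?\<tau>"
        using s tau permutation_permutes by blast+
      hence "sg (?\<tau> \<circ> \<sigma>) = (\<ominus> \<one>) \<otimes> sg \<sigma>"
        using that by (simp add: sg_def evenperm_comp evenperm_swap l_minus)
      moreover have "m j (?\<tau> \<circ> \<sigma>) = m j \<sigma>" by (simp add: m_def ft)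
      ultimately show "sg (?\<tau> \<circ> \<sigma>) \<otimes> m j (?\<tau> \<circ> \<sigma>) = (\<ominus> \<one>) \<otimes> (sg \<sigma> \<otimes> m j \<sigma>)"
        using sg m by (simp add: m_assoc)
    qed (use sg m in auto)
    also have "\<dots> = (\<ominus> \<one>) \<otimes> T j"
      unfolding T_def using sg m fin by (intro finsum_rdistr[symmetric]) auto
    also have "\<dots> = \<ominus> T j" using T by (simp add: l_minus)
    finally have "T j \<oplus> T j = \<zero>" using T by (metis r_neg)
    hence "(\<one> \<oplus> \<one>) \<otimes> T j = \<zero>" using T by (simp add: l_distr)
    thus ?thesis using integral[of "\<one> \<oplus> \<one>" "T j"] two T by auto
  qed
  have row: "(\<Oplus>j\<in>{..<N}. w j \<otimes> m j \<sigma>) = \<zero>" if s: "\<sigma> \<in> ?P" for \<sigma>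
  proof -
    have s: "\<sigma> permutes {..<N}" using s by simp
    obtain r where r: "r < N" "\<sigma> r = j0"
      using permutes_image[OF s] j0(1) by (metis imageE lessThan_iff)
    define m' where "m' = finprod R (\<lambda>i. A i (\<sigma> i)) ({..<N} - {r})"
    have m': "m' \<in> carrier R" unfolding m'_def using A by (intro finprod_closed) auto
    have mj: "m j \<sigma> = A r j \<otimes> m'" for j
    proof -
      have "m j \<sigma> = finprod R (\<lambda>i. A i (f j (\<sigma> i))) (insert r ({..<N} - {r}))"
        unfolding m_def using r by (simp add: insert_absorb)
      also have "\<dots> = A r (f j (\<sigma> r)) \<otimes> finprod R (\<lambda>i. A i (f j (\<sigma> i))) ({..<N} - {r})"
        using A by (intro finprod_insert) auto
      also have "finprod R (\<lambda>i. A i (f j (\<sigma> i))) ({..<N} - {r}) = m'"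
        unfolding m'_def
      proof (rule finprod_cong')
        fix i assume "i \<in> {..<N} - {r}"
        hence "\<sigma> i \<noteq> j0" using r permutes_inj[OF s] by (auto dest: injD)
        thus "A i (f j (\<sigma> i)) = A i (\<sigma> i)" by (simp add: f_def)
      qed (use A in auto)
      finally show ?thesis using r by (simp add: f_def)
    qed
    have "(\<Oplus>j\<in>{..<N}. w j \<otimes> m j \<sigma>) = (\<Oplus>j\<in>{..<N}. (w j \<otimes> A r j) \<otimes> m')"
      unfolding mj using A w m' by (intro finsum_cong') (auto simp: m_assoc)
    also have "\<dots> = (\<Oplus>j\<in>{..<N}. w j \<otimes> A r j) \<otimes> m'"
      using A w m' by (intro finsum_ldistr[symmetric]) auto
    finally show ?thesis using rel[OF r(1)] m' by simp
  qed
  have "(\<Oplus>j\<in>{..<N}. w j \<otimes> T j) = (\<Oplus>j\<in>{..<N}. \<Oplus>\<sigma>\<in>?P. sg \<sigma> \<otimes> (w j \<otimes> m j \<sigma>))"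
  proof (rule finsum_cong')
    fix j
    have "w j \<otimes> T j = (\<Oplus>\<sigma>\<in>?P. w j \<otimes> (sg \<sigma> \<otimes> m j \<sigma>))"
      unfolding T_def using fin w sg m by (intro finsum_rdistr) auto
    also have "\<dots> = (\<Oplus>\<sigma>\<in>?P. sg \<sigma> \<otimes> (w j \<otimes> m j \<sigma>))"
      using w sg m by (intro finsum_cong') (auto simp: m_lcomm)
    finally show "w j \<otimes> T j = (\<Oplus>\<sigma>\<in>?P. sg \<sigma> \<otimes> (w j \<otimes> m j \<sigma>))" .
  qed (use w sg m in \<open>auto intro!: finsum_closed\<close>)
  also have "\<dots> = (\<Oplus>\<sigma>\<in>?P. \<Oplus>j\<in>{..<N}. sg \<sigma> \<otimes> (w j \<otimes> m j \<sigma>))"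
    using w sg m fin by (intro finsum_swap_lessThan) auto
  also have "\<dots> = (\<Oplus>\<sigma>\<in>?P. \<zero>)"
  proof (rule finsum_cong')
    fix \<sigma> assume s: "\<sigma> \<in> ?P"
    have "(\<Oplus>j\<in>{..<N}. sg \<sigma> \<otimes> (w j \<otimes> m j \<sigma>)) = sg \<sigma> \<otimes> (\<Oplus>j\<in>{..<N}. w j \<otimes> m j \<sigma>)"
      using w sg m by (intro finsum_rdistr[symmetric]) auto
    thus "(\<Oplus>j\<in>{..<N}. sg \<sigma> \<otimes> (w j \<otimes> m j \<sigma>)) = \<zero>" using row[OF s] sg by simp
  qed auto
  finally have "(\<Oplus>j\<in>{..<N}. w j \<otimes> T j) = \<zero>" by (simp add: finsum_zero)
  moreover have "(\<Oplus>j\<in>{..<N}. w j \<otimes> T j) = (\<Oplus>j\<in>{..<N}. if j0 = j then w j \<otimes> T j else \<zero>)"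
    using T_zero w T by (intro finsum_cong') auto
  moreover have "\<dots> = w j0 \<otimes> T j0"
    using j0 w T by (intro add.finprod_singleton) auto
  ultimately have "T j0 = \<zero>" using integral[of "w j0" "T j0"] j0 w T by auto
  moreover have "T j0 = ring_det R N A"
  proof -
    have "f j0 = (\<lambda>k. k)" by (auto simp: f_def)
    thus ?thesis unfolding T_def m_def ring_det_def sg_def by simp
  qed
  ultimately show ?thesis by simp
qed

end

section \<open>Hasse derivatives\<close>

context field begin

context
  fixes C z D
  assumes hasse: "hasse_derivatives R C z D" and C: "subfield C R" 
    and sepz: "separating_element R C z"
begin

lemma zR: "z \<in> carrier R" using sepz by (simp add: separating_element_def)

lemma hasse_closed [simp]: "f \<in> carrier R \<Longrightarrow> D k f \<in> carrier R"
  and hasse_0: "f \<in> carrier R \<Longrightarrow> D 0 f = f"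
  and hasse_add: "f \<in> carrier R \<Longrightarrow> g \<in> carrier R \<Longrightarrow> D k (f \<oplus> g) = D k f \<oplus> D k g"
  and hasse_linear: "c \<in> C \<Longrightarrow> f \<in> carrier R \<Longrightarrow> D k (c \<otimes> f) = c \<otimes> D k f"
  and hasse_mult: "f \<in> carrier R \<Longrightarrow> g \<in> carrier R \<Longrightarrow> D k (f \<otimes> g) = (\<Oplus>i\<in>{..k}. D i f \<otimes> D (k - i) g)"
  and hasse_pow: "D k (z [^] m) = [(m choose k)] \<cdot> (z [^] (m - k))"
  using hasse unfolding hasse_derivatives_def by blast+

lemma hasse_zero: "D k \<zero> = \<zero>"
  using hasse_add[of \<zero> \<zero> k] hasse_closed[of \<zero> k] by (metis add.r_cancel_one' r_zero zero_closed)

lemma hasse_one: "k > 0 \<Longrightarrow> D k \<one> = \<zero>"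
  using hasse_pow[of k 0] by (simp add: binomial_eq_0)

lemma hasse_const:
  assumes "c \<in> C" "k > 0" shows "D k c = \<zero>"
proof -
  have "c \<in> carrier R" using assms subfieldE(3)[OF C] by auto
  thus ?thesis using hasse_linear[OF assms(1) one_closed, of k] hasse_one[OF assms(2)] by simp
qed

lemma hasse_z: "D (Suc k) z = (if k = 0 then \<one> else \<zero>)"
  using hasse_pow[of "Suc k" 1] zR by (auto simp: binomial_eq_0)

lemma hasse_derivation: "derivation (D 1)"
  unfolding derivation_def
proof (safe)
  fix f g assume fg: "f \<in> carrier R" "g \<in> carrier R"
  have "D 1 (f \<otimes> g) = (\<Oplus>i\<in>{..Suc 0}. D i f \<otimes> D (1 - i) g)" using hasse_mult[OF fg, of 1] by simp
  also have "\<dots> = D 1 f \<otimes> g \<oplus> f \<otimes> D 1 g"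
    using fg by (subst finsum_Suc) (auto simp: finsum_0 hasse_0)
  finally show "D 1 (f \<otimes> g) = D 1 f \<otimes> g \<oplus> f \<otimes> D 1 g" .
qed (auto simp: hasse_add)

text \<open>The composition rule, by strong induction on \<open>k\<close>. Let \<open>\<delta> k\<close> be the difference of the two sides. If
  \<open>\<delta> i = 0\<close> for \<open>i < k\<close>, then the product rule of \<open>D\<close> makes \<open>\<delta> k\<close> a derivation. It kills \<open>C\<close> and \<open>z\<close>, and
  everything is separable over \<open>C(z)\<close>, so it is zero.\<close>

lemma hasse_compose:
  assumes f: "f \<in> carrier R"
  shows "[Suc k] \<cdot> D (Suc k) f = D k (D 1 f)"
  using f
proof (induction k arbitrary: f rule: less_induct)
  case (less k)
  define \<delta> where "\<delta> = (\<lambda>i f. [Suc i] \<cdot> D (Suc i) f \<ominus> D i (D 1 f))"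
  have cl: "\<delta> i f \<in> carrier R" if "f \<in> carrier R" for i f unfolding \<delta>_def using that by (intro minus_closed) auto
  have lower: "\<delta> i f = \<zero>" if "f \<in> carrier R" "i < k" for i f
    unfolding \<delta>_def less.IH[OF that(2,1)] using that by (simp add: r_neg minus_eq)
  have split: "[Suc i] \<cdot> D (Suc i) f = \<delta> i f \<oplus> D i (D 1 f)" if "f \<in> carrier R" for i f
  proof -
    define a where "a = [Suc i] \<cdot> D (Suc i) f"
    define b where "b = D i (D 1 f)"
    have "a \<in> carrier R" "b \<in> carrier R" using that by (simp_all add: a_def b_def)
    thus ?thesis unfolding \<delta>_def a_def[symmetric] b_def[symmetric] by algebra
  qed
  have "derivation (\<delta> k)"
    unfolding derivation_def
  proof (safe)
    fix f g assume fg: "f \<in> carrier R" "g \<in> carrier R"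
    define a where "a = [Suc k] \<cdot> D (Suc k) f"
    define a' where "a' = [Suc k] \<cdot> D (Suc k) g"
    define b where "b = D k (D 1 f)"
    define b' where "b' = D k (D 1 g)"
    have "a \<in> carrier R" "a' \<in> carrier R" "b \<in> carrier R" "b' \<in> carrier R"
      using fg by (simp_all add: a_def a'_def b_def b'_def)
    hence "(a \<oplus> a') \<ominus> (b \<oplus> b') = (a \<ominus> b) \<oplus> (a' \<ominus> b')" by algebra
    thus "\<delta> k (f \<oplus> g) = \<delta> k f \<oplus> \<delta> k g"
      unfolding \<delta>_def using fg
      by (simp add: hasse_add add.nat_pow_distrib a_def a'_def b_def b'_def del: add.nat_pow_Suc)
  next
    fix f g assume fg: "f \<in> carrier R" "g \<in> carrier R"
    define P where "P = (\<Oplus>i\<in>{..k}. D i (D 1 f) \<otimes> D (k - i) g)"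
    define Q where "Q = (\<Oplus>i\<in>{..k}. D i f \<otimes> D (k - i) (D 1 g))"
    have PQ: "P \<in> carrier R" "Q \<in> carrier R" unfolding P_def Q_def using fg by (auto intro!: finsum_closed)
    \<comment> \<open>In the product rule for \<open>D (Suc k) (f \<otimes> g)\<close> the factor \<open>Suc k\<close> is split as \<open>i + (Suc k - i)\<close>; each
      part is then an index-shifted sum in which only one \<open>\<delta>\<close> survives.\<close>
    have s1: "(\<Oplus>i\<in>{..Suc k}. ([i] \<cdot> D i f) \<otimes> D (Suc k - i) g) = \<delta> k f \<otimes> g \<oplus> P"
    proof -
      have "(\<Oplus>i\<in>{..Suc k}. ([i] \<cdot> D i f) \<otimes> D (Suc k - i) g) = 
          (\<Oplus>i\<in>{..k}. ([Suc i] \<cdot> D (Suc i) f) \<otimes> D (Suc k - Suc i) g) \<oplus> ([(0::nat)] \<cdot> D 0 f) \<otimes> D (Suc k - 0) g"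
        using fg by (intro finsum_Suc2) auto
      also have "(\<Oplus>i\<in>{..k}. ([Suc i] \<cdot> D (Suc i) f) \<otimes> D (Suc k - Suc i) g)
         = (\<Oplus>i\<in>{..k}. \<delta> i f \<otimes> D (k - i) g \<oplus> D i (D 1 f) \<otimes> D (k - i) g)"
        using fg cl by (intro finsum_cong') (auto simp: split l_distr simp del: add.nat_pow_Suc)
      also have "\<dots> = (\<Oplus>i\<in>{..k}. \<delta> i f \<otimes> D (k - i) g) \<oplus> P"
        unfolding P_def using fg cl by (intro finsum_addf) auto
      also have "(\<Oplus>i\<in>{..k}. \<delta> i f \<otimes> D (k - i) g) = (\<Oplus>i\<in>{..k}. if k = i then \<delta> i f \<otimes> D (k - i) g else \<zero>)"
        using fg cl lower by (intro finsum_cong') auto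
      also have "\<dots> = \<delta> k f \<otimes> g"
        using fg cl by (subst add.finprod_singleton) (auto simp: hasse_0)
      finally show ?thesis using fg cl PQ by simp
    qed
    have s2: "(\<Oplus>i\<in>{..Suc k}. D i f \<otimes> ([(Suc k - i)] \<cdot> D (Suc k - i) g)) = f \<otimes> \<delta> k g \<oplus> Q"
    proof -
      have "(\<Oplus>i\<in>{..Suc k}. D i f \<otimes> ([(Suc k - i)] \<cdot> D (Suc k - i) g)) = 
          D (Suc k) f \<otimes> ([(Suc k - Suc k)] \<cdot> D (Suc k - Suc k) g) \<oplus> (\<Oplus>i\<in>{..k}. D i f \<otimes> ([(Suc k - i)] \<cdot> D (Suc k - i) g))"
        using fg by (intro finsum_Suc) auto
      also have "(\<Oplus>i\<in>{..k}. D i f \<otimes> ([(Suc k - i)] \<cdot> D (Suc k - i) g))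
         = (\<Oplus>i\<in>{..k}. D i f \<otimes> \<delta> (k - i) g \<oplus> D i f \<otimes> D (k - i) (D 1 g))"
        using fg cl by (intro finsum_cong') (auto simp: split r_distr Suc_diff_le simp del: add.nat_pow_Suc)
      also have "\<dots> = (\<Oplus>i\<in>{..k}. D i f \<otimes> \<delta> (k - i) g) \<oplus> Q"
        unfolding Q_def using fg cl by (intro finsum_addf) auto
      also have "(\<Oplus>i\<in>{..k}. D i f \<otimes> \<delta> (k - i) g) = (\<Oplus>i\<in>{..k}. if 0 = i then D i f \<otimes> \<delta> (k - i) g else \<zero>)"
        using fg cl lower by (intro finsum_cong') auto
      also have "\<dots> = f \<otimes> \<delta> k g"
        using fg cl by (subst add.finprod_singleton) (auto simp: hasse_0)
      finally show ?thesis using fg cl PQ by simp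
    qed
    have "[Suc k] \<cdot> D (Suc k) (f \<otimes> g) = ([Suc k] \<cdot> \<one>) \<otimes> (\<Oplus>i\<in>{..Suc k}. D i f \<otimes> D (Suc k - i) g)"
      using fg by (simp add: hasse_mult add_pow_ldistr finsum_closed Pi_def del: add.nat_pow_Suc)
    also have "\<dots> = (\<Oplus>i\<in>{..Suc k}. ([Suc k] \<cdot> \<one>) \<otimes> (D i f \<otimes> D (Suc k - i) g))"
      using fg by (intro finsum_rdistr) auto
    also have "\<dots> = (\<Oplus>i\<in>{..Suc k}. ([i] \<cdot> D i f) \<otimes> D (Suc k - i) g \<oplus> D i f \<otimes> ([(Suc k - i)] \<cdot> D (Suc k - i) g))"
    proof (rule finsum_cong')
      fix i assume "i \<in> {..Suc k}"
      hence i: "i + (Suc k - i) = Suc k" by simp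
      define c where "c = D i f \<otimes> D (Suc k - i) g"
      have c: "c \<in> carrier R" using fg by (simp add: c_def)
      have "([Suc k] \<cdot> \<one>) \<otimes> c = [Suc k] \<cdot> c" using c by (simp add: add_pow_ldistr del: add.nat_pow_Suc)
      also have "\<dots> = [i] \<cdot> c \<oplus> [(Suc k - i)] \<cdot> c"
        using c add.nat_pow_mult[of c i "Suc k - i"] unfolding i by simp
      also have "[i] \<cdot> c = ([i] \<cdot> D i f) \<otimes> D (Suc k - i) g"
        unfolding c_def using fg by (intro add_pow_ldistr[symmetric]) auto
      also have "[(Suc k - i)] \<cdot> c = D i f \<otimes> ([(Suc k - i)] \<cdot> D (Suc k - i) g)"
        unfolding c_def using fg by (intro add_pow_rdistr[symmetric]) auto
      finally show "([Suc k] \<cdot> \<one>) \<otimes> (D i f \<otimes> D (Suc k - i) g) = ([i] \<cdot> D i f) \<otimes> D (Suc k - i) g \<oplus> D i f \<otimes> ([(Suc k - i)] \<cdot> D (Suc k - i) g)"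
        by (simp add: c_def)
    qed (use fg in auto)
    also have "\<dots> = (\<delta> k f \<otimes> g \<oplus> P) \<oplus> (f \<otimes> \<delta> k g \<oplus> Q)"
      unfolding s1[symmetric] s2[symmetric] using fg by (intro finsum_addf) auto
    finally have e1: "[Suc k] \<cdot> D (Suc k) (f \<otimes> g) = (\<delta> k f \<otimes> g \<oplus> P) \<oplus> (f \<otimes> \<delta> k g \<oplus> Q)" .
    have "D 1 (f \<otimes> g) = D 1 f \<otimes> g \<oplus> f \<otimes> D 1 g" using der_mult[OF hasse_derivation] fg by simp
    hence "D k (D 1 (f \<otimes> g)) = D k (D 1 f \<otimes> g) \<oplus> D k (f \<otimes> D 1 g)"
      using fg hasse_add[of "D 1 f \<otimes> g" "f \<otimes> D 1 g" k] by simp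
    also have "\<dots> = P \<oplus> Q" unfolding P_def Q_def using fg by (subst (1 2) hasse_mult) auto
    finally have e2: "D k (D 1 (f \<otimes> g)) = P \<oplus> Q" .
    define a where "a = \<delta> k f \<otimes> g"
    define b where "b = f \<otimes> \<delta> k g"
    have ab: "a \<in> carrier R" "b \<in> carrier R" using cl fg by (auto simp: a_def b_def)
    have "((a \<oplus> P) \<oplus> (b \<oplus> Q)) = (a \<oplus> b) \<oplus> (P \<oplus> Q)" using ab PQ by algebra
    hence "((a \<oplus> P) \<oplus> (b \<oplus> Q)) \<ominus> (P \<oplus> Q) = a \<oplus> b"
      using ab PQ by (simp add: minus_eq a_assoc r_neg)
    hence "((\<delta> k f \<otimes> g \<oplus> P) \<oplus> (f \<otimes> \<delta> k g \<oplus> Q)) \<ominus> (P \<oplus> Q) = \<delta> k f \<otimes> g \<oplus> f \<otimes> \<delta> k g"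
      by (simp only: a_def b_def)
    moreover have "\<delta> k (f \<otimes> g) = [Suc k] \<cdot> D (Suc k) (f \<otimes> g) \<ominus> D k (D 1 (f \<otimes> g))" by (simp only: \<delta>_def)
    ultimately show "\<delta> k (f \<otimes> g) = \<delta> k f \<otimes> g \<oplus> f \<otimes> \<delta> k g" unfolding e1 e2 by simp
  qed (use cl in auto)
  moreover have "\<delta> k s = \<zero>" if "s \<in> insert z C" for s
  proof (cases "s = z")
    case True
    show ?thesis
    proof (cases "k = 0")
      case True
      thus ?thesis using \<open>s = z\<close> zR hasse_z[of 0] by (simp add: \<delta>_def hasse_0 r_neg minus_eq)
    next
      case False
      thus ?thesis using \<open>s = z\<close> hasse_z[of k] hasse_z[of 0] hasse_one[of k] add.nat_pow_one[of "Suc k"]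
        by (simp add: \<delta>_def r_neg minus_eq del: add.nat_pow_Suc)
    qed
  next
    case False
    hence "s \<in> C" using that by simp
    thus ?thesis using hasse_const[of s "Suc k"] hasse_const[of s 1] hasse_zero add.nat_pow_one[of "Suc k"]
      by (simp add: \<delta>_def r_neg minus_eq del: add.nat_pow_Suc)
  qed
  moreover have "insert z C \<subseteq> carrier R" using zR subfieldE(3)[OF C] by auto
  moreover have "separable_element R (generate_field R (insert z C)) f"
    using sepz less.prems by (simp add: separating_element_def)
  ultimately have "\<delta> k f = \<zero>" using less.prems derivation_zero_if_separable[of "\<delta> k" "insert z C" f] by blast
  thus ?case using split[OF less.prems, of k] less.prems by simp
qed

end
end

context prime_char_field begin

context
  fixes C z D
  assumes hasse: "hasse_derivatives R C z D" and C: "subfield C R" 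
    and sepz: "separating_element R C z"
    and perfect: "\<And>a. a \<in> C \<Longrightarrow> \<exists>b\<in>C. b [^] p = a"
begin

lemma hasse_vanish:
  assumes w: "w \<in> carrier R" "D 1 w = \<zero>" and k: "0 < k" "k < p"
  shows "D k w = \<zero>"
proof -
  obtain m where m: "k = Suc m" using k by (cases k) auto
  have "[k] \<cdot> D k w = \<zero>"
    using hasse_compose[OF hasse C sepz w(1), of m] w(2) hasse_zero[OF hasse C sepz] by (simp only: m)
  moreover have "\<not> p dvd k" using k by (auto dest: dvd_imp_le)
  ultimately show ?thesis using char_mult_eq_zero hasse_closed[OF hasse C sepz w(1)] by blast
qed

text \<open>Elements killed by \<open>D 1\<close> are constants for all Hasse derivatives of order below \<open>p\<close>.\<close>

lemma hasse_relation:
  assumes w: "\<And>j. w j \<in> carrier R" "\<And>j. D 1 (w j) = \<zero>" and y: "\<And>j. y j \<in> carrier R"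
    and k: "k < p"
  shows "D k (\<Oplus>j\<in>{..<N::nat}. w j \<otimes> y j) = (\<Oplus>j\<in>{..<N}. w j \<otimes> D k (y j))"
proof (induction N)
  case 0
  show ?case by (simp add: finsum_empty hasse_zero[OF hasse C sepz])
next
  case (Suc N)
  note cl = hasse_closed[OF hasse C sepz]
  have "D k (w N \<otimes> y N) = (\<Oplus>i\<in>{..k}. D i (w N) \<otimes> D (k - i) (y N))"
    using w y by (intro hasse_mult[OF hasse C sepz])
  also have "\<dots> = (\<Oplus>i\<in>{..k}. if 0 = i then D i (w N) \<otimes> D (k - i) (y N) else \<zero>)"
    using w y k hasse_vanish[of "w N"] cl by (intro finsum_cong') auto
  also have "\<dots> = w N \<otimes> D k (y N)"
    using w y cl hasse_0[OF hasse C sepz] by (subst add.finprod_singleton) auto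
  finally have e: "D k (w N \<otimes> y N) = w N \<otimes> D k (y N)" .
  have "D k (\<Oplus>j\<in>{..<Suc N}. w j \<otimes> y j) = D k ((\<Oplus>j\<in>{..<N}. w j \<otimes> y j) \<oplus> w N \<otimes> y N)"
    using w y by (subst finsum_lessThan_Suc) auto
  also have "\<dots> = D k (\<Oplus>j\<in>{..<N}. w j \<otimes> y j) \<oplus> D k (w N \<otimes> y N)"
    using w y by (intro hasse_add[OF hasse C sepz] finsum_closed) auto
  also have "\<dots> = (\<Oplus>j\<in>{..<Suc N}. w j \<otimes> D k (y j))"
    unfolding Suc e using w y cl by (subst finsum_lessThan_Suc) auto
  finally show ?case .
qed

text \<open>The elements \<open>w\<^sub>j\<close> of \<open>L\<close> give a linear relation between the columns of the Frobenius matrix: row \<open>0\<close>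
  satisfies it by assumption, and row \<open>k + 1\<close> by applying \<open>D k\<close> to \<open>\<Sum> w\<^sub>j y\<^sub>j = 0\<close>.\<close>

theorem frobenius_det_zero_if_inseparable:
  assumes L: "subfield L R" "C \<subseteq> L" and insep: "\<not> separable_extension R L"
    and w0: "\<And>j. j \<le> n \<Longrightarrow> w0 j \<in> L" "j0 \<le> n" "w0 j0 \<noteq> \<zero>"
    and y0: "\<And>j. j \<le> n \<Longrightarrow> y0 j \<in> carrier R"
    and rel0: "(\<Oplus>j\<in>{..<Suc n}. w0 j \<otimes> y0 j) = \<zero>"
    and relq0: "(\<Oplus>j\<in>{..<Suc n}. w0 j \<otimes> y0 j [^] (q::nat)) = \<zero>"
    and n: "n < p" "2 < p"
  shows "ring_det R (Suc n) (frobenius_matrix R q y0 D [0..<n]) = \<zero>"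
proof -
  \<comment> \<open>Extension by zero, so that closure in the field holds for all indices.\<close>
  define w where "w = (\<lambda>j. if j \<le> n then w0 j else \<zero>)"
  define y where "y = (\<lambda>j. if j \<le> n then y0 j else \<zero>)"
  have w: "w j \<in> L" "w j0 \<noteq> \<zero>" for j
    using w0 subringE(2)[OF subfieldE(1)[OF L(1)]] by (auto simp: w_def)
  have y: "y j \<in> carrier R" for j using y0 by (auto simp: y_def)
  have wR0: "w0 j \<in> carrier R" if "j \<le> n" for j using that w0(1) subfieldE(3)[OF L(1)] by auto
  have rel: "(\<Oplus>j\<in>{..<Suc n}. w j \<otimes> y j) = \<zero>"
    unfolding rel0[symmetric] using wR0 y0 by (intro finsum_cong') (auto simp: w_def y_def)
  have relq: "(\<Oplus>j\<in>{..<Suc n}. w j \<otimes> y j [^] q) = \<zero>"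
    unfolding relq0[symmetric] using wR0 y0 by (intro finsum_cong') (auto simp: w_def y_def)
  have zR: "z \<in> carrier R" using zR[OF hasse C sepz] .
  have LR: "L \<subseteq> carrier R" using subfieldE(3)[OF L(1)] .
  have wR: "w j \<in> carrier R" for j using w(1) LR by auto
  have genL: "generate_field R (L \<union> {}) = L"
    using generate_field_min_subfield1[OF LR L(1)] generate_field.incl[of _ L R] by auto
  have dw: "D 1 (w j) = \<zero>" for j
  proof (rule ccontr)
    assume nz: "D 1 (w j) \<noteq> \<zero>"
    have "separable_element R L a" if "a \<in> carrier R" for a
    proof (rule separable_over_nonconstant[OF C perfect hasse_derivation[OF hasse C sepz] _ L w(1) nz zR _ that])
      show "D 1 c = \<zero>" if "c \<in> C" for c using hasse_const[OF hasse C sepz that, of 1] by simp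
      show "algebraic (generate_field R (insert z C)) a" if "a \<in> carrier R" for a
        using sepz that unfolding separating_element_def separable_element_def by blast
    qed auto
    hence "separable_extension R L" unfolding separable_extension_def
      by (intro exI[of _ "{}"]) (auto simp: genL[simplified])
    thus False using insep by blast
  qed
  have two: "\<one> \<oplus> \<one> \<noteq> \<zero>"
  proof
    assume "\<one> \<oplus> \<one> = \<zero>"
    hence "[(2::nat)] \<cdot> \<one> = \<zero>" by (simp add: numeral_2_eq_2)
    moreover have "\<not> p dvd 2" using n by (auto dest: dvd_imp_le)
    ultimately show False using char_mult_eq_zero[of \<one> 2] by auto
  qed
  have Mc: "frobenius_matrix R q y D [0..<n] i j \<in> carrier R" for i j
    using y hasse_closed[OF hasse C sepz] by (auto simp: frobenius_matrix_def split: nat.split)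
  have "ring_det R (Suc n) (frobenius_matrix R q y0 D [0..<n]) = ring_det R (Suc n) (frobenius_matrix R q y D [0..<n])"
    using Mc by (intro ring_det_cong) (auto simp: frobenius_matrix_def y_def split: nat.split)
  also have "\<dots> = \<zero>"
  proof (rule ring_det_eq_zero[OF two Mc])
    fix i assume i: "i < Suc n"
    show "(\<Oplus>j\<in>{..<Suc n}. w j \<otimes> frobenius_matrix R q y D [0..<n] i j) = \<zero>"
    proof (cases i)
      case 0
      thus ?thesis using relq by (simp add: frobenius_matrix_def)
    next
      case (Suc k)
      hence k: "k < n" using i by simp
      have "(\<Oplus>j\<in>{..<Suc n}. w j \<otimes> D k (y j)) = D k (\<Oplus>j\<in>{..<Suc n}. w j \<otimes> y j)"
        using k n by (intro hasse_relation[symmetric] wR dw y) auto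
      also have "\<dots> = \<zero>" unfolding rel using hasse_zero[OF hasse C sepz] .
      finally show ?thesis using Suc k by (simp add: frobenius_matrix_def)
    qed
  qed (use w wR w0 in auto)
  finally show ?thesis .
qed

end
end

section \<open>Evaluation over the algebraic closure\<close>

definition monom_value :: "(nat \<Rightarrow> 'a::comm_ring_1) \<Rightarrow> (nat \<Rightarrow>\<^sub>0 nat) \<Rightarrow> 'a" where
  "monom_value x m = (\<Prod>i\<in>Poly_Mapping.keys m. x i ^ Poly_Mapping.lookup m i)"

lemma monom_value_superset:
  assumes "finite S" "Poly_Mapping.keys m \<subseteq> S"
  shows "monom_value x m = (\<Prod>i\<in>S. x i ^ Poly_Mapping.lookup m i)"
  unfolding monom_value_def using assms
  by (intro prod.mono_neutral_left) (auto simp: in_keys_iff)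

lemma monom_value_add: "monom_value x (a + b) = monom_value x a * monom_value x b"
proof -
  let ?S = "Poly_Mapping.keys a \<union> Poly_Mapping.keys b"
  have "Poly_Mapping.keys (a + b) \<subseteq> ?S" by (rule keys_add)
  hence "monom_value x (a + b) = (\<Prod>i\<in>?S. x i ^ Poly_Mapping.lookup (a + b) i)"
    by (intro monom_value_superset) auto
  also have "\<dots> = (\<Prod>i\<in>?S. x i ^ Poly_Mapping.lookup a i) * (\<Prod>i\<in>?S. x i ^ Poly_Mapping.lookup b i)"
    by (simp add: lookup_add power_add prod.distrib)
  also have "\<dots> = monom_value x a * monom_value x b"
    by (simp add: monom_value_superset[of ?S])
  finally show ?thesis .
qed

lemma monom_value_0 [simp]: "monom_value x 0 = 1"
  by (simp add: monom_value_def)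

lemma monom_value_single [simp]: "monom_value x (Poly_Mapping.single i k) = x i ^ k"
  by (cases "k = 0") (auto simp: monom_value_def)

text \<open>As a ring homomorphism on polynomials over \<open>'k\<close>, \<open>ev v\<close> reduces every identity in the function field
  to an identity between values in the algebraic closure.\<close>

definition ev :: "(nat \<Rightarrow> 'k::field alg_closure) \<Rightarrow> 'k mpoly \<Rightarrow> 'k alg_closure" where
  "ev v G = eval_mpoly v (base_change G)"

lemma lookup_base_change: "Poly_Mapping.lookup (base_change G) m = to_ac (Poly_Mapping.lookup G m)"
  unfolding base_change_def by (transfer fixing: ) (auto simp: when_def)

lemma keys_base_change: "Poly_Mapping.keys (base_change G) = Poly_Mapping.keys G"
  by (auto simp: in_keys_iff lookup_base_change)

lemma ev_superset:
  assumes "finite S" "Poly_Mapping.keys G \<subseteq> S"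
  shows "ev v G = (\<Sum>m\<in>S. to_ac (Poly_Mapping.lookup G m) * monom_value v m)"
  unfolding ev_def eval_mpoly_def monom_value_def[symmetric] keys_base_change lookup_base_change
  using assms by (intro sum.mono_neutral_left) (auto simp: in_keys_iff)

lemma ev_eq: "ev v G = (\<Sum>m\<in>Poly_Mapping.keys G. to_ac (Poly_Mapping.lookup G m) * monom_value v m)"
  by (rule ev_superset) auto

lemma ev_single [simp]: "ev v (Poly_Mapping.single m c) = to_ac c * monom_value v m"
  by (subst ev_superset[of "{m}"]) auto

lemma ev_0 [simp]: "ev v 0 = 0"
  by (simp add: ev_eq)

lemma ev_add [simp]: "ev v (F + G) = ev v F + ev v G"
proof -
  let ?S = "Poly_Mapping.keys F \<union> Poly_Mapping.keys G"
  have "Poly_Mapping.keys (F + G) \<subseteq> ?S" by (rule keys_add)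
  hence "ev v (F + G) = (\<Sum>m\<in>?S. to_ac (Poly_Mapping.lookup (F + G) m) * monom_value v m)"
    by (intro ev_superset) auto
  also have "\<dots> = ev v F + ev v G"
    by (simp add: lookup_add ring_distribs sum.distrib ev_superset[of ?S])
  finally show ?thesis .
qed

lemma ev_sum: "ev v (sum f A) = (\<Sum>a\<in>A. ev v (f a))"
  by (induction A rule: infinite_finite_induct) auto

lemma ev_uminus [simp]: "ev v (- F) = - ev v F"
  using ev_add[of v F "- F"] by (simp add: add_eq_0_iff)

lemma ev_diff [simp]: "ev v (F - G) = ev v F - ev v G"
  using ev_add[of v F "- G"] by simp

lemma mpoly_decompose:
  fixes F :: "('a \<Rightarrow>\<^sub>0 'b::comm_monoid_add)"
  shows "F = (\<Sum>m\<in>Poly_Mapping.keys F. Poly_Mapping.single m (Poly_Mapping.lookup F m))"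
  by (rule poly_mapping_eqI) (auto simp: lookup_sum lookup_single when_def in_keys_iff)

lemma ev_mult [simp]: "ev v (F * G) = ev v F * ev v G"
proof -
  have s: "ev v (Poly_Mapping.single a c * Poly_Mapping.single b e) = ev v (Poly_Mapping.single a c) * ev v (Poly_Mapping.single b e)" for a b c e
    by (simp add: mult_single monom_value_add)
  have "ev v (F * G) = ev v ((\<Sum>m\<in>Poly_Mapping.keys F. Poly_Mapping.single m (Poly_Mapping.lookup F m)) *
    (\<Sum>m\<in>Poly_Mapping.keys G. Poly_Mapping.single m (Poly_Mapping.lookup G m)))"
    using mpoly_decompose[of F] mpoly_decompose[of G] by simp
  also have "\<dots> = ev v (\<Sum>m\<in>Poly_Mapping.keys F. Poly_Mapping.single m (Poly_Mapping.lookup F m)) *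
    ev v (\<Sum>m\<in>Poly_Mapping.keys G. Poly_Mapping.single m (Poly_Mapping.lookup G m))"
    by (simp only: sum_product ev_sum s)
  finally show ?thesis using mpoly_decompose[of F] mpoly_decompose[of G] by simp
qed

lemma ev_mconst [simp]: "ev v (mconst c) = to_ac c"
  by (simp add: mconst_def)

lemma mpoly_one_eq: "(1 :: 'k::field mpoly) = mconst 1"
  unfolding mconst_def by (rule poly_mapping_eqI) (simp add: lookup_one lookup_single when_def eq_commute)

lemma ev_1 [simp]: "ev v 1 = 1"
  by (simp add: mpoly_one_eq)

lemma ev_power [simp]: "ev v (F ^ k) = ev v F ^ k"
  by (induction k) auto

lemma ev_X_var [simp]: "ev v (X_var i) = v i"
  by (simp add: X_var_def)

section \<open>Homogeneous polynomials\<close>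

lemma homogeneous_0 [simp, intro]: "homogeneous n d 0"
  by (simp add: homogeneous_def)

lemma homogeneous_mconst [simp, intro]: "homogeneous n 0 (mconst c)"
  by (auto simp: homogeneous_def mconst_def)

lemma homogeneous_1 [simp, intro]: "homogeneous n 0 (1 :: 'k::field mpoly)"
  by (simp add: mpoly_one_eq)

lemma homogeneous_X_var [intro]: "i \<le> n \<Longrightarrow> homogeneous n 1 (X_var i)"
  by (auto simp: homogeneous_def X_var_def lookup_single when_def split: if_splits)

lemma homogeneous_add [intro]: "homogeneous n d F \<Longrightarrow> homogeneous n d G \<Longrightarrow> homogeneous n d (F + G)"
  unfolding homogeneous_def using keys_add[of F G] by blast

lemma homogeneous_uminus [intro]: "homogeneous n d F \<Longrightarrow> homogeneous n d (- F)"
  unfolding homogeneous_def by (simp add: in_keys_iff)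

lemma homogeneous_diff [intro]: "homogeneous n d F \<Longrightarrow> homogeneous n d G \<Longrightarrow> homogeneous n d (F - G)"
  using homogeneous_add[of n d F "- G"] homogeneous_uminus[of n d G] by simp

lemma homogeneous_mult [intro]: 
  assumes "homogeneous n d F" "homogeneous n e G" 
  shows "homogeneous n (d + e) (F * G)"
  unfolding homogeneous_def
proof
  fix m assume "m \<in> Poly_Mapping.keys (F * G)"
  then obtain a b where m: "m = a + b" and ab: "a \<in> Poly_Mapping.keys F" "b \<in> Poly_Mapping.keys G"
    using keys_mult[of F G] by blast
  have "Poly_Mapping.keys m \<subseteq> Poly_Mapping.keys a \<union> Poly_Mapping.keys b" unfolding m by (rule keys_add)
  thus "Poly_Mapping.keys m \<subseteq> {..n} \<and> (\<Sum>i\<le>n. Poly_Mapping.lookup m i) = d + e"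
    using assms ab unfolding homogeneous_def m by (auto simp: lookup_add sum.distrib)
qed

lemma homogeneous_power: 
  assumes "homogeneous n d (F::'k::field mpoly)" shows "homogeneous n (k * d) (F ^ k)"
  by (induction k) (use assms homogeneous_mult in \<open>auto simp: add.commute\<close>)

lemma homogeneous_base_change: "homogeneous n d (base_change F) \<longleftrightarrow> homogeneous n d F"
  by (simp add: homogeneous_def keys_base_change)

lemma homogeneous_partial:
  assumes "homogeneous n d F" "i \<le> n" "d = Suc e"
  shows "homogeneous n e (partial i F)"
  unfolding homogeneous_def
proof
  fix m' assume "m' \<in> Poly_Mapping.keys (partial i F)"
  hence "Poly_Mapping.lookup (partial i F) m' \<noteq> 0" by (simp add: in_keys_iff)
  then obtain m where m: "m \<in> Poly_Mapping.keys F"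
    "Poly_Mapping.lookup (Poly_Mapping.single (m - Poly_Mapping.single i 1)
       (of_nat (Poly_Mapping.lookup m i) * Poly_Mapping.lookup F m)) m' \<noteq> 0"
    unfolding partial_def lookup_sum by (meson sum.not_neutral_contains_not_neutral)
  have m': "m' = m - Poly_Mapping.single i 1" using m(2) by (auto simp: lookup_single when_def split: if_splits)
  have pos: "Poly_Mapping.lookup m i > 0" using m(2) by (auto simp: lookup_single when_def split: if_splits intro: ccontr)
  have l: "Poly_Mapping.lookup m j = Poly_Mapping.lookup m' j + (if j = i then 1 else 0)" for j
    using pos unfolding m' by (auto simp: lookup_minus lookup_single when_def)
  have "Poly_Mapping.keys m' \<subseteq> Poly_Mapping.keys m" using l by (auto simp: in_keys_iff)
  moreover have "(\<Sum>j\<le>n. Poly_Mapping.lookup m j) = (\<Sum>j\<le>n. Poly_Mapping.lookup m' j) + 1"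
    using assms(2) by (simp add: l sum.distrib)
  ultimately show "Poly_Mapping.keys m' \<subseteq> {..n} \<and> (\<Sum>i\<le>n. Poly_Mapping.lookup m' i) = e"
    using assms m(1) unfolding homogeneous_def by auto
qed

lemma monom_value_scale:
  assumes "Poly_Mapping.keys m \<subseteq> {..n}"
  shows "monom_value (\<lambda>i. c * x i) m = c ^ (\<Sum>i\<le>n. Poly_Mapping.lookup m i) * monom_value x m"
  using assms by (simp add: monom_value_superset[of "{..n}"] power_mult_distrib prod.distrib power_sum)

lemma eval_scale:
  assumes "homogeneous n d G"
  shows "eval_mpoly (\<lambda>i. c * x i) G = c ^ d * eval_mpoly x G"
  unfolding eval_mpoly_def monom_value_def[symmetric] sum_distrib_left
  using assms by (intro sum.cong) (auto simp: homogeneous_def monom_value_scale)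

lemma euler_identity:
  assumes F: "homogeneous n d F"
  shows "(\<Sum>i\<le>n. ev v (partial i F) * v i) = of_nat d * ev v F"
proof -
  have "ev v (partial i F) * v i = (\<Sum>m\<in>Poly_Mapping.keys F. 
      to_ac (Poly_Mapping.lookup F m) * monom_value v m * of_nat (Poly_Mapping.lookup m i))" for i
  proof -
    have "ev v (partial i F) * v i = (\<Sum>m\<in>Poly_Mapping.keys F. 
      to_ac (of_nat (Poly_Mapping.lookup m i) * Poly_Mapping.lookup F m) * (monom_value v (m - Poly_Mapping.single i 1) * v i))"
      unfolding partial_def by (simp add: ev_sum sum_distrib_right mult.assoc)
    also have "\<dots> = (\<Sum>m\<in>Poly_Mapping.keys F. 
      to_ac (Poly_Mapping.lookup F m) * monom_value v m * of_nat (Poly_Mapping.lookup m i))"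
    proof (rule sum.cong)
      fix m
      show "to_ac (of_nat (Poly_Mapping.lookup m i) * Poly_Mapping.lookup F m) * (monom_value v (m - Poly_Mapping.single i 1) * v i)
        = to_ac (Poly_Mapping.lookup F m) * monom_value v m * of_nat (Poly_Mapping.lookup m i)"
      proof (cases "Poly_Mapping.lookup m i = 0")
        case False
        have "m = (m - Poly_Mapping.single i 1) + Poly_Mapping.single i 1"
          using False by (intro poly_mapping_eqI) (auto simp: lookup_add lookup_minus lookup_single when_def)
        hence "monom_value v m = monom_value v (m - Poly_Mapping.single i 1) * v i"
          using monom_value_add[of v "m - Poly_Mapping.single i 1" "Poly_Mapping.single i 1"] by simp
        thus ?thesis by simp
      qed simp
    qed simp
    finally show ?thesis .
  qed
  hence "(\<Sum>i\<le>n. ev v (partial i F) * v i) = (\<Sum>m\<in>Poly_Mapping.keys F. 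
      to_ac (Poly_Mapping.lookup F m) * monom_value v m * of_nat (\<Sum>i\<le>n. Poly_Mapping.lookup m i))"
    by (simp add: sum_distrib_left sum.swap[of _ "Poly_Mapping.keys F"])
  also have "\<dots> = (\<Sum>m\<in>Poly_Mapping.keys F. to_ac (Poly_Mapping.lookup F m) * monom_value v m * of_nat d)"
    using F by (intro sum.cong) (auto simp: homogeneous_def)
  finally show ?thesis by (simp add: ev_eq sum_distrib_left mult.commute)
qed

section \<open>The vanishing ideal of an irreducible set\<close>

lemma vanishes_on_ev: "vanishes_on G V \<longleftrightarrow> (\<forall>P\<in>V. \<forall>v\<in>P. ev v G = 0)"
  by (simp add: vanishes_on_def ev_def)

lemma topspace_zariski: "topspace (zariski n :: (nat \<Rightarrow> 'a::field) set topology) = proj_space n"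
proof -
  have "proj_space n = proj_space n - zero_locus n {1 :: 'a mpoly}"
  proof -
    have "\<exists>v. v \<in> P" if "P \<in> proj_space n" for P :: "(nat \<Rightarrow> 'a) set"
      using that by (fastforce simp: proj_space_def proj_point_def)
    moreover have "eval_mpoly v 1 = 1" for v :: "nat \<Rightarrow> 'a"
      by (simp add: eval_mpoly_def lookup_one)
    ultimately show ?thesis by (auto simp: zero_locus_def)
  qed
  moreover have "homogeneous n 0 (1 :: 'a mpoly)" by (simp add: homogeneous_def)
  ultimately have "proj_space n \<in> {proj_space n - zero_locus n {G :: 'a mpoly} |G. \<exists>d. homogeneous n d G}"
    by blast
  thus ?thesis unfolding zariski_def topology_generated_by_topspace by blast
qed

lemma closedin_zero_locus:
  fixes G :: "'a::field mpoly"
  assumes "homogeneous n d G" "V \<subseteq> proj_space n"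
  shows "closedin (subtopology (zariski n) V) (V \<inter> zero_locus n {G})"
proof -
  have "openin (zariski n) (proj_space n - zero_locus n {G})"
    unfolding zariski_def using assms by (intro topology_generated_by_Basis) blast
  hence "closedin (zariski n) (zero_locus n {G})"
    by (auto simp: closedin_def topspace_zariski zero_locus_def Diff_Diff_Int inf.absorb2)
  thus ?thesis by (auto simp: closedin_subtopology)
qed

text \<open>For a homogeneous polynomial the value at one representative of a point decides.\<close>

lemma zero_locus_if_eval_zero:
  assumes "homogeneous n d G" "P \<in> proj_space n" "v \<in> P" "eval_mpoly v G = 0" 
  shows "P \<in> zero_locus n {G}"
proof -
  obtain u where u: "P = proj_point u" using assms(2) by (auto simp: proj_space_def)
  obtain c where c: "c \<noteq> 0" "v = (\<lambda>i. c * u i)" using assms(3) by (auto simp: u proj_point_def)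
  have "eval_mpoly u G = 0" using eval_scale[OF assms(1), of c u] assms(4) c by simp
  hence "eval_mpoly x G = 0" if "x \<in> P" for x
    using that eval_scale[OF assms(1), of _ u] by (auto simp: u proj_point_def)
  thus ?thesis using assms(2) by (auto simp: zero_locus_def)
qed

text \<open>If \<open>G H\<close> vanishes on \<open>V\<close>, then \<open>V\<close> is the union of the closed subsets where \<open>G\<close> and where \<open>H\<close> vanish,
  so one of them is all of \<open>V\<close>.\<close>

lemma vanishes_on_prime:
  fixes G H :: "'k::field mpoly"
  assumes V: "V \<subseteq> proj_space n" and irr: "irreducible_space (subtopology (zariski n) V)"
    and G: "homogeneous n d G" and H: "homogeneous n e H" and GH: "vanishes_on (G * H) V"
  shows "vanishes_on G V \<or> vanishes_on H V"
proof -
  let ?A = "V \<inter> zero_locus n {base_change G}" and ?B = "V \<inter> zero_locus n {base_change H}"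
  have G': "homogeneous n d (base_change G)" and H': "homogeneous n e (base_change H)"
    using G H by (simp_all add: homogeneous_base_change)
  have top: "topspace (subtopology (zariski n) V) = V" using V by (auto simp: topspace_zariski)
  have "V \<subseteq> ?A \<union> ?B"
  proof
    fix P assume P: "P \<in> V"
    hence PP: "P \<in> proj_space n" using V by auto
    then obtain v where v: "v \<in> P" by (fastforce simp: proj_space_def proj_point_def)
    have "ev v G * ev v H = 0" using GH P v by (auto simp: vanishes_on_ev simp del: mult_eq_0_iff)
    thus "P \<in> ?A \<union> ?B"
      using zero_locus_if_eval_zero[OF G' PP v] zero_locus_if_eval_zero[OF H' PP v] P by (auto simp: ev_def)
  qed
  hence "V = ?A \<union> ?B" by auto
  hence "?A = V \<or> ?B = V"
    using irr closedin_zero_locus[OF G' V] closedin_zero_locus[OF H' V] 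
    unfolding irreducible_space_def top by metis
  thus ?thesis by (auto simp: vanishes_on_def zero_locus_def)
qed

section \<open>The function field\<close>

text \<open>The field axioms for fractions depend only on the homogeneous vanishing ideal being proper and prime.\<close>

locale prime_vanishing =
  fixes n :: nat and V :: "(nat \<Rightarrow> 'k::field alg_closure) set set"
  assumes one: "\<not> vanishes_on (1 :: 'k mpoly) V"
    and prime: "\<And>G H d e. homogeneous n d G \<Longrightarrow> homogeneous n e H \<Longrightarrow> vanishes_on (G * H) V \<Longrightarrow>
      vanishes_on G V \<or> vanishes_on (H :: 'k mpoly) V"
begin

abbreviation "K \<equiv> function_field n V"

lemma fractionsI [intro]: "homogeneous n d G \<Longrightarrow> homogeneous n d H \<Longrightarrow> \<not> vanishes_on H V \<Longrightarrow> (G, H) \<in> fractions n V"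
  by (auto simp: fractions_def)

lemma fractions_mult:
  assumes "(G, H) \<in> fractions n V" "(G', H') \<in> fractions n V"
  shows "(G * G', H * H') \<in> fractions n V"
proof -
  obtain d e where "homogeneous n d G" "homogeneous n d H" "homogeneous n e G'" "homogeneous n e H'"
    using assms by (auto simp: fractions_def)
  thus ?thesis using assms prime[of d H e H'] by (auto simp: fractions_def intro!: exI[of _ "d + e"])
qed

lemma fractions_add:
  assumes "(G, H) \<in> fractions n V" "(G', H') \<in> fractions n V"
  shows "(G * H' + G' * H, H * H') \<in> fractions n V"
proof -
  obtain d e where "homogeneous n d G" "homogeneous n d H" "homogeneous n e G'" "homogeneous n e H'"
    using assms by (auto simp: fractions_def)
  moreover from this have "homogeneous n (d + e) (G' * H)" using homogeneous_mult[of n e G' d H] by (simp add: add.commute)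
  ultimately show ?thesis using assms prime[of d H e H'] by (auto simp: fractions_def intro!: exI[of _ "d + e"])
qed

text \<open>The nontrivial point is transitivity: \<open>G/H = G\<^sub>1/H\<^sub>1\<close> and \<open>G\<^sub>1/H\<^sub>1 = G\<^sub>2/H\<^sub>2\<close> give
  \<open>H\<^sub>1 (G H\<^sub>2 - G\<^sub>2 H) = 0\<close> on \<open>V\<close>, and \<open>H\<^sub>1\<close> cancels by primality.\<close>

lemma ratio_eq_iff:
  assumes GH: "(G, H) \<in> fractions n V" and GH': "(G', H') \<in> fractions n V"
  shows "ratio n V G H = ratio n V G' H' \<longleftrightarrow> (\<forall>P\<in>V. \<forall>v\<in>P. ev v G * ev v H' = ev v G' * ev v H)"
proof -
  have trans: "vanishes_on (A * H2 - A2 * B) V"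
    if f: "(A, B) \<in> fractions n V" "(A1, B1) \<in> fractions n V" "(A2, H2) \<in> fractions n V" 
    and v: "vanishes_on (A * B1 - A1 * B) V" "vanishes_on (A1 * H2 - A2 * B1) V" for A B A1 B1 A2 H2
  proof -
    obtain d e e1 where h: "homogeneous n d A" "homogeneous n d B" "homogeneous n e A2" "homogeneous n e H2"
       "homogeneous n e1 B1" using f by (auto simp: fractions_def)
    have "homogeneous n (d + e) (A2 * B)" using homogeneous_mult[OF h(3,2)] by (simp add: add.commute)
    hence hh: "homogeneous n (d + e) (A * H2 - A2 * B)" using h by blast
    have "vanishes_on (B1 * (A * H2 - A2 * B)) V"
      unfolding vanishes_on_ev
    proof safe
      fix P v assume Pv: "P \<in> V" "v \<in> P"
      have "ev v A * ev v B1 = ev v A1 * ev v B" "ev v A1 * ev v H2 = ev v A2 * ev v B1"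
        using v Pv by (auto simp: vanishes_on_ev)
      hence "ev v B1 * (ev v A * ev v H2 - ev v A2 * ev v B) = 0" by Groebner_Basis.algebra
      thus "ev v (B1 * (A * H2 - A2 * B)) = 0" by simp
    qed
    thus ?thesis using prime[OF h(5) hh] f by (auto simp: fractions_def)
  qed
  have sym: "vanishes_on (A1 * B - A * B1) V" if "vanishes_on (A * B1 - A1 * B) V" for A B A1 B1
    using that by (simp add: vanishes_on_ev)
  have self: "vanishes_on (A * B - A * B) V" for A B by (simp add: vanishes_on_ev)
  have "ratio n V G H = ratio n V G' H' \<longleftrightarrow> vanishes_on (G * H' - G' * H) V"
  proof
    assume "ratio n V G H = ratio n V G' H'"
    moreover have "(G', H') \<in> ratio n V G' H'" using GH' self by (auto simp: ratio_def)
    ultimately show "vanishes_on (G * H' - G' * H) V" by (auto simp: ratio_def)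
  next
    assume a: "vanishes_on (G * H' - G' * H) V"
    show "ratio n V G H = ratio n V G' H'" unfolding ratio_def
      using trans[OF GH' GH _ sym[OF a]] trans[OF GH GH' _ a] by blast
  qed
  thus ?thesis by (simp add: vanishes_on_ev)
qed

lemma ratio_eqI:
  assumes "(G, H) \<in> fractions n V" "(G', H') \<in> fractions n V"
    "\<And>v. ev v G * ev v H' = ev v G' * ev v H"
  shows "ratio n V G H = ratio n V G' H'"
  using assms by (simp add: ratio_eq_iff)

lemma ratio_mem:
  assumes "(A, B) \<in> ratio n V G H" "(G, H) \<in> fractions n V"
  shows "(A, B) \<in> fractions n V" "P \<in> V \<Longrightarrow> v \<in> P \<Longrightarrow> ev v G * ev v B = ev v A * ev v H"
  using assms by (auto simp: ratio_def vanishes_on_ev)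

lemma ratio_self: "(G, H) \<in> fractions n V \<Longrightarrow> (G, H) \<in> ratio n V G H"
  by (auto simp: ratio_def vanishes_on_ev)

lemma carrier_K: "a \<in> carrier K \<longleftrightarrow> (\<exists>G H. (G, H) \<in> fractions n V \<and> a = ratio n V G H)"
  by (auto simp: function_field_def)

lemma ratio_carrier [simp, intro]: "(G, H) \<in> fractions n V \<Longrightarrow> ratio n V G H \<in> carrier K"
  by (auto simp: carrier_K)

lemma K_elim:
  assumes "a \<in> carrier K"
  obtains G H where "(G, H) \<in> fractions n V" "a = ratio n V G H"
  using assms carrier_K by blast

lemma ratio_mult:
  assumes GH: "(G, H) \<in> fractions n V" and GH': "(G', H') \<in> fractions n V"
  shows "ratio n V G H \<otimes>\<^bsub>K\<^esub> ratio n V G' H' = ratio n V (G * G') (H * H')"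
proof -
  have "ratio n V (A * A') (B * B') = ratio n V (G * G') (H * H')"
    if a: "(A, B) \<in> ratio n V G H" "(A', B') \<in> ratio n V G' H'" for A B A' B'
  proof -
    have "ev v (A * A') * ev v (H * H') = ev v (G * G') * ev v (B * B')" if "P \<in> V" "v \<in> P" for P v
      using ratio_mem(2)[OF a(1) GH that] ratio_mem(2)[OF a(2) GH' that] by simp Groebner_Basis.algebra
    thus ?thesis
      using fractions_mult[OF ratio_mem(1)[OF a(1) GH] ratio_mem(1)[OF a(2) GH']] fractions_mult[OF GH GH']
      by (subst ratio_eq_iff) auto
  qed
  hence "(\<Union>(A, B)\<in>ratio n V G H. \<Union>(A', B')\<in>ratio n V G' H'. ratio n V (A * A') (B * B')) 
     = (\<Union>(A, B)\<in>ratio n V G H. \<Union>(A', B')\<in>ratio n V G' H'. ratio n V (G * G') (H * H'))"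
    by fast
  also have "\<dots> = ratio n V (G * G') (H * H')" using ratio_self[OF GH] ratio_self[OF GH'] by fast
  finally show ?thesis by (simp add: function_field_def)
qed

lemma ratio_add:
  assumes GH: "(G, H) \<in> fractions n V" and GH': "(G', H') \<in> fractions n V"
  shows "ratio n V G H \<oplus>\<^bsub>K\<^esub> ratio n V G' H' = ratio n V (G * H' + G' * H) (H * H')"
proof -
  have "ratio n V (A * B' + A' * B) (B * B') = ratio n V (G * H' + G' * H) (H * H')"
    if a: "(A, B) \<in> ratio n V G H" "(A', B') \<in> ratio n V G' H'" for A B A' B'
  proof -
    have "ev v (A * B' + A' * B) * ev v (H * H') = ev v (G * H' + G' * H) * ev v (B * B')" if "P \<in> V" "v \<in> P" for P v
      using ratio_mem(2)[OF a(1) GH that] ratio_mem(2)[OF a(2) GH' that] by simp Groebner_Basis.algebra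
    thus ?thesis
      using fractions_add[OF ratio_mem(1)[OF a(1) GH] ratio_mem(1)[OF a(2) GH']] fractions_add[OF GH GH']
      by (subst ratio_eq_iff) auto
  qed
  hence "(\<Union>(A, B)\<in>ratio n V G H. \<Union>(A', B')\<in>ratio n V G' H'. ratio n V (A * B' + A' * B) (B * B')) 
     = (\<Union>(A, B)\<in>ratio n V G H. \<Union>(A', B')\<in>ratio n V G' H'. ratio n V (G * H' + G' * H) (H * H'))"
    by fast
  also have "\<dots> = ratio n V (G * H' + G' * H) (H * H')" using ratio_self[OF GH] ratio_self[OF GH'] by fast
  finally show ?thesis by (simp add: function_field_def)
qed

lemma K_one: "\<one>\<^bsub>K\<^esub> = ratio n V 1 1" and K_zero: "\<zero>\<^bsub>K\<^esub> = ratio n V 0 1"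
  by (simp_all add: function_field_def)

lemma fractions_const [simp, intro]: "(mconst c, 1) \<in> fractions n V" "(1, 1) \<in> fractions n V" "(0, 1) \<in> fractions n V"
  using one by (auto intro!: fractionsI[of 0])

lemma ratio_zero_iff: "(G, H) \<in> fractions n V \<Longrightarrow> ratio n V G H = \<zero>\<^bsub>K\<^esub> \<longleftrightarrow> vanishes_on G V"
  by (simp add: K_zero ratio_eq_iff vanishes_on_ev)

lemma K_cring: "cring K"
proof (rule cringI)
  show "abelian_group K"
  proof (rule abelian_groupI)
    fix x y z assume "x \<in> carrier K" "y \<in> carrier K" "z \<in> carrier K"
    then obtain A B A' B' A'' B'' where f: "(A, B) \<in> fractions n V" "x = ratio n V A B"
      "(A', B') \<in> fractions n V" "y = ratio n V A' B'" "(A'', B'') \<in> fractions n V" "z = ratio n V A'' B''"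
      by (metis carrier_K)
    show "x \<oplus>\<^bsub>K\<^esub> y \<oplus>\<^bsub>K\<^esub> z = x \<oplus>\<^bsub>K\<^esub> (y \<oplus>\<^bsub>K\<^esub> z)"
    proof -
      note f1 = fractions_add[OF f(1,3)] and f2 = fractions_add[OF f(3,5)]
      show ?thesis unfolding f(2,4,6) ratio_add[OF f(1,3)] ratio_add[OF f(3,5)]
        ratio_add[OF f1 f(5)] ratio_add[OF f(1) f2]
        by (intro ratio_eqI fractions_add[OF f1 f(5)] fractions_add[OF f(1) f2]) (simp add: algebra_simps)
    qed
  next
    fix x y assume "x \<in> carrier K" "y \<in> carrier K"
    then obtain A B A' B' where f: "(A, B) \<in> fractions n V" "x = ratio n V A B"
      "(A', B') \<in> fractions n V" "y = ratio n V A' B'" by (metis carrier_K)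
    show "x \<oplus>\<^bsub>K\<^esub> y \<in> carrier K" using f by (simp add: ratio_add fractions_add)
    show "x \<oplus>\<^bsub>K\<^esub> y = y \<oplus>\<^bsub>K\<^esub> x" using f by (simp add: ratio_add mult.commute add.commute)
  next
    fix x assume "x \<in> carrier K"
    then obtain A B where f: "(A, B) \<in> fractions n V" "x = ratio n V A B" by (rule K_elim)
    show "\<zero>\<^bsub>K\<^esub> \<oplus>\<^bsub>K\<^esub> x = x" using f by (simp add: K_zero ratio_add)
    have g: "(- A, B) \<in> fractions n V" using f(1) by (auto simp: fractions_def)
    show "\<exists>y\<in>carrier K. y \<oplus>\<^bsub>K\<^esub> x = \<zero>\<^bsub>K\<^esub>"
    proof
      show "ratio n V (- A) B \<in> carrier K" using g by auto
      show "ratio n V (- A) B \<oplus>\<^bsub>K\<^esub> x = \<zero>\<^bsub>K\<^esub>"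
        using f g fractions_add[OF g f(1)] by (simp add: ratio_add ratio_zero_iff) (simp add: vanishes_on_ev)
    qed
  qed (auto simp: K_zero)
  show "comm_monoid K"
  proof (rule comm_monoidI)
    fix x y z assume "x \<in> carrier K" "y \<in> carrier K" "z \<in> carrier K"
    then obtain A B A' B' A'' B'' where f: "(A, B) \<in> fractions n V" "x = ratio n V A B"
      "(A', B') \<in> fractions n V" "y = ratio n V A' B'" "(A'', B'') \<in> fractions n V" "z = ratio n V A'' B''"
      by (metis carrier_K)
    show "x \<otimes>\<^bsub>K\<^esub> y \<otimes>\<^bsub>K\<^esub> z = x \<otimes>\<^bsub>K\<^esub> (y \<otimes>\<^bsub>K\<^esub> z)"
      using f by (simp add: ratio_mult fractions_mult mult.assoc)
  next
    fix x y assume "x \<in> carrier K" "y \<in> carrier K"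
    then obtain A B A' B' where f: "(A, B) \<in> fractions n V" "x = ratio n V A B"
      "(A', B') \<in> fractions n V" "y = ratio n V A' B'" by (metis carrier_K)
    show "x \<otimes>\<^bsub>K\<^esub> y \<in> carrier K" using f by (simp add: ratio_mult fractions_mult)
    show "x \<otimes>\<^bsub>K\<^esub> y = y \<otimes>\<^bsub>K\<^esub> x" using f by (simp add: ratio_mult mult.commute)
  next
    fix x assume "x \<in> carrier K"
    then obtain A B where f: "(A, B) \<in> fractions n V" "x = ratio n V A B" by (rule K_elim)
    show "\<one>\<^bsub>K\<^esub> \<otimes>\<^bsub>K\<^esub> x = x" using f by (simp add: K_one ratio_mult)
  qed (auto simp: K_one)
next
  fix x y z assume "x \<in> carrier K" "y \<in> carrier K" "z \<in> carrier K"
  then obtain A B A' B' A'' B'' where f: "(A, B) \<in> fractions n V" "x = ratio n V A B"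
    "(A', B') \<in> fractions n V" "y = ratio n V A' B'" "(A'', B'') \<in> fractions n V" "z = ratio n V A'' B''"
    by (metis carrier_K)
  show "(x \<oplus>\<^bsub>K\<^esub> y) \<otimes>\<^bsub>K\<^esub> z = x \<otimes>\<^bsub>K\<^esub> z \<oplus>\<^bsub>K\<^esub> y \<otimes>\<^bsub>K\<^esub> z"
  proof -
    note f1 = fractions_add[OF f(1,3)] and f2 = fractions_mult[OF f(1,5)] and f3 = fractions_mult[OF f(3,5)]
    show ?thesis unfolding f(2,4,6) ratio_add[OF f(1,3)] ratio_mult[OF f(1,5)] ratio_mult[OF f(3,5)]
      ratio_mult[OF f1 f(5)] ratio_add[OF f2 f3]
      by (intro ratio_eqI fractions_mult[OF f1 f(5)] fractions_add[OF f2 f3]) (simp add: algebra_simps)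
  qed
qed

lemma K_field: "field K"
proof (rule cring.cring_fieldI2[OF K_cring])
  show "\<zero>\<^bsub>K\<^esub> \<noteq> \<one>\<^bsub>K\<^esub>" using ratio_zero_iff[of 1 1] one by (auto simp: K_one)
  fix x assume "x \<in> carrier K" and nz: "x \<noteq> \<zero>\<^bsub>K\<^esub>"
  then obtain A B where f: "(A, B) \<in> fractions n V" "x = ratio n V A B" by (metis K_elim)
  have g: "(B, A) \<in> fractions n V" using f nz ratio_zero_iff by (auto simp: fractions_def)
  show "\<exists>y\<in>carrier K. x \<otimes>\<^bsub>K\<^esub> y = \<one>\<^bsub>K\<^esub>"
  proof
    show "ratio n V B A \<in> carrier K" using g by auto
    show "x \<otimes>\<^bsub>K\<^esub> ratio n V B A = \<one>\<^bsub>K\<^esub>"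
      using f g by (simp add: ratio_mult K_one) (rule ratio_eqI, auto simp: fractions_mult)
  qed
qed

definition const :: "'k \<Rightarrow> ('k mpoly \<times> 'k mpoly) set" where
  "const c = ratio n V (mconst c) 1"

lemma constants_eq: "constants n V = range const"
  by (auto simp: constants_def const_def)

lemma const_carrier [simp, intro]: "const c \<in> carrier K" by (auto simp: const_def)

lemma mconst_add: "mconst (a + b) = mconst a + mconst b"
  by (simp add: mconst_def single_add)

lemma mconst_mult: "mconst (a * b) = mconst a * mconst b"
  by (simp add: mconst_def mult_single)

lemma const_add: "const (a + b) = const a \<oplus>\<^bsub>K\<^esub> const b"
  unfolding const_def by (subst ratio_add) (auto simp: mconst_add)

lemma const_mult: "const (a * b) = const a \<otimes>\<^bsub>K\<^esub> const b"
  unfolding const_def by (subst ratio_mult) (auto simp: mconst_mult)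

lemma const_1: "const 1 = \<one>\<^bsub>K\<^esub>"
  by (simp add: const_def K_one mpoly_one_eq)

lemma const_0: "const 0 = \<zero>\<^bsub>K\<^esub>"
  by (simp add: const_def K_zero mconst_def)

interpretation K: field K by (rule K_field)

lemma const_power: "const (a ^ k) = const a [^]\<^bsub>K\<^esub> k"
  by (induction k) (simp_all add: const_1 const_mult mult.commute K.m_comm)

lemma const_of_nat: "const (of_nat k) = [k] \<cdot>\<^bsub>K\<^esub> \<one>\<^bsub>K\<^esub>"
  by (induction k) (simp_all add: const_0 const_1 const_add K.a_comm)

lemma constants_subfield: "subfield (constants n V) K"
proof (rule K.subfieldI'[OF K.subringI])
  fix x assume "x \<in> constants n V"
  then obtain c where c: "x = const c" by (auto simp: constants_eq)
  have "const (- c) \<oplus>\<^bsub>K\<^esub> const c = \<zero>\<^bsub>K\<^esub>" unfolding const_add[symmetric] by (simp add: const_0)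
  hence "\<ominus>\<^bsub>K\<^esub> x = const (- c)" using K.minus_equality c by auto
  thus "\<ominus>\<^bsub>K\<^esub> x \<in> constants n V" by (auto simp: constants_eq)
next
  fix x assume x: "x \<in> constants n V - {\<zero>\<^bsub>K\<^esub>}"
  then obtain c where c: "x = const c" by (auto simp: constants_eq)
  have "c \<noteq> 0" using x c const_0 by auto
  hence "const c \<otimes>\<^bsub>K\<^esub> const (inverse c) = \<one>\<^bsub>K\<^esub>" unfolding const_mult[symmetric] by (simp add: const_1)
  hence "inv\<^bsub>K\<^esub> x = const (inverse c)" using K.comm_inv_char c by auto
  thus "inv\<^bsub>K\<^esub> x \<in> constants n V" by (auto simp: constants_eq)
next
  show "\<one>\<^bsub>K\<^esub> \<in> constants n V" using const_1 by (metis constants_eq rangeI)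
qed (auto simp: constants_eq const_add[symmetric] const_mult[symmetric])

lemma ratio_power:
  assumes "(G, H) \<in> fractions n V"
  shows "(G ^ k, H ^ k) \<in> fractions n V" "ratio n V G H [^]\<^bsub>K\<^esub> k = ratio n V (G ^ k) (H ^ k)"
proof -
  have "(G ^ k, H ^ k) \<in> fractions n V \<and> ratio n V G H [^]\<^bsub>K\<^esub> k = ratio n V (G ^ k) (H ^ k)"
  proof (induction k)
    case (Suc k)
    thus ?case using assms fractions_mult[of "G ^ k" "H ^ k" G H] ratio_mult[of "G ^ k" "H ^ k" G H]
      by (auto simp: mult.commute)
  qed (simp add: K_one)
  thus "(G ^ k, H ^ k) \<in> fractions n V" "ratio n V G H [^]\<^bsub>K\<^esub> k = ratio n V (G ^ k) (H ^ k)" by auto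
qed

lemma ratio_sum:
  assumes G: "\<And>i. i < N \<Longrightarrow> homogeneous n d (G i)" and H: "homogeneous n d H" "\<not> vanishes_on H V"
  shows "(\<Oplus>\<^bsub>K\<^esub>i\<in>{..<N::nat}. ratio n V (G i) H) = ratio n V (\<Sum>i<N. G i) H"
  using G
proof (induction N)
  case 0
  have "(0, H) \<in> fractions n V" using H by auto
  hence "ratio n V 0 H = \<zero>\<^bsub>K\<^esub>" using ratio_zero_iff[of 0 H] by (simp add: vanishes_on_ev)
  thus ?case by (simp add: K.finsum_empty)
next
  case (Suc N)
  have f: "(G i, H) \<in> fractions n V" if "i < Suc N" for i using that Suc.prems H by auto
  have hs: "homogeneous n d (\<Sum>i<k. G i)" if "k \<le> Suc N" for k
    using that by (induction k) (auto intro!: homogeneous_add Suc.prems)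
  have fs: "((\<Sum>i<k. G i), H) \<in> fractions n V" if "k \<le> Suc N" for k using hs[OF that] H by auto
  have "(\<Oplus>\<^bsub>K\<^esub>i\<in>{..<Suc N}. ratio n V (G i) H) = (\<Oplus>\<^bsub>K\<^esub>i\<in>{..<N}. ratio n V (G i) H) \<oplus>\<^bsub>K\<^esub> ratio n V (G N) H"
    using f by (intro K.finsum_lessThan_Suc) auto
  also have "\<dots> = ratio n V (\<Sum>i<N. G i) H \<oplus>\<^bsub>K\<^esub> ratio n V (G N) H" using Suc by simp
  also have "\<dots> = ratio n V ((\<Sum>i<N. G i) * H + G N * H) (H * H)" using fs f by (intro ratio_add) auto
  also have "\<dots> = ratio n V (\<Sum>i<Suc N. G i) H"
    using fractions_add[OF fs[of N] f[of N]] fs[of "Suc N"] by (intro ratio_eqI) (auto simp: algebra_simps)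
  finally show ?case .
qed

end

section \<open>Frobenius nonclassicality\<close>

lemma pth_root_in_finite_field:
  assumes "prime CHAR('k::{field,finite})"
  shows "\<exists>b. b ^ CHAR('k) = (a::'k)"
proof -
  have p0: "CHAR('k) > 0" using assms prime_gt_0_nat by auto
  have "inj (\<lambda>b::'k. b ^ CHAR('k))"
  proof (rule injI)
    fix x y :: 'k assume e: "x ^ CHAR('k) = y ^ CHAR('k)"
    have "x ^ CHAR('k) = ((x - y) + y) ^ CHAR('k)" by simp
    also have "\<dots> = (x - y) ^ CHAR('k) + y ^ CHAR('k)" by (rule freshmans_dream[OF assms refl])
    finally have "(x - y) ^ CHAR('k) = 0" using e by simp
    thus "x = y" by simp
  qed
  hence "surj (\<lambda>b::'k. b ^ CHAR('k))" by (intro finite_UNIV_inj_surj) auto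
  thus ?thesis by (metis surjD)
qed

theorem theorem3p6:
  fixes n p e q d :: nat
    and F :: "'k::{field,finite} mpoly"
  assumes "n \<ge> 2"
    and "prime p" and "p > n"
    and "e > 0" and "q = p ^ e" and "CARD('k) = q"
    and "homogeneous n d F"
    and "Factorial_Ring.irreducible (base_change F)"
    and "\<not> p dvd d"
    and "(\<Sum>i\<le>n. partial i F * X_var i ^ q) \<noteq> 0"
    and "krull_dim (subtopology (zariski n) (frobenius_nonclassical_locus n q F)) > 0"
  shows "\<forall>V. projective_curve n V \<and> V \<subseteq> frobenius_nonclassical_locus n q F \<and>
           gauss_map_inseparable n F V \<longrightarrow> frobenius_nonclassical n V"
proof (intro allI impI notI, elim conjE)
  fix V :: "(nat \<Rightarrow> 'k alg_closure) set set"
  assume curve: "projective_curve n V" and sub: "V \<subseteq> frobenius_nonclassical_locus n q F"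
    and insep: "gauss_map_inseparable n F V" and classical: "frobenius_classical n V"
  have char: "CHAR('k) = p"
  proof -
    have "prime CHAR('k)" by (rule prime_CHAR_semidom[OF finite_imp_CHAR_pos]) simp
    moreover have "CHAR('k) dvd p ^ e" using CHAR_dvd_CARD[where 'a = 'k] assms(5,6) by simp
    ultimately show ?thesis using \<open>prime p\<close> by (metis prime_dvd_power primes_dvd_imp_eq)
  qed
  have V: "V \<subseteq> proj_space n" and irr: "irreducible_space (subtopology (zariski n) V)"
    using curve by (auto simp: projective_curve_def zero_locus_def)
  have "topspace (subtopology (zariski n) V) \<noteq> {}" using irr unfolding irreducible_space_def by blast
  hence "V \<noteq> {}" by auto
  then obtain P0 where P0: "P0 \<in> V" by blast
  obtain v0 where v0: "v0 \<in> P0" using V P0 by (fastforce simp: proj_space_def proj_point_def)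
  interpret prime_vanishing n V
  proof
    show "\<not> vanishes_on (1 :: 'k mpoly) V" using P0 v0 by (auto simp: vanishes_on_ev)
    show "vanishes_on G V \<or> vanishes_on H V" if "homogeneous n d G" "homogeneous n e H" "vanishes_on (G * H) V"
      for G H :: "'k mpoly" and d e using vanishes_on_prime[OF V irr that] .
  qed
  obtain d' where d': "d = Suc d'" using assms(9) by (cases d) auto
  have hp: "homogeneous n d' (partial i F)" if "i \<le> n" for i
    using homogeneous_partial[OF assms(7) that d'] .
  have reg: "P \<in> regular_locus n F" "frobenius_map q P \<in> tangent_hyperplane n F P" if "P \<in> V" for P
    using that sub by (auto simp: frobenius_nonclassical_locus_def)
  obtain i0 where i0: "i0 \<le> n" "\<not> vanishes_on (partial i0 F) V"
    using reg(1)[OF P0] P0 v0 unfolding regular_locus_def vanishes_on_def by blast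
  obtain j z D where j: "j \<le> n" "\<not> vanishes_on (X_var j :: 'k mpoly) V"
    and sepz: "separating_element K (constants n V) z" and hasse: "hasse_derivatives K (constants n V) z D"
    and det: "ring_det K (Suc n) (frobenius_matrix K q (coord_fun n V j) D [0..<n]) \<noteq> \<zero>\<^bsub>K\<^esub>"
    using classical assms(6) unfolding frobenius_classical_def frobenius_order_sequence_def frobenius_admissible_def
    by auto
  interpret K: field K by (rule K_field)
  interpret K: prime_char_field K p
  proof unfold_locales
    show "Factorial_Ring.prime p" by fact
    have "of_nat p = (0 :: 'k)" using of_nat_CHAR[where 'a = 'k] char by simp
    thus "[p] \<cdot>\<^bsub>K\<^esub> \<one>\<^bsub>K\<^esub> = \<zero>\<^bsub>K\<^esub>" using const_of_nat[of p] const_0 by simp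
  qed
  have perfect: "\<exists>b\<in>constants n V. b [^]\<^bsub>K\<^esub> p = a" if a: "a \<in> constants n V" for a
  proof -
    obtain c where c: "a = const c" using a by (auto simp: constants_eq)
    obtain b where "b ^ p = c" using pth_root_in_finite_field[of c] \<open>prime p\<close> char by auto
    hence "const b [^]\<^bsub>K\<^esub> p = a" using const_power[of b p] c by simp
    thus ?thesis by (auto simp: constants_eq)
  qed
  define w where "w = (\<lambda>i. ratio n V (partial i F) (partial i0 F))"
  have wf: "(partial i F, partial i0 F) \<in> fractions n V" if "i \<le> n" for i
    using hp[OF that] hp[OF i0(1)] i0(2) by auto
  have yf: "(X_var i, X_var j) \<in> fractions n V" if "i \<le> n" for i
    using that j by (auto intro!: fractionsI[of 1])
  define S where "S = constants n V \<union> {ratio n V (partial i F) (partial j F) |i j.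
           i \<le> n \<and> j \<le> n \<and> \<not> vanishes_on (partial j F) V}"
  have S: "S \<subseteq> carrier K"
    using subfieldE(3)[OF constants_subfield] hp by (auto simp: S_def)
  define L where "L = gauss_image_field n F V"
  have L_eq: "L = generate_field K S" by (simp add: L_def gauss_image_field_def S_def)
  have L: "subfield L K" unfolding L_eq by (rule K.generate_field_is_subfield[OF S])
  have CL: "constants n V \<subseteq> L" unfolding L_eq by (auto simp: S_def intro: generate_field.incl)
  have wL: "w i \<in> L" if "i \<le> n" for i
    unfolding L_eq w_def using that i0 by (intro generate_field.incl) (auto simp: S_def)
  have wR: "w i \<in> carrier K" if "i \<le> n" for i
    using wL[OF that] subfieldE(3)[OF L] by auto
  have w0: "w i0 \<noteq> \<zero>\<^bsub>K\<^esub>" unfolding w_def using ratio_zero_iff[OF wf[OF i0(1)]] i0 by simp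
  have tang: "(\<Sum>i\<le>n. ev v (partial i F) * v i ^ q) = 0" if "P \<in> V" "v \<in> P" for P v
  proof -
    have "(\<lambda>i. v i ^ q) \<in> frobenius_map q P" 
      using that(2) by (auto simp: frobenius_map_def proj_point_def intro!: bexI[of _ v] exI[of _ 1])
    thus ?thesis using reg(2)[OF that(1)] that(2) by (auto simp: tangent_hyperplane_def hyperplane_def ev_def)
  qed
  have euler: "(\<Sum>i\<le>n. ev v (partial i F) * v i) = 0" if "P \<in> V" "v \<in> P" for P v
  proof -
    have "ev v F = 0" using reg(1)[OF that(1)] that(2)
      by (auto simp: regular_locus_def hypersurface_def zero_locus_def ev_def)
    thus ?thesis using euler_identity[OF assms(7), of v] by simp
  qed
  \<comment> \<open>Used with \<open>m = 1\<close> for Euler's identity and with \<open>m = q\<close> for the tangency condition.\<close>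
  have rel: "(\<Oplus>\<^bsub>K\<^esub>i\<in>{..<Suc n}. w i \<otimes>\<^bsub>K\<^esub> coord_fun n V j i [^]\<^bsub>K\<^esub> m) = \<zero>\<^bsub>K\<^esub>"
    if z: "\<And>P v. P \<in> V \<Longrightarrow> v \<in> P \<Longrightarrow> (\<Sum>i\<le>n. ev v (partial i F) * v i ^ m) = 0" for m :: nat
  proof -
    let ?H = "partial i0 F * X_var j ^ m"
    have hX: "homogeneous n m (X_var i ^ m :: 'k mpoly)" if "i \<le> n" for i
      using homogeneous_power[OF homogeneous_X_var[OF that], of m] by simp
    have hG: "homogeneous n (d' + m) (partial i F * X_var i ^ m)" if "i \<le> n" for i
      using hp[OF that] hX[OF that] by blast
    have f: "(partial i F * X_var i ^ m, ?H) \<in> fractions n V" if "i \<le> n" for i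
      using fractions_mult[OF wf[OF that] ratio_power(1)[OF yf[OF that]]] .
    have t: "w i \<otimes>\<^bsub>K\<^esub> coord_fun n V j i [^]\<^bsub>K\<^esub> m = ratio n V (partial i F * X_var i ^ m) ?H" if "i \<le> n" for i
      unfolding w_def coord_fun_def ratio_power(2)[OF yf[OF that]]
      by (rule ratio_mult[OF wf[OF that] ratio_power(1)[OF yf[OF that]]])
    have H: "homogeneous n (d' + m) ?H" "\<not> vanishes_on ?H V"
      using hp[OF i0(1)] hX[OF j(1)] f[OF j(1)] by (auto simp: fractions_def)
    have "(\<Oplus>\<^bsub>K\<^esub>i\<in>{..<Suc n}. w i \<otimes>\<^bsub>K\<^esub> coord_fun n V j i [^]\<^bsub>K\<^esub> m)
        = (\<Oplus>\<^bsub>K\<^esub>i\<in>{..<Suc n}. ratio n V (partial i F * X_var i ^ m) ?H)"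
      using t f by (intro K.finsum_cong') auto
    also have "\<dots> = ratio n V (\<Sum>i<Suc n. partial i F * X_var i ^ m) ?H"
      using hG H by (intro ratio_sum) auto
    also have "\<dots> = \<zero>\<^bsub>K\<^esub>"
    proof -
      have hs: "homogeneous n (d' + m) (\<Sum>i<k. partial i F * X_var i ^ m)" if "k \<le> Suc n" for k
        using that by (induction k) (auto intro!: homogeneous_add hG)
      have "((\<Sum>i<Suc n. partial i F * X_var i ^ m), ?H) \<in> fractions n V" 
        using hs[OF order_refl] H by (rule fractionsI)
      moreover have "vanishes_on (\<Sum>i<Suc n. partial i F * X_var i ^ m) V"
        using z unfolding vanishes_on_ev lessThan_Suc_atMost by (simp add: ev_sum)
      ultimately show ?thesis using ratio_zero_iff by blast
    qed
    finally show ?thesis .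
  qed
  have yR: "coord_fun n V j i \<in> carrier K" if "i \<le> n" for i
    unfolding coord_fun_def using yf[OF that] by auto
  have rel1: "(\<Oplus>\<^bsub>K\<^esub>i\<in>{..<Suc n}. w i \<otimes>\<^bsub>K\<^esub> coord_fun n V j i) = \<zero>\<^bsub>K\<^esub>"
  proof -
    have "(\<Oplus>\<^bsub>K\<^esub>i\<in>{..<Suc n}. w i \<otimes>\<^bsub>K\<^esub> coord_fun n V j i) = (\<Oplus>\<^bsub>K\<^esub>i\<in>{..<Suc n}. w i \<otimes>\<^bsub>K\<^esub> coord_fun n V j i [^]\<^bsub>K\<^esub> (1::nat))"
      using yR wR by (intro K.finsum_cong') auto
    also have "\<dots> = \<zero>\<^bsub>K\<^esub>" by (rule rel) (use euler in simp)
    finally show ?thesis .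
  qed
  have "ring_det K (Suc n) (frobenius_matrix K q (coord_fun n V j) D [0..<n]) = \<zero>\<^bsub>K\<^esub>"
  proof (rule K.frobenius_det_zero_if_inseparable[OF hasse constants_subfield sepz perfect L CL _ wL i0(1) w0 yR rel1 rel])
    show "\<not> separable_extension K L" using insep by (simp add: gauss_map_inseparable_def L_def)
  qed (use tang assms(1,3) in auto)
  with det show False by contradiction
qed

end
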